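(* Let $n\geq 2$, let $\Omega\subset\mathbb{R}^n$ be a bounded open Lipschitz set and let $\lambda\in C^{1}(\partial\Omega)^n$ be such that $\lambda\neq 0$ on $\partial\Omega$ (i.e. $\lambda(x)\neq 0$ for every $x\in\partial\Omega$). Then there exists a constant $C=C(\Omega,\lambda)$ such that $$\|\nabla\omega\|_{L^2(\Omega)}^2\leq C\left(\|\operatorname{curl}\omega\|_{L^2(\Omega)}^2+ \|\operatorname{div}\omega\|_{L^2(\Omega)}^2+\|\omega\|_{L^2(\Omega)}^2\right)$$ for all $\omega\in H^1(\Omega)^n$ which satisfy $$\lambda\times\omega=0\quad\text{ on }\partial\Omega.$$ If $n=2$, then the same conclusion holds under the weaker regularity assumption $\lambda\in C^{0,1}(\partial\Omega)^2$ (still with $\lambda\neq 0$ on $\partial\Omega$).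
   Context: A Lipschitz set is an open set $\Omega$ whose boundary $\partial\Omega$ is Lipschitz. For an integer $r\ge 0$ and $0\le\alpha\le 1$, a function $\lambda:\partial\Omega\to\mathbb{R}$ is said to be in $C^{r,\alpha}(\partial\Omega)$ if it has an extension to $\mathbb{R}^n$ which belongs to $C^{r,\alpha}(\mathbb{R}^n)$; by convention $C^{r,0}=C^r$. $C^{r,\alpha}(\partial\Omega)^n$ denotes vector fields with components in $C^{r,\alpha}(\partial\Omega)$; $C^{0,1}$ means Lipschitz. For vector fields $\omega=(\omega_1,\dots,\omega_n)$ and $\lambda=(\lambda_1,\dots,\lambda_n)$, the curl and the cross product are the vectors in $\mathbb{R}^{\binom n2}$ with components $$(\operatorname{curl}\omega)_{ij}=\frac{\partial\omega_j}{\partial x_i}-\frac{\partial\omega_i}{\partial x_j},\qquad (\omega\times\lambda)_{ij}=\omega_i\lambda_j-\omega_j\lambda_i,\qquad 1\le i<j\le n,$$ and $\operatorname{div}\omega=\sum_i\partial\omega_i/\partial x_i$. $H^1(\Omega)^n$ is the Sobolev space of vector fields whose components and their first (weak) derivatives are in $L^2(\Omega)$. Boundary conditions on $H^1$ vector fields are understood in the sense of traces. $C=C(\Omega,\lambda)$ means that $C$ depends on $\Omega$ and $\lambda$ but not on $\omega$. *)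

theory Defs
  imports "HOL-Analysis.Analysis"
begin

section \<open>Classical differentiability\<close>

definition partial :: "'n::finite \<Rightarrow> (real^'n \<Rightarrow> real) \<Rightarrow> real^'n \<Rightarrow> real" where
  "partial i f x = frechet_derivative f (at x) (axis i 1)"

text \<open>The class \<open>C\<^sup>r\<^sup>,\<^sup>\<alpha>\<close> on the whole space; for \<open>\<alpha> = 0\<close> it is \<open>C\<^sup>r\<close>, and for \<open>r = 0\<close>,
  \<open>\<alpha> = 1\<close> it is the class of globally Lipschitz functions. Membership puts no bound on the
  functions at infinity; this is immaterial for the traces on compact sets considered below.\<close>

primrec C_class :: "nat \<Rightarrow> real \<Rightarrow> (real^'n::finite \<Rightarrow> real) \<Rightarrow> bool" where
  "C_class 0 \<alpha> f \<longleftrightarrow>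
     continuous_on UNIV f \<and> (\<alpha> > 0 \<longrightarrow> (\<exists>L. \<forall>x y. \<bar>f x - f y\<bar> \<le> L * dist x y powr \<alpha>))"
| "C_class (Suc r) \<alpha> f \<longleftrightarrow>
     (\<forall>x. f differentiable (at x)) \<and> (\<forall>i. C_class r \<alpha> (partial i f))"

definition smooth_fun :: "(real^'n::finite \<Rightarrow> real) \<Rightarrow> bool" where
  "smooth_fun f \<longleftrightarrow> (\<forall>r. C_class r 0 f)"

definition C_class_on :: "nat \<Rightarrow> real \<Rightarrow> (real^'n::finite) set \<Rightarrow> (real^'n \<Rightarrow> real) \<Rightarrow> bool" where
  "C_class_on r \<alpha> S f \<longleftrightarrow> (\<exists>F. C_class r \<alpha> F \<and> (\<forall>x\<in>S. F x = f x))"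

definition C_field_on :: "nat \<Rightarrow> real \<Rightarrow> (real^'n::finite) set \<Rightarrow> (real^'n \<Rightarrow> real^'n) \<Rightarrow> bool" where
  "C_field_on r \<alpha> S v \<longleftrightarrow> (\<forall>i. C_class_on r \<alpha> S (\<lambda>x. v x $ i))"

section \<open>Lipschitz sets\<close>

text \<open>Near each boundary point the set is, after a rotation taking \<open>e\<close> to the last coordinate
  direction, the strict epigraph of a Lipschitz function on the hyperplane orthogonal to \<open>e\<close>.\<close>

definition lipschitz_set :: "(real^'n::finite) set \<Rightarrow> bool" where
  "lipschitz_set \<Omega> \<longleftrightarrow> open \<Omega> \<and>
     (\<forall>p\<in>frontier \<Omega>. \<exists>r>0. \<exists>e L g. norm e = 1 \<and> L-lipschitz_on {y. y \<bullet> e = 0} g \<and>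
        \<Omega> \<inter> ball p r = {x \<in> ball p r. g (x - (x \<bullet> e) *\<^sub>R e) < x \<bullet> e})"

section \<open>Square integrable functions\<close>

text \<open>The squared norm is \<open>\<infinity>\<close> when the function is not square integrable. For matrix-valued
  functions \<open>norm\<close> is the Euclidean (Frobenius) norm.\<close>

definition L2_normsq :: "'a measure \<Rightarrow> ('a \<Rightarrow> 'b::real_normed_vector) \<Rightarrow> ennreal" where
  "L2_normsq M u = (\<integral>\<^sup>+ x. ennreal ((norm (u x))\<^sup>2) \<partial>M)"

definition L2 :: "'a measure \<Rightarrow> ('a \<Rightarrow> real) \<Rightarrow> bool" where
  "L2 M u \<longleftrightarrow> u \<in> borel_measurable M \<and> L2_normsq M u < \<infinity>"

section \<open>Weak derivatives and the Sobolev space of order one\<close>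

definition test_fun :: "(real^'n::finite) set \<Rightarrow> (real^'n \<Rightarrow> real) \<Rightarrow> bool" where
  "test_fun \<Omega> \<phi> \<longleftrightarrow> smooth_fun \<phi> \<and> compact (closure {x. \<phi> x \<noteq> 0}) \<and> closure {x. \<phi> x \<noteq> 0} \<subseteq> \<Omega>"

definition locally_integrable :: "(real^'n::finite) set \<Rightarrow> (real^'n \<Rightarrow> real) \<Rightarrow> bool" where
  "locally_integrable \<Omega> u \<longleftrightarrow> (\<forall>K. compact K \<and> K \<subseteq> \<Omega> \<longrightarrow> integrable (lebesgue_on K) u)"

definition has_weak_partial ::
    "(real^'n::finite) set \<Rightarrow> 'n \<Rightarrow> (real^'n \<Rightarrow> real) \<Rightarrow> (real^'n \<Rightarrow> real) \<Rightarrow> bool" where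
  "has_weak_partial \<Omega> i u g \<longleftrightarrow> locally_integrable \<Omega> u \<and> locally_integrable \<Omega> g \<and>
     (\<forall>\<phi>. test_fun \<Omega> \<phi> \<longrightarrow>
        (LINT x|lebesgue_on \<Omega>. u x * partial i \<phi> x) = - (LINT x|lebesgue_on \<Omega>. g x * \<phi> x))"

text \<open>For open \<open>\<Omega>\<close> the weak derivative is unique up to null sets, so any choice will do.\<close>

definition weak_partial :: "(real^'n::finite) set \<Rightarrow> 'n \<Rightarrow> (real^'n \<Rightarrow> real) \<Rightarrow> real^'n \<Rightarrow> real" where
  "weak_partial \<Omega> i u = (SOME g. has_weak_partial \<Omega> i u g)"

definition H1 :: "(real^'n::finite) set \<Rightarrow> (real^'n \<Rightarrow> real) \<Rightarrow> bool" where
  "H1 \<Omega> u \<longleftrightarrow> L2 (lebesgue_on \<Omega>) u \<and>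
     (\<forall>i. (\<exists>g. has_weak_partial \<Omega> i u g) \<and> L2 (lebesgue_on \<Omega>) (weak_partial \<Omega> i u))"

definition H1_field :: "(real^'n::finite) set \<Rightarrow> (real^'n \<Rightarrow> real^'n) \<Rightarrow> bool" where
  "H1_field \<Omega> \<omega> \<longleftrightarrow> (\<forall>i. H1 \<Omega> (\<lambda>x. \<omega> x $ i))"

section \<open>Gradient, divergence, curl and cross product\<close>

definition grad_field :: "(real^'n::finite) set \<Rightarrow> (real^'n \<Rightarrow> real^'n) \<Rightarrow> real^'n \<Rightarrow> real^'n^'n" where
  "grad_field \<Omega> \<omega> x = (\<chi> i j. weak_partial \<Omega> j (\<lambda>y. \<omega> y $ i) x)"

definition div_field :: "(real^'n::finite) set \<Rightarrow> (real^'n \<Rightarrow> real^'n) \<Rightarrow> real^'n \<Rightarrow> real" where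
  "div_field \<Omega> \<omega> x = (\<Sum>i\<in>UNIV. weak_partial \<Omega> i (\<lambda>y. \<omega> y $ i) x)"

text \<open>A vector indexed by the pairs \<open>i < j\<close> is stored as a strictly upper triangular matrix,
  whose norm is the Euclidean norm of that vector.\<close>

definition curl_field ::
    "(real,'n::{finite,linorder}) vec set \<Rightarrow> ((real,'n) vec \<Rightarrow> (real,'n) vec) \<Rightarrow>
       (real,'n) vec \<Rightarrow> ((real,'n) vec,'n) vec" where
  "curl_field \<Omega> \<omega> x =
     (\<chi> i j. if i < j
             then weak_partial \<Omega> i (\<lambda>y. \<omega> y $ j) x - weak_partial \<Omega> j (\<lambda>y. \<omega> y $ i) x
             else 0)"

definition cross_prod ::
    "(real,'n::{finite,linorder}) vec \<Rightarrow> (real,'n) vec \<Rightarrow> ((real,'n) vec,'n) vec" where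
  "cross_prod v w = (\<chi> i j. if i < j then v $ i * w $ j - v $ j * w $ i else 0)"

section \<open>Surface measure and traces\<close>

text \<open>The \<open>d\<close>-dimensional Hausdorff measure, normalised to agree with Lebesgue measure. Its
  restriction to the Borel sets is countably additive because the outer measure is a metric one.\<close>

definition hausdorff_content :: "nat \<Rightarrow> real \<Rightarrow> ('a::metric_space) set \<Rightarrow> ennreal" where
  "hausdorff_content d \<delta> A =
     (INF U \<in> {U :: nat \<Rightarrow> 'a set. A \<subseteq> (\<Union>k. U k) \<and> (\<forall>k. bounded (U k) \<and> diameter (U k) \<le> \<delta>)}.
        \<Sum>k. if U k = {} then 0 else ennreal (unit_ball_vol (real d) * (diameter (U k) / 2) ^ d))"

definition hausdorff_outer :: "nat \<Rightarrow> ('a::metric_space) set \<Rightarrow> ennreal" where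
  "hausdorff_outer d A = (SUP \<delta> \<in> {0<..}. hausdorff_content d \<delta> A)"

definition hausdorff_measure :: "nat \<Rightarrow> ('a::metric_space) measure" where
  "hausdorff_measure d = measure_of UNIV (sets borel) (hausdorff_outer d)"

definition boundary_measure :: "(real^'n::finite) set \<Rightarrow> (real^'n) measure" where
  "boundary_measure \<Omega> = restrict_space (hausdorff_measure (CARD('n) - 1)) (frontier \<Omega>)"

text \<open>The trace operator is the continuous extension, from \<open>H\<^sup>1(\<Omega>)\<close> to \<open>L\<^sup>2(\<partial>\<Omega>)\<close>, of the
  restriction map on the functions smooth up to the boundary, which are dense in \<open>H\<^sup>1(\<Omega>)\<close> for
  bounded Lipschitz \<open>\<Omega>\<close>. The relation below is its graph.\<close>

definition has_trace ::
    "(real^'n::finite) set \<Rightarrow> (real^'n \<Rightarrow> real) \<Rightarrow> (real^'n \<Rightarrow> real) \<Rightarrow> bool" where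
  "has_trace \<Omega> u t \<longleftrightarrow> L2 (boundary_measure \<Omega>) t \<and>
     (\<exists>\<phi> :: nat \<Rightarrow> real^'n \<Rightarrow> real. (\<forall>k. smooth_fun (\<phi> k)) \<and>
        (\<lambda>k. L2_normsq (lebesgue_on \<Omega>) (\<lambda>x. \<phi> k x - u x)) \<longlonglongrightarrow> 0 \<and>
        (\<forall>i. (\<lambda>k. L2_normsq (lebesgue_on \<Omega>) (\<lambda>x. partial i (\<phi> k) x - weak_partial \<Omega> i u x)) \<longlonglongrightarrow> 0) \<and>
        (\<lambda>k. L2_normsq (boundary_measure \<Omega>) (\<lambda>x. \<phi> k x - t x)) \<longlonglongrightarrow> 0)"

definition has_trace_field ::
    "(real^'n::finite) set \<Rightarrow> (real^'n \<Rightarrow> real^'n) \<Rightarrow> (real^'n \<Rightarrow> real^'n) \<Rightarrow> bool" where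
  "has_trace_field \<Omega> \<omega> T \<longleftrightarrow> (\<forall>i. has_trace \<Omega> (\<lambda>x. \<omega> x $ i) (\<lambda>x. T x $ i))"

end

theory Submission
  imports Defs
begin

text \<open>
  Normalise \<open>l\<close> on the boundary, extend it to a Lipschitz field \<open>\<mu>\<close> with \<open>|\<mu>| \<le> 1\<close>, and
  split \<open>u = Q u + \<tau> u\<close> (\<open>par\<close> and \<open>perp\<close> below) with \<open>Q u = (u \<bullet> \<mu>) \<mu>\<close>. Pointwise,
  \<open>|\<nabla>u|\<^sup>2 - |curl u|\<^sup>2 - (div u)\<^sup>2\<close> is a quadratic null Lagrangian \<open>B(u, u)\<close>, so that
  \<open>\<integral>B(a, b)\<close> is controlled by the values of \<open>a\<close> or of \<open>b\<close> on the boundary and a Lipschitz bound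
  for the other field. For the given fields \<open>\<tau> u\<close> has zero trace, and in \<open>B(Q u, Q u)\<close> the terms with two
  derivatives of \<open>u \<bullet> \<mu>\<close> cancel; what remains is at most \<open>C |u| (|\<nabla>u| + |u|)\<close>.

  Since \<open>\<mu>\<close> is only Lipschitz, \<open>B\<close> is replaced by a form in difference quotients with step \<open>s\<close>, for
  which the divergence identity is exact and the cancellation holds up to \<open>O(s)\<close>, and
  \<open>s \<rightarrow> 0\<close> is taken with smooth \<open>u\<close>. The trace term needs a fixed second field \<open>w\<close>: the derivatives of the
  approximations \<open>u\<close> of \<open>\<omega>\<close> are not bounded on the boundary, hence first \<open>u \<rightarrow> \<omega>\<close> for fixed \<open>w\<close>,
  and then \<open>w \<rightarrow> \<omega>\<close>.
\<close>

section \<open>Hausdorff measure as a metric outer measure\<close>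

text \<open>The textbook route integrates by parts against the unit normal and is left with a
  curvature term, which asks for a smoother boundary and a divergence theorem. Only upper bounds for
  boundary terms are wanted here, and they come from volumes: the integral over
  \<open>\<Omega>\<close> of a difference quotient of step \<open>s\<close> is a difference of
  integrals over a translate and over \<open>\<Omega>\<close>, divided by \<open>s\<close>, hence
  lives on the layer between the two. That layer is swept from the frontier by a segment of length
  \<open>s\<close>, so its volume is at most a constant times \<open>s\<close> times the Hausdorff
  measure of the frontier. The local graphs enter through the finiteness of that measure.

  Two constants are kept apart. The one in front of curl, div, \<open>u\<close> and
  \<open>u - w\<close> depends on the dimension and on the Lipschitz constant of
  \<open>\<mu>\<close>. The one in front of the boundary integral of \<open>perp \<mu> u\<close>
  depends on difference quotients of \<open>w\<close> near the frontier, and no bound uniform in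
  \<open>w\<close> is available; it is harmless because for fixed \<open>w\<close> it multiplies a
  quantity that tends to 0.\<close>

lemma caratheodory_criterion:
  fixes f :: "'a::metric_space set \<Rightarrow> ennreal"
  assumes oms: "outer_measure_space (Pow UNIV) f"
    and metric: "\<And>A B r. r > 0 \<Longrightarrow> (\<forall>x\<in>A. \<forall>y\<in>B. r \<le> dist x y) \<Longrightarrow> f A + f B \<le> f (A \<union> B)"
    and "closed F"
  shows "f (E \<inter> F) + f (E - F) \<le> f E"
proof (cases "f E = \<infinity> \<or> F = {}")
  case True
  moreover have "f {} = 0"
    using oms by (auto simp: outer_measure_space_def positive_def)
  ultimately show ?thesis by auto
next
  case False
  have mono: "f A \<le> f B" if "A \<subseteq> B" for A B
    using oms that by (auto simp: outer_measure_space_def increasing_def)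
  have f0: "f {} = 0"
    using oms by (auto simp: outer_measure_space_def positive_def)
  have csub: "f (\<Union>i. A i) \<le> (\<Sum>i. f (A i))" if "disjoint_family A" for A :: "nat \<Rightarrow> 'a set"
    using oms that by (auto simp: outer_measure_space_def countably_subadditive_def)
  have sub2: "f (A \<union> B) \<le> f A + f B" for A B
  proof -
    have "subadditive (Pow UNIV) f"
      using oms ring_of_sets.countably_subadditive_subadditive[OF ring_of_sets_Pow, of UNIV f]
      by (auto simp: outer_measure_space_def)
    then have "f (A \<union> (B - A)) \<le> f A + f (B - A)"
      unfolding subadditive_def by blast
    also have "\<dots> \<le> f A + f B" by (intro add_left_mono mono) auto
    finally show ?thesis by simp
  qed
  \<comment> \<open>The sets \<open>S n\<close> exhaust \<open>E - F\<close> and keep a positive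
    distance from \<open>F\<close>, so the metric inequality applies to \<open>S n\<close> and
    \<open>E \<inter> F\<close>. It remains to see that the part of \<open>E - F\<close> outside
    \<open>S n\<close> becomes negligible; it is cut into the shells \<open>R k\<close>, whose sizes
    form a convergent series.\<close>
  define S where "S n = {x\<in>E. 1 / real (Suc n) \<le> infdist x F}" for n
  define R where "R k = S (Suc k) - S k" for k
  have S_mono: "S m \<subseteq> S n" if "m \<le> n" for m n
  proof -
    have "1 / real (Suc n) \<le> 1 / real (Suc m)" using that by (intro frac_le) auto
    then show ?thesis unfolding S_def by fastforce
  qed
  have sep: "f A + f B \<le> f (A \<union> B)"
    if "s < t" "\<And>x. x \<in> A \<Longrightarrow> t \<le> infdist x F" "\<And>y. y \<in> B \<Longrightarrow> infdist y F \<le> s" for A B s t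
  proof (rule metric[of "t - s"])
    show "\<forall>x\<in>A. \<forall>y\<in>B. t - s \<le> dist x y"
    proof (intro ballI)
      fix x y assume "x \<in> A" "y \<in> B"
      then have "t \<le> infdist x F" "infdist y F \<le> s" using that by auto
      with infdist_triangle[of x F y] show "t - s \<le> dist x y" by linarith
    qed
  qed (use that in auto)
  \<comment> \<open>Shells of equal parity \<open>p\<close> are kept apart by the shell in between,
    so their sizes add up to at most \<open>f E\<close>; adjacent shells may touch. The two parities
    together give the factor 2 below.\<close>
  have par: "(\<Sum>k<m. f (R (2 * k + p))) \<le> f (\<Union>k<m. R (2 * k + p))" for m p
  proof (induction m)
    case (Suc m)
    let ?A = "\<Union>k<m. R (2 * k + p)" and ?B = "R (2 * m + p)"
    have "f ?A + f ?B \<le> f (?A \<union> ?B)"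
    \<comment> \<open>For \<open>2 * m + p = 0\<close> the union is empty, whereas the separation
      bound \<open>1 / real (2 * m + p)\<close> would degenerate to 0.\<close>
    proof (cases "2 * m + p = 0")
      case True
      then show ?thesis by (simp add: f0)
    next
      case ne: False
      show ?thesis
      proof (rule sep[of "1 / real (Suc (2 * m + p))" "1 / real (2 * m + p)"])
        show "1 / real (Suc (2 * m + p)) < 1 / real (2 * m + p)"
          using ne by (intro divide_strict_left_mono) auto
      next
        fix x assume "x \<in> ?A"
        then obtain k where k: "k < m" "x \<in> R (2 * k + p)" by auto
        then have "x \<in> S (Suc (2 * k + p))" by (auto simp: R_def)
        also have "\<dots> \<subseteq> S (2 * m + p - 1)" using k by (intro S_mono) auto
        finally show "1 / real (2 * m + p) \<le> infdist x F" using ne by (auto simp: S_def)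
      next
        fix x assume "x \<in> ?B"
        then show "infdist x F \<le> 1 / real (Suc (2 * m + p))" by (auto simp: R_def S_def)
      qed
    qed
    with Suc have "(\<Sum>k<Suc m. f (R (2 * k + p))) \<le> f (?A \<union> ?B)"
      by (auto intro: order_trans add_right_mono)
    also have "?A \<union> ?B = (\<Union>k<Suc m. R (2 * k + p))" by (auto simp: less_Suc_eq)
    finally show ?case .
  qed (simp add: f0)
  have par': "(\<Sum>k<m. f (R (2 * k + p))) \<le> f E" for m p
    by (rule order_trans[OF par mono]) (auto simp: R_def S_def)
  have sumb: "(\<Sum>k<m. f (R k)) \<le> 2 * f E" for m
  proof -
    have "(\<Sum>k<m. f (R k)) \<le> (\<Sum>k<2*m. f (R k))"
      by (intro sum_mono2) auto
    also have "(\<Sum>k<2*m. f (R k)) = (\<Sum>k<m. f (R (2*k+0))) + (\<Sum>k<m. f (R (2*k+1)))"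
      by (induction m) (auto simp: algebra_simps)
    also have "\<dots> \<le> f E + f E" by (intro add_mono par')
    finally show ?thesis by (simp add: mult_2)
  qed
  have fin: "f (R k) < \<infinity>" for k
  proof -
    have "f (R k) \<le> f E" by (rule mono) (auto simp: R_def S_def)
    with False show ?thesis by (auto simp: top.not_eq_extremum intro: order_le_less_trans)
  qed
  define r where "r k = enn2real (f (R k))" for k
  have r: "f (R k) = ennreal (r k)" "0 \<le> r k" for k
    using fin by (auto simp: r_def)
  have "2 * f E \<noteq> \<infinity>" using False by (auto simp: ennreal_mult_eq_top_iff)
  then obtain c where c: "2 * f E = ennreal c" "c \<ge> 0" by (cases "2 * f E") auto
  have "summable r"
  proof (rule bounded_imp_summable[where B = c])
    fix n
    have "ennreal (sum r {..n}) = (\<Sum>k\<le>n. ennreal (r k))"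
      by (rule sum_ennreal[symmetric]) (use r in auto)
    also have "\<dots> = (\<Sum>k<Suc n. f (R k))" by (simp only: r lessThan_Suc_atMost)
    also have "\<dots> \<le> ennreal c" using sumb c by metis
    finally show "sum r {..n} \<le> c" using c by simp
  qed (rule r)
  have E_minus: "E - F \<subseteq> S n \<union> (\<Union>k. R (k + n))" for n
  proof
    fix x assume x: "x \<in> E - F"
    \<comment> \<open>\<open>infdist\<close> to the empty set is 0 by convention, hence the separate
      case \<open>F = {}\<close>.\<close>
    then have "0 < infdist x F"
      using False \<open>closed F\<close> in_closed_iff_infdist_zero[of F x] infdist_nonneg[of x F] by (auto simp: less_le)
    then obtain m where "inverse (real (Suc m)) < infdist x F"
      using reals_Archimedean by blast
    then have m: "x \<in> S m" using x by (auto simp: S_def divide_simps)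
    define m0 where "m0 = (LEAST m. x \<in> S m)"
    have m0: "x \<in> S m0" unfolding m0_def using m by (rule LeastI)
    show "x \<in> S n \<union> (\<Union>k. R (k + n))"
    proof (cases "m0 \<le> n")
      case True
      then show ?thesis using S_mono m0 by blast
    next
      case False
      then have "x \<notin> S (m0 - 1)" using not_less_Least[of "m0 - 1" "\<lambda>m. x \<in> S m"] by (simp add: m0_def)
      then have "x \<in> R (m0 - 1)" using m0 False by (auto simp: R_def)
      moreover have "m0 - 1 = (m0 - 1 - n) + n" using False by auto
      ultimately have "x \<in> R ((m0 - 1 - n) + n)" by simp
      then show ?thesis by blast
    qed
  qed
  have R_disj: "disjoint_family (\<lambda>k. R (k + n))" for n
  proof -
    have "R j \<inter> R k = {}" if "j < k" for j k
      using S_mono[of "Suc j" k] that by (auto simp: R_def)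
    then show ?thesis
      unfolding disjoint_family_on_def by (metis Int_commute add_right_cancel linorder_neqE_nat)
  qed
  show ?thesis
  proof (rule ennreal_le_epsilon)
    fix e :: real assume "e > 0" "f E < top"
    obtain n where n: "\<bar>\<Sum>k. r (k + n)\<bar> < e"
      using suminf_exist_split[OF \<open>e > 0\<close> \<open>summable r\<close>] by auto
    have "f (\<Union>k. R (k + n)) \<le> (\<Sum>k. f (R (k + n)))" by (rule csub[OF R_disj])
    also have "\<dots> = ennreal (\<Sum>k. r (k + n))"
      using \<open>summable r\<close> by (simp add: r suminf_ennreal2 summable_iff_shift)
    also have "\<dots> \<le> ennreal e" using n by (intro ennreal_leI) auto
    finally have tail: "f (\<Union>k. R (k + n)) \<le> ennreal e" .
    have "f (E \<inter> F) + f (E - F) \<le> f (E \<inter> F) + (f (S n) + f (\<Union>k. R (k + n)))"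
      by (intro add_left_mono order_trans[OF mono[OF E_minus] sub2])
    also have "\<dots> \<le> (f (S n) + f (E \<inter> F)) + ennreal e"
      using tail by (simp add: ac_simps add_left_mono)
    also have "f (S n) + f (E \<inter> F) \<le> f (S n \<union> (E \<inter> F))"
      by (rule sep[of 0 "1 / real (Suc n)"]) (auto simp: S_def)
    also have "\<dots> \<le> f E" by (rule mono) (auto simp: S_def)
    finally show "f (E \<inter> F) + f (E - F) \<le> f E + ennreal e" by (simp add: add_right_mono)
  qed
qed

text \<open>By the criterion closed sets are measurable in the sense of Caratheodory; as they
  generate the Borel sets, the Caratheodory measure restricts to these.\<close>

lemma metric_outer_measure_space_borel:
  fixes f :: "'a::metric_space set \<Rightarrow> ennreal"
  assumes oms: "outer_measure_space (Pow UNIV) f"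
    and metric: "\<And>A B r. r > 0 \<Longrightarrow> (\<forall>x\<in>A. \<forall>y\<in>B. r \<le> dist x y) \<Longrightarrow> f A + f B \<le> f (A \<union> B)"
  shows "measure_space UNIV (sets borel) f"
proof (rule measure_down)
  show ms: "measure_space UNIV (lambda_system UNIV (Pow UNIV) f) f"
    by (rule sigma_algebra.caratheodory_lemma[OF sigma_algebra_Pow oms])
  show "sigma_algebra UNIV (sets (borel :: 'a measure))"
    using sets.sigma_algebra_axioms[of "borel :: 'a measure"] by simp
  have sub: "f E \<le> f (E \<inter> F) + f (E - F)" for E F
  proof -
    have "subadditive (Pow UNIV) f"
      using oms ring_of_sets.countably_subadditive_subadditive[OF ring_of_sets_Pow, of UNIV f]
      by (auto simp: outer_measure_space_def)
    then have "f ((E \<inter> F) \<union> (E - F)) \<le> f (E \<inter> F) + f (E - F)"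
      by (rule subadditiveD) auto
    then show ?thesis by (simp add: Int_Diff_Un)
  qed
  have closed: "F \<in> lambda_system UNIV (Pow UNIV) f" if "closed F" for F
  proof -
    have "f (E \<inter> F) + f (E - F) = f E" for E
      by (rule antisym[OF caratheodory_criterion[OF oms metric that] sub])
    then show ?thesis
      unfolding lambda_system_def by (simp add: Int_commute Diff_eq)
  qed
  have "sigma_sets UNIV {F :: 'a set. closed F} \<subseteq> lambda_system UNIV (Pow UNIV) f"
    by (rule sigma_algebra.sigma_sets_subset) (use ms closed in \<open>auto simp: measure_space_def\<close>)
  moreover have "sets (borel :: 'a measure) = sigma_sets UNIV {F :: 'a set. closed F}"
    unfolding borel_eq_closed by (simp add: sets_measure_of)
  ultimately show "sets (borel :: 'a measure) \<subseteq> lambda_system UNIV (Pow UNIV) f" by simp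
qed

section \<open>Hausdorff content and outer measure\<close>

abbreviation hausdorff_gauge :: "nat \<Rightarrow> 'a::metric_space set \<Rightarrow> ennreal" where
  "hausdorff_gauge d U \<equiv> (if U = {} then 0 else ennreal (unit_ball_vol (real d) * (diameter U / 2) ^ d))"

lemma hausdorff_content_le:
  assumes "A \<subseteq> (\<Union>k. U k)" "\<And>k. bounded (U k)" "\<And>k. diameter (U k) \<le> \<delta>"
  shows "hausdorff_content d \<delta> A \<le> (\<Sum>k. hausdorff_gauge d (U k))"
  unfolding hausdorff_content_def by (rule INF_lower) (use assms in auto)

lemma hausdorff_content_mono: "A \<subseteq> B \<Longrightarrow> hausdorff_content d \<delta> A \<le> hausdorff_content d \<delta> B"
  unfolding hausdorff_content_def by (rule INF_superset_mono) auto

lemma hausdorff_content_antimono: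
  "\<delta> \<le> \<delta>' \<Longrightarrow> hausdorff_content d \<delta>' A \<le> hausdorff_content d \<delta> A"
  unfolding hausdorff_content_def
  by (rule INF_superset_mono) (auto intro: order_trans)

lemma hausdorff_content_UN:
  fixes A :: "nat \<Rightarrow> 'a::metric_space set"
  shows "hausdorff_content d \<delta> (\<Union>i. A i) \<le> (\<Sum>i. hausdorff_content d \<delta> (A i))"
proof (rule ennreal_le_epsilon)
  fix e :: real assume e: "e > 0" and fin: "(\<Sum>i. hausdorff_content d \<delta> (A i)) < top"
  have finA: "hausdorff_content d \<delta> (A i) < top" for i
    by (rule ennreal_suminf_lessD[OF fin])
  \<comment> \<open>Covers of the \<open>A i\<close> that are optimal up to
    \<open>e / 2 ^ Suc i\<close>: the errors sum to \<open>e\<close>, and the double family of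
    covering sets is listed in the single sequence \<open>V\<close>.\<close>
  define G where "G i U \<longleftrightarrow> A i \<subseteq> (\<Union>k. U k) \<and> (\<forall>k. bounded (U k) \<and> diameter (U k) \<le> \<delta>) \<and>
      (\<Sum>k. hausdorff_gauge d (U k)) \<le> hausdorff_content d \<delta> (A i) + ennreal (e * (1/2)^Suc i)"
    for i and U :: "nat \<Rightarrow> 'a set"
  have "\<exists>U. G i U" for i
  proof -
    have "hausdorff_content d \<delta> (A i) < hausdorff_content d \<delta> (A i) + ennreal (e * (1/2)^Suc i)"
      using finA[of i] e
      by (cases "hausdorff_content d \<delta> (A i)") (auto simp: ennreal_less_iff simp flip: ennreal_plus)
    then show ?thesis
      unfolding hausdorff_content_def[of d \<delta> "A i"] INF_less_iff G_def
      by (auto simp: hausdorff_content_def[of d \<delta> "A i"] intro: less_imp_le)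
  qed
  then obtain U where G: "\<And>i. G i (U i)" by metis
  have U: "\<And>i. A i \<subseteq> (\<Union>k. U i k)" "\<And>i k. bounded (U i k)" "\<And>i k. diameter (U i k) \<le> \<delta>"
      "\<And>i. (\<Sum>k. hausdorff_gauge d (U i k)) \<le> hausdorff_content d \<delta> (A i) + ennreal (e * (1/2)^Suc i)"
    using G unfolding G_def by blast+
  define V where "V n = (case prod_decode n of (i, k) \<Rightarrow> U i k)" for n
  have "hausdorff_content d \<delta> (\<Union>i. A i) \<le> (\<Sum>n. hausdorff_gauge d (V n))"
  proof (rule hausdorff_content_le)
    show "(\<Union>i. A i) \<subseteq> (\<Union>n. V n)"
    proof
      fix x assume "x \<in> (\<Union>i. A i)"
      then obtain i k where "x \<in> U i k" using U(1) by blast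
      then have "x \<in> V (prod_encode (i, k))" by (simp add: V_def)
      then show "x \<in> (\<Union>n. V n)" by blast
    qed
  qed (use U in \<open>auto simp: V_def split: prod.splits\<close>)
  also have "\<dots> = (\<Sum>i. \<Sum>k. hausdorff_gauge d (U i k))"
  proof -
    define h where "h X = hausdorff_gauge d X" for X :: "'a set"
    have "(\<Sum>n. h (V n)) = (\<Sum>i. \<Sum>k. h (U i k))"
      using suminf_ennreal_2dimen[of "\<lambda>i. \<Sum>k. h (U i k)" "\<lambda>p. h (U (fst p) (snd p))"]
      by (simp add: V_def case_prod_beta)
    then show ?thesis unfolding h_def .
  qed
  also have "\<dots> \<le> (\<Sum>i. hausdorff_content d \<delta> (A i) + ennreal (e * (1/2)^Suc i))"
    by (intro suminf_le U) auto
  also have "\<dots> = (\<Sum>i. hausdorff_content d \<delta> (A i)) + (\<Sum>i. ennreal (e * (1/2)^Suc i))"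
    by (rule suminf_add[symmetric]) auto
  also have "(\<Sum>i. ennreal (e * (1/2)^Suc i)) = ennreal e"
  proof -
    have "(\<lambda>i. e * (1/2)^Suc i) sums e"
      using sums_mult[OF power_half_series, of e] by simp
    then show ?thesis using e by (intro suminf_ennreal_eq) auto
  qed
  finally show "hausdorff_content d \<delta> (\<Union>i. A i) \<le> (\<Sum>i. hausdorff_content d \<delta> (A i)) + ennreal e" .
qed

lemma hausdorff_content_le_outer: "\<delta> > 0 \<Longrightarrow> hausdorff_content d \<delta> A \<le> hausdorff_outer d A"
  unfolding hausdorff_outer_def by (rule SUP_upper) auto

lemma hausdorff_content_empty: "\<delta> \<ge> 0 \<Longrightarrow> hausdorff_content d \<delta> {} = 0"
  using hausdorff_content_le[of "{}" "\<lambda>_. {}" \<delta> d] by auto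

lemma outer_measure_space_hausdorff_outer:
  "outer_measure_space (Pow UNIV) (hausdorff_outer d :: 'a::metric_space set \<Rightarrow> ennreal)"
  unfolding outer_measure_space_def
proof (intro conjI)
  show "positive (Pow UNIV) (hausdorff_outer d :: 'a set \<Rightarrow> ennreal)"
    by (auto simp: positive_def hausdorff_outer_def hausdorff_content_empty)
  show "increasing (Pow UNIV) (hausdorff_outer d :: 'a set \<Rightarrow> ennreal)"
    unfolding increasing_def hausdorff_outer_def
    by (auto intro!: SUP_mono' hausdorff_content_mono)
  have "hausdorff_outer d (\<Union>i. A i) \<le> (\<Sum>i. hausdorff_outer d (A i))"
    for A :: "nat \<Rightarrow> 'a set"
  proof -
    have "hausdorff_content d \<delta> (\<Union>i. A i) \<le> (\<Sum>i. hausdorff_outer d (A i))" if "\<delta> > 0" for \<delta>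
      by (rule order_trans[OF hausdorff_content_UN])
         (intro suminf_le hausdorff_content_le_outer that; simp)
    then show ?thesis unfolding hausdorff_outer_def[of d "\<Union>i. A i"] by (auto intro: SUP_least)
  qed
  then show "countably_subadditive (Pow UNIV) (hausdorff_outer d :: 'a set \<Rightarrow> ennreal)"
    by (auto simp: countably_subadditive_def)
qed

text \<open>A set of diameter at most \<open>\<delta> < r\<close> cannot meet both \<open>A\<close>
  and \<open>B\<close>, so every admissible cover of the union splits into a cover of
  \<open>A\<close> and a cover of \<open>B\<close>.\<close>

lemma hausdorff_content_separated:
  assumes "\<delta> < r" "\<forall>x\<in>A. \<forall>y\<in>B. r \<le> dist x y"
  shows "hausdorff_content d \<delta> A + hausdorff_content d \<delta> B \<le> hausdorff_content d \<delta> (A \<union> B)"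
  unfolding hausdorff_content_def[of d \<delta> "A \<union> B"]
proof (rule INF_greatest)
  fix U :: "nat \<Rightarrow> 'a set"
  assume "U \<in> {U. A \<union> B \<subseteq> (\<Union>k. U k) \<and> (\<forall>k. bounded (U k) \<and> diameter (U k) \<le> \<delta>)}"
  then have U: "A \<union> B \<subseteq> (\<Union>k. U k)" "\<And>k. bounded (U k)" "\<And>k. diameter (U k) \<le> \<delta>" by auto
  have "0 \<le> \<delta>" using U(3) diameter_ge_0[OF U(2)] order_trans by blast
  \<comment> \<open>Members of the cover that miss \<open>X\<close> become empty instead of being
    dropped; the empty set has weight 0 even for \<open>d = 0\<close>.\<close>
  define V where "V X k = (if U k \<inter> X = {} then {} else U k)" for X k
  have V: "hausdorff_content d \<delta> X \<le> (\<Sum>k. hausdorff_gauge d (V X k))" if XAB: "X \<subseteq> A \<union> B" for X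
  proof (rule hausdorff_content_le)
    show "X \<subseteq> (\<Union>k. V X k)"
    proof
      fix x assume "x \<in> X"
      then obtain k where "x \<in> U k" using U(1) XAB by blast
      with \<open>x \<in> X\<close> have "x \<in> V X k" by (auto simp: V_def)
      then show "x \<in> (\<Union>k. V X k)" by blast
    qed
  qed (use U \<open>0 \<le> \<delta>\<close> in \<open>auto simp: V_def\<close>)
  have disj: "U k \<inter> A = {} \<or> U k \<inter> B = {}" for k
  proof (rule ccontr)
    assume "\<not> ?thesis"
    then obtain x y where "x \<in> U k" "x \<in> A" "y \<in> U k" "y \<in> B" by blast
    then have "r \<le> dist x y" "dist x y \<le> diameter (U k)"
      using assms diameter_bounded_bound[OF U(2)] by auto
    with U(3)[of k] assms(1) show False by linarith
  qed
  have "hausdorff_content d \<delta> A + hausdorff_content d \<delta> B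
      \<le> (\<Sum>k. hausdorff_gauge d (V A k)) + (\<Sum>k. hausdorff_gauge d (V B k))"
    by (intro add_mono V) auto
  also have "\<dots> = (\<Sum>k. hausdorff_gauge d (V A k) + hausdorff_gauge d (V B k))"
    by (rule suminf_add) auto
  also have "\<dots> \<le> (\<Sum>k. hausdorff_gauge d (U k))"
    using disj by (intro suminf_le) (auto simp: V_def)
  finally show "hausdorff_content d \<delta> A + hausdorff_content d \<delta> B \<le> (\<Sum>k. hausdorff_gauge d (U k))" .
qed

text \<open>The inequality for contents is available for \<open>\<delta> < r\<close>. The supremum
  is therefore taken along \<open>r / (n + 2)\<close>, which lies below \<open>r\<close> already for
  \<open>n = 0\<close>; along this decreasing sequence the contents increase, which lets the
  supremum commute with the sum.\<close>

lemma hausdorff_outer_separated: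
  assumes "r > 0" "\<forall>x\<in>A. \<forall>y\<in>B. r \<le> dist x y"
  shows "hausdorff_outer d A + hausdorff_outer d B \<le> hausdorff_outer d (A \<union> B)"
proof -
  have sup: "hausdorff_outer d X = (SUP n. hausdorff_content d (r / (real n + 2)) X)"
    for X :: "'a set"
    unfolding hausdorff_outer_def
  proof (rule antisym)
    show "(SUP \<delta>\<in>{0<..}. hausdorff_content d \<delta> X) \<le> (SUP n. hausdorff_content d (r / (real n + 2)) X)"
    proof (rule SUP_least)
      fix \<delta> :: real assume "\<delta> \<in> {0<..}"
      then obtain n :: nat where "r / \<delta> < real n" using reals_Archimedean2 by blast
      then have "r / (real n + 2) \<le> \<delta>"
        using \<open>\<delta> \<in> _\<close> assms(1) by (simp add: field_simps)
      then show "hausdorff_content d \<delta> X \<le> (SUP n. hausdorff_content d (r / (real n + 2)) X)"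
        by (intro SUP_upper2[of n] hausdorff_content_antimono) auto
    qed
    show "(SUP n. hausdorff_content d (r / (real n + 2)) X) \<le> (SUP \<delta>\<in>{0<..}. hausdorff_content d \<delta> X)"
      using assms(1) by (intro SUP_least SUP_upper) auto
  qed
  have inc: "incseq (\<lambda>n. hausdorff_content d (r / (real n + 2)) X)" for X :: "'a set"
    using assms(1) by (auto simp: incseq_def intro!: hausdorff_content_antimono divide_left_mono)
  show ?thesis
    unfolding sup ennreal_SUP_add[OF inc inc, symmetric]
    using assms by (intro SUP_mono' hausdorff_content_separated[OF _ assms(2)])
      (auto simp: field_simps add_pos_nonneg)
qed

text \<open>\<open>measure_of\<close> yields the zero measure unless it is given a measure, so this
  is what makes integrals over the frontier meaningful.\<close>

lemma measure_space_hausdorff: "measure_space UNIV (sets borel) (hausdorff_outer d)"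
  using outer_measure_space_hausdorff_outer hausdorff_outer_separated
  by (rule metric_outer_measure_space_borel)

lemma sets_hausdorff_measure [simp]: "sets (hausdorff_measure d :: 'a::metric_space measure) = sets borel"
  unfolding hausdorff_measure_def
  by (metis sets.sets_measure_of_eq space_borel)

lemma space_hausdorff_measure [simp]: "space (hausdorff_measure d) = UNIV"
  by (simp add: hausdorff_measure_def space_measure_of_conv)

lemma emeasure_hausdorff_measure:
  "A \<in> sets borel \<Longrightarrow> emeasure (hausdorff_measure d) A = hausdorff_outer d A"
  using measure_space_hausdorff[of d]
  by (intro emeasure_measure_of_sigma[of UNIV "sets borel" "hausdorff_outer d" A,
        folded hausdorff_measure_def]) (auto simp: measure_space_def)

section \<open>Volume of swept sets\<close>

lemma emeasure_cylinder_le: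
  fixes U :: "(real^'n::finite) set"
  assumes "bounded U" "diameter U \<le> \<rho>" "\<rho> > 0" "norm e \<le> 1" "s \<ge> 0"
  shows "emeasure lborel {x + t *\<^sub>R e |x t. x \<in> closure U \<and> t \<in> {0..s}}
    \<le> ennreal (unit_ball_vol (real CARD('n)) * 2 ^ CARD('n) * (s + \<rho>) * \<rho> ^ (CARD('n) - 1))"
proof (cases "U = {}")
  case False
  let ?n = "CARD('n)" and ?K = "{x + t *\<^sub>R e |x t. x \<in> closure U \<and> t \<in> {0..s}}"
  obtain x0 where x0: "x0 \<in> closure U" using False closure_subset by fastforce
  define m where "m = nat \<lfloor>s / \<rho>\<rfloor>"
  have "?K \<subseteq> (\<Union>k\<in>{..m}. cball (x0 + (real k * \<rho>) *\<^sub>R e) (2 * \<rho>))"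
  proof
    fix y assume "y \<in> ?K"
    then obtain x t where y: "y = x + t *\<^sub>R e" "x \<in> closure U" "0 \<le> t" "t \<le> s" by auto
    define k where "k = nat \<lfloor>t / \<rho>\<rfloor>"
    have "real k \<le> t / \<rho>" "t / \<rho> < real k + 1"
      using y \<open>\<rho> > 0\<close> by (auto simp: k_def)
    then have k: "\<bar>t - real k * \<rho>\<bar> \<le> \<rho>" using \<open>\<rho> > 0\<close> by (auto simp: field_simps abs_if)
    have "k \<le> m" unfolding k_def m_def using y \<open>\<rho> > 0\<close> by (intro nat_mono floor_mono divide_right_mono) auto
    have "dist x x0 \<le> \<rho>"
      using diameter_bounded_bound[of "closure U" x x0] y x0 assms by (simp add: bounded_closure diameter_closure)
    moreover have "\<bar>t - real k * \<rho>\<bar> * norm e \<le> \<rho> * 1"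
      using k \<open>norm e \<le> 1\<close> \<open>\<rho> > 0\<close> by (intro mult_mono) auto
    ultimately have "norm ((x - x0) + (t - real k * \<rho>) *\<^sub>R e) \<le> \<rho> + \<rho> * 1"
      by (intro norm_triangle_mono) (auto simp: dist_norm)
    then have "y \<in> cball (x0 + (real k * \<rho>) *\<^sub>R e) (2 * \<rho>)"
      by (simp add: y dist_norm norm_minus_commute algebra_simps)
    then show "y \<in> (\<Union>k\<in>{..m}. cball (x0 + (real k * \<rho>) *\<^sub>R e) (2 * \<rho>))" using \<open>k \<le> m\<close> by blast
  qed
  then have "emeasure lborel ?K \<le> emeasure lborel (\<Union>k\<in>{..m}. cball (x0 + (real k * \<rho>) *\<^sub>R e) (2 * \<rho>))"
    by (intro emeasure_mono) auto
  also have "\<dots> \<le> (\<Sum>k\<in>{..m}. emeasure lborel (cball (x0 + (real k * \<rho>) *\<^sub>R e) (2 * \<rho>)))"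
    by (intro emeasure_subadditive_finite) auto
  also have "\<dots> = (\<Sum>k\<in>{..m}. ennreal (unit_ball_vol (real ?n) * (2 * \<rho>) ^ ?n))"
    using \<open>\<rho> > 0\<close> by (simp add: emeasure_cball)
  also have "\<dots> = ennreal (\<Sum>k\<in>{..m}. unit_ball_vol (real ?n) * (2 * \<rho>) ^ ?n)"
    using \<open>\<rho> > 0\<close> by (intro sum_ennreal) auto
  also have "\<dots> = ennreal (real (m + 1) * (unit_ball_vol (real ?n) * (2 * \<rho>) ^ ?n))" by simp
  also have "\<dots> \<le> ennreal ((s / \<rho> + 1) * (unit_ball_vol (real ?n) * (2 * \<rho>) ^ ?n))"
    using \<open>\<rho> > 0\<close> \<open>s \<ge> 0\<close> by (intro ennreal_leI mult_right_mono) (auto simp: m_def)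
  also have "(s / \<rho> + 1) * (unit_ball_vol (real ?n) * (2 * \<rho>) ^ ?n)
      = unit_ball_vol (real ?n) * 2 ^ ?n * (s + \<rho>) * \<rho> ^ (?n - 1)"
  proof -
    have "\<rho> ^ ?n = \<rho> * \<rho> ^ (?n - 1)" by (metis power_eq_if zero_less_card_finite less_numeral_extra(3))
    then show ?thesis using \<open>\<rho> > 0\<close> by (simp add: power_mult_distrib field_simps)
  qed
  finally show ?thesis .
qed auto

text \<open>The diameter is 0 for a single point, and a covering by balls of that size makes no
  sense. The bound is the limit of those with \<open>\<rho>\<close> above the diameter.\<close>

lemma emeasure_cylinder_le_diameter:
  fixes U :: "(real^'n::finite) set"
  assumes "bounded U" "norm e \<le> 1" "s \<ge> 0"
  shows "emeasure lborel {x + t *\<^sub>R e |x t. x \<in> closure U \<and> t \<in> {0..s}}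
    \<le> ennreal (unit_ball_vol (real CARD('n)) * 2 ^ CARD('n) * (s + diameter U) * diameter U ^ (CARD('n) - 1))"
proof (rule tendsto_lowerbound)
  show "((\<lambda>\<rho>. ennreal (unit_ball_vol (real CARD('n)) * 2 ^ CARD('n) * (s + \<rho>) * \<rho> ^ (CARD('n) - 1)))
      \<longlongrightarrow> ennreal (unit_ball_vol (real CARD('n)) * 2 ^ CARD('n) * (s + diameter U) * diameter U ^ (CARD('n) - 1)))
      (at_right (diameter U))"
    by (intro tendsto_intros)
  show "\<forall>\<^sub>F \<rho> in at_right (diameter U).
      emeasure lborel {x + t *\<^sub>R e |x t. x \<in> closure U \<and> t \<in> {0..s}}
      \<le> ennreal (unit_ball_vol (real CARD('n)) * 2 ^ CARD('n) * (s + \<rho>) * \<rho> ^ (CARD('n) - 1))"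
    unfolding eventually_at_filter
    using diameter_ge_0[OF assms(1)]
    by (intro always_eventually allI impI emeasure_cylinder_le assms) auto
qed auto

text \<open>This is why closures are swept: the swept set is compact, hence Borel, for every bounded
  \<open>U\<close>, and passing to the closure does not change the diameter.\<close>

lemma compact_cylinder:
  fixes U :: "(real^'n::finite) set"
  assumes "bounded U"
  shows "compact {x + t *\<^sub>R e |x t. x \<in> closure U \<and> t \<in> {0..s}}"
proof -
  have "{x + t *\<^sub>R e |x t. x \<in> closure U \<and> t \<in> {0..s}} = (\<lambda>(x, t). x + t *\<^sub>R e) ` (closure U \<times> {0..s})"
    by (force simp: image_iff)
  also have "compact \<dots>"
    using assms by (intro compact_continuous_image compact_Times)
      (auto simp: case_prod_beta intro!: continuous_intros)
  finally show ?thesis .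
qed

text \<open>The first factors are the volume of a ball of radius \<open>2\<close>, the others undo the normalisation
  of the Hausdorff measure.\<close>

definition hausdorff_const :: "nat \<Rightarrow> real" where
  "hausdorff_const n = unit_ball_vol (real n) * 2 ^ n * 2 ^ (n - 1) / unit_ball_vol (real (n - 1))"

lemma hausdorff_const_pos: "hausdorff_const n > 0"
  by (simp add: hausdorff_const_def)

text \<open>Each member of a cover of \<open>A\<close> is swept separately; up to the constant it
  costs \<open>s + \<delta>\<close> times its weight in the Hausdorff sum. The estimate is linear in
  the weights, so it passes to the infimum over covers.\<close>

lemma emeasure_swept_le_content:
  fixes A S :: "(real^'n::finite) set"
  assumes "S \<subseteq> {a + t *\<^sub>R e |a t. a \<in> A \<and> t \<in> {0..s}}" "norm e \<le> 1" "s \<ge> 0" "\<delta> > 0"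
  shows "emeasure lborel S \<le> ennreal (hausdorff_const CARD('n) * (s + \<delta>)) * hausdorff_content (CARD('n) - 1) \<delta> A"
proof -
  let ?n = "CARD('n)"
  have *: "emeasure lborel S \<le> ennreal (hausdorff_const ?n * (s + \<delta>)) * (\<Sum>k. hausdorff_gauge (?n - 1) (U k))"
    if U: "A \<subseteq> (\<Union>k. U k)" "\<And>k. bounded (U k)" "\<And>k. diameter (U k) \<le> \<delta>" for U
  proof -
    define K where "K k = {x + t *\<^sub>R e |x t. x \<in> closure (U k) \<and> t \<in> {0..s}}" for k
    have K: "K k \<in> sets lborel" for k
      using compact_cylinder[OF U(2), where e = e and s = s] by (auto simp: K_def intro: borel_compact)
    have "S \<subseteq> (\<Union>k. K k)"
    proof
      fix y assume "y \<in> S"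
      then obtain a t where a: "y = a + t *\<^sub>R e" "a \<in> A" "t \<in> {0..s}" using assms(1) by blast
      then obtain k where "a \<in> U k" using U(1) by blast
      then have "y \<in> K k" using a closure_subset[of "U k"] unfolding K_def by blast
      then show "y \<in> (\<Union>k. K k)" by blast
    qed
    then have "emeasure lborel S \<le> emeasure lborel (\<Union>k. K k)"
      using K by (intro emeasure_mono) auto
    also have "\<dots> \<le> (\<Sum>k. emeasure lborel (K k))"
      using K by (intro emeasure_subadditive_countably) auto
    also have "\<dots> \<le> (\<Sum>k. ennreal (hausdorff_const ?n * (s + \<delta>)) * hausdorff_gauge (?n - 1) (U k))"
    proof (intro suminf_le allI)
      fix k
      show "emeasure lborel (K k) \<le> ennreal (hausdorff_const ?n * (s + \<delta>)) * hausdorff_gauge (?n - 1) (U k)"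
      proof (cases "U k = {}")
        case False
        let ?d = "diameter (U k)"
        have d: "0 \<le> ?d" using U diameter_ge_0 by blast
        have "emeasure lborel (K k) \<le> ennreal (unit_ball_vol (real ?n) * 2 ^ ?n * (s + ?d) * ?d ^ (?n - 1))"
          unfolding K_def by (rule emeasure_cylinder_le_diameter) (use U assms in auto)
        also have "\<dots> \<le> ennreal (unit_ball_vol (real ?n) * 2 ^ ?n * (s + \<delta>) * ?d ^ (?n - 1))"
          using U d assms by (intro ennreal_leI mult_right_mono mult_left_mono) auto
        also have "unit_ball_vol (real ?n) * 2 ^ ?n * (s + \<delta>) * ?d ^ (?n - 1)
            = (hausdorff_const ?n * (s + \<delta>)) * (unit_ball_vol (real (?n - 1)) * (?d / 2) ^ (?n - 1))"
        proof -
          have "a * p * r * x ^ m = a * p * 2 ^ m / v * r * (v * (x / 2) ^ m)"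
            if "v > 0" for a p r x v :: real and m :: nat
            using that by (simp add: power_divide)
          from this[OF unit_ball_vol_pos[of "real (?n - 1)"]] show ?thesis
            unfolding hausdorff_const_def by simp
        qed
        also have "ennreal \<dots> = ennreal (hausdorff_const ?n * (s + \<delta>)) * hausdorff_gauge (?n - 1) (U k)"
          using False d assms hausdorff_const_pos[of ?n] by (simp add: ennreal_mult)
        finally show ?thesis .
      qed (auto simp: K_def)
    qed auto
    also have "\<dots> = ennreal (hausdorff_const ?n * (s + \<delta>)) * (\<Sum>k. hausdorff_gauge (?n - 1) (U k))"
      by (rule ennreal_suminf_cmult)
    finally show ?thesis .
  qed
  have "hausdorff_const ?n * (s + \<delta>) > 0" using assms hausdorff_const_pos[of ?n] by simp
  show ?thesis
  proof (rule ennreal_le_epsilon)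
    fix r :: real
    let ?c = "hausdorff_const ?n * (s + \<delta>)"
    assume r: "r > 0" and fin: "ennreal ?c * hausdorff_content (?n - 1) \<delta> A < top"
    have "hausdorff_content (?n - 1) \<delta> A < top"
      using fin \<open>?c > 0\<close> by (auto simp: ennreal_mult_less_top)
    then have "hausdorff_content (?n - 1) \<delta> A < hausdorff_content (?n - 1) \<delta> A + ennreal (r / ?c)"
      using r \<open>?c > 0\<close>
      by (cases "hausdorff_content (?n - 1) \<delta> A") (auto simp: ennreal_less_iff simp flip: ennreal_plus)
    then obtain U where U: "A \<subseteq> (\<Union>k. U k)" "\<forall>k. bounded (U k) \<and> diameter (U k) \<le> \<delta>"
      "(\<Sum>k. hausdorff_gauge (?n - 1) (U k)) < hausdorff_content (?n - 1) \<delta> A + ennreal (r / ?c)"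
      unfolding hausdorff_content_def[of _ _ A] INF_less_iff by blast
    have "emeasure lborel S \<le> ennreal ?c * (\<Sum>k. hausdorff_gauge (?n - 1) (U k))"
      by (rule *) (use U in auto)
    also have "\<dots> \<le> ennreal ?c * (hausdorff_content (?n - 1) \<delta> A + ennreal (r / ?c))"
      using U by (intro mult_left_mono) auto
    also have "\<dots> = ennreal ?c * hausdorff_content (?n - 1) \<delta> A + ennreal r"
      using r \<open>?c > 0\<close> by (simp add: distrib_left flip: ennreal_mult)
    finally show "emeasure lborel S \<le> ennreal ?c * hausdorff_content (?n - 1) \<delta> A + ennreal r" .
  qed
qed

text \<open>A set of diameter \<open>d\<close> swept along a segment of length
  \<open>s\<close> is covered by about \<open>s / d + 1\<close> balls of radius \<open>2 d\<close>.\<close>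

lemma emeasure_swept_le_hausdorff:
  fixes A S :: "(real^'n::finite) set"
  assumes "S \<subseteq> {a + t *\<^sub>R e |a t. a \<in> A \<and> t \<in> {0..s}}" "norm e \<le> 1" "s > 0"
  shows "emeasure lborel S \<le> ennreal (hausdorff_const CARD('n) * s) * hausdorff_outer (CARD('n) - 1) A"
    (is "_ \<le> ennreal (?c * s) * ?H")
proof (cases "?H = \<infinity>")
  case True
  then show ?thesis using assms hausdorff_const_pos[of "CARD('n)"] by (simp add: ennreal_mult_top)
next
  case False
  show ?thesis
  proof (rule tendsto_lowerbound)
    show "((\<lambda>\<delta>. ennreal (?c * (s + \<delta>)) * ?H) \<longlongrightarrow> ennreal (?c * s) * ?H) (at_right 0)"
    proof -
      have "((\<lambda>\<delta>. ?c * (s + \<delta>)) \<longlongrightarrow> ?c * (s + 0)) (at_right 0)" by (intro tendsto_intros)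
      then show ?thesis using False by (intro tendsto_mult_ennreal tendsto_ennrealI tendsto_const) auto
    qed
    show "\<forall>\<^sub>F \<delta> in at_right 0. emeasure lborel S \<le> ennreal (?c * (s + \<delta>)) * ?H"
      unfolding eventually_at_filter
    proof (intro always_eventually allI impI)
      fix \<delta> :: real assume "\<delta> \<in> {0<..}"
      then show "emeasure lborel S \<le> ennreal (?c * (s + \<delta>)) * ?H"
        using assms
        by (intro order_trans[OF emeasure_swept_le_content[OF assms(1,2), of \<delta>]] mult_left_mono[OF
              hausdorff_content_le_outer]) auto
    qed
  qed auto
qed

section \<open>Difference quotients and the boundary integral\<close>

text \<open>For \<open>y \<le> real q\<close> the sum counts the integers in the interval from 0 to
  \<open>y\<close>, which are at least \<open>y\<close> and at most \<open>y + 1\<close> in number.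
  The two bounds are the rounding estimates of a layer cake with finitely many levels.\<close>

lemma sum_of_bool_le_ge:
  fixes y :: real
  assumes "0 \<le> y" "y \<le> real q"
  shows "y \<le> (\<Sum>l\<le>q. of_bool (real l \<le> y))"
proof -
  have "{..min q (nat \<lfloor>y\<rfloor>)} \<subseteq> {l\<in>{..q}. real l \<le> y}"
    using assms by (auto simp: le_nat_floor le_floor_iff nat_le_iff) linarith
  then have "card {..min q (nat \<lfloor>y\<rfloor>)} \<le> card {l\<in>{..q}. real l \<le> y}"
    by (intro card_mono) auto
  then have "real (min q (nat \<lfloor>y\<rfloor>)) + 1 \<le> real (card {l\<in>{..q}. real l \<le> y})" by simp
  moreover have "y \<le> real (min q (nat \<lfloor>y\<rfloor>)) + 1" using assms by linarith
  moreover have "(\<Sum>l\<le>q. of_bool (real l \<le> y)) = real (card {l\<in>{..q}. real l \<le> y})"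
    by (simp add: of_bool_def sum.If_cases Int_def)
  ultimately show ?thesis by linarith
qed

lemma sum_of_bool_le_le:
  fixes y :: real
  assumes "0 \<le> y"
  shows "(\<Sum>l\<le>q. of_bool (real l \<le> y)) \<le> y + 1"
proof -
  have "{l\<in>{..q}. real l \<le> y} \<subseteq> {..nat \<lfloor>y\<rfloor>}" by (auto simp: le_nat_floor)
  then have "card {l\<in>{..q}. real l \<le> y} \<le> nat \<lfloor>y\<rfloor> + 1"
    using card_mono[of "{..nat \<lfloor>y\<rfloor>}"] by fastforce
  then have "real (card {l\<in>{..q}. real l \<le> y}) \<le> y + 1" using assms by linarith
  then show ?thesis by (simp add: of_bool_def sum.If_cases Int_def)
qed

section \<open>The layer between a set and its translate\<close>

definition shift_bd :: "'a::real_vector set \<Rightarrow> 'a \<Rightarrow> 'a set" where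
  "shift_bd \<Omega> h = {x. (x \<in> \<Omega>) \<noteq> (x - h \<in> \<Omega>)}"

text \<open>A point of the symmetric difference of \<open>\<Omega>\<close> and its translate ends a
  segment in direction \<open>e\<close> that meets both \<open>\<Omega>\<close> and the complement;
  being connected, the segment meets the frontier.\<close>

lemma shift_bd_subset:
  fixes \<Omega> :: "'a::real_normed_vector set"
  assumes "s \<ge> 0"
  shows "shift_bd \<Omega> (s *\<^sub>R e) \<subseteq> {a + t *\<^sub>R e |a t. a \<in> frontier \<Omega> \<and> t \<in> {0..s}}"
proof
  fix x assume x: "x \<in> shift_bd \<Omega> (s *\<^sub>R e)"
  let ?S = "closed_segment (x - s *\<^sub>R e) x"
  have "?S \<inter> \<Omega> \<noteq> {}" "?S - \<Omega> \<noteq> {}" using x by (auto simp: shift_bd_def)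
  then obtain a where a: "a \<in> ?S" "a \<in> frontier \<Omega>"
    using connected_Int_frontier[of ?S \<Omega>] by auto
  then obtain u where u: "0 \<le> u" "u \<le> 1" "a = (1 - u) *\<^sub>R (x - s *\<^sub>R e) + u *\<^sub>R x"
    by (auto simp: closed_segment_def)
  then have "x = a + ((1 - u) * s) *\<^sub>R e" by (simp add: algebra_simps)
  moreover have "(1 - u) * s \<le> 1 * s" using u assms by (intro mult_right_mono) auto
  ultimately show "x \<in> {a + t *\<^sub>R e |a t. a \<in> frontier \<Omega> \<and> t \<in> {0..s}}"
    using a u assms by (intro CollectI exI[of _ a] exI[of _ "(1 - u) * s"]) auto
qed

lemma shift_bd_borel:
  fixes \<Omega> :: "'a::euclidean_space set"
  assumes "open \<Omega>"
  shows "shift_bd \<Omega> h \<in> sets borel"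
proof -
  have "open ((\<lambda>x. x - h) -` \<Omega>)" using assms by (intro open_vimage continuous_intros)
  moreover have "shift_bd \<Omega> h = (\<Omega> - (\<lambda>x. x - h) -` \<Omega>) \<union> ((\<lambda>x. x - h) -` \<Omega> - \<Omega>)"
    by (auto simp: shift_bd_def)
  ultimately show ?thesis using assms by auto
qed

lemma nn_integral_boundary_measure:
  fixes \<Omega> :: "(real^'n::finite) set"
  shows "(\<integral>\<^sup>+x. f x \<partial>boundary_measure \<Omega>)
    = (\<integral>\<^sup>+x. f x * indicator (frontier \<Omega>) x \<partial>hausdorff_measure (CARD('n) - 1))"
  unfolding boundary_measure_def by (rule nn_integral_restrict_space) auto

lemma emeasure_boundary_measure:
  fixes \<Omega> :: "(real^'n::finite) set"
  shows "emeasure (boundary_measure \<Omega>) (space (boundary_measure \<Omega>)) = hausdorff_outer (CARD('n) - 1) (frontier \<Omega>)"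
  unfolding boundary_measure_def
  by (subst emeasure_restrict_space) (auto simp: space_restrict_space emeasure_hausdorff_measure)

lemma borel_measurable_boundary_measure:
  "f \<in> borel_measurable borel \<Longrightarrow> f \<in> borel_measurable (boundary_measure \<Omega>)"
  unfolding boundary_measure_def
  by (rule measurable_restrict_space1) (simp add: measurable_cong_sets[OF sets_hausdorff_measure refl])

text \<open>Layer cake over finitely many levels reduces the integral to the measure estimate for the
  superlevel sets.\<close>

lemma nn_integral_shift_bd_le:
  fixes \<Omega> :: "(real^'n::finite) set" and b :: "real^'n \<Rightarrow> real"
  assumes "open \<Omega>" "bounded \<Omega>" "hausdorff_outer (CARD('n) - 1) (frontier \<Omega>) < \<infinity>"
    and "norm e \<le> 1" and b: "continuous_on UNIV b" "\<And>x. b x \<ge> 0" and "\<epsilon> > 0"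
  obtains s0 where "s0 > 0"
    "\<And>s. 0 < s \<Longrightarrow> s < s0 \<Longrightarrow> (\<integral>\<^sup>+x. ennreal (b x) * indicator (shift_bd \<Omega> (s *\<^sub>R e)) x \<partial>lborel)
       \<le> ennreal (hausdorff_const CARD('n) * s) * ((\<integral>\<^sup>+x. ennreal (b x) \<partial>boundary_measure \<Omega>) + ennreal \<epsilon>)"
proof -
  let ?H = "hausdorff_outer (CARD('n) - 1) :: (real^'n) set \<Rightarrow> ennreal"
  let ?M = "hausdorff_measure (CARD('n) - 1) :: (real^'n) measure"
  let ?c = "hausdorff_const CARD('n)"
  obtain h where h: "?H (frontier \<Omega>) = ennreal h" "h \<ge> 0"
    using assms(3) by (cases "?H (frontier \<Omega>)") auto
  \<comment> \<open>The rounding errors add up to \<open>2 * \<eta> * h \<le> \<epsilon>\<close>;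
    \<open>h + 1\<close> avoids a division by 0 when the frontier is a null set.\<close>
  define \<eta> where "\<eta> = \<epsilon> / (2 * (h + 1))"
  have \<eta>: "\<eta> > 0" "2 * \<eta> * h \<le> \<epsilon>" using \<open>\<epsilon> > 0\<close> h by (auto simp: \<eta>_def field_simps)
  define K where "K = {x + y |x y. x \<in> frontier \<Omega> \<and> y \<in> cball 0 (1::real)}"
  have "compact K" unfolding K_def
    using assms(2) by (intro compact_sums compact_frontier_bounded) auto
  have bK: "continuous_on K b" using b(1) continuous_on_subset by blast
  have frK: "frontier \<Omega> \<subseteq> K" unfolding K_def by force
  obtain \<rho> where \<rho>: "\<rho> > 0" "\<And>x y. x \<in> K \<Longrightarrow> y \<in> K \<Longrightarrow> dist y x < \<rho> \<Longrightarrow> dist (b y) (b x) < \<eta>"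
    using compact_uniformly_continuous[OF bK \<open>compact K\<close>] \<eta>(1) unfolding uniformly_continuous_on_def by metis
  have "bounded (b ` K)"
    using compact_continuous_image[OF bK \<open>compact K\<close>] compact_imp_bounded by blast
  then obtain m where m: "\<And>x. x \<in> K \<Longrightarrow> \<bar>b x\<bar> \<le> m" unfolding bounded_iff by auto
  define q where "q = nat \<lceil>m / \<eta>\<rceil>"
  have q: "b x / \<eta> \<le> real q" if "x \<in> K" for x
  proof -
    have "b x / \<eta> \<le> m / \<eta>" using m[OF that] \<eta> by (intro divide_right_mono) auto
    then show ?thesis unfolding q_def by linarith
  qed
  show ?thesis
  proof (rule that[of "min 1 \<rho>"])
    show "min 1 \<rho> > 0" using \<rho> by auto
  next
    fix s assume s: "0 < s" "s < min 1 \<rho>"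
    let ?N = "shift_bd \<Omega> (s *\<^sub>R e)"
    \<comment> \<open>Moving from a point \<open>x\<close> of the layer to the frontier point
      \<open>a\<close> from which it is swept changes \<open>b\<close> by less than
      \<open>\<eta>\<close>, that is by less than one level; hence the \<open>+ 1\<close>.\<close>
    define A where "A l = {a \<in> frontier \<Omega>. real l \<le> b a / \<eta> + 1}" for l
    have N: "x \<in> K \<and> (\<exists>a t. x = a + t *\<^sub>R e \<and> a \<in> frontier \<Omega> \<and> t \<in> {0..s} \<and> \<bar>b x - b a\<bar> < \<eta>)"
      if x: "x \<in> ?N" for x
    proof -
      obtain a t where a: "x = a + t *\<^sub>R e" "a \<in> frontier \<Omega>" "t \<in> {0..s}"
        using subsetD[OF shift_bd_subset x] s by auto
      have "norm (t *\<^sub>R e) \<le> t * 1" using a mult_left_mono[of "norm e" 1 t] \<open>norm e \<le> 1\<close> by auto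
      then have te: "norm (t *\<^sub>R e) \<le> s" using a by auto
      then have "x \<in> K" using a s unfolding K_def by force
      moreover have "dist (b x) (b a) < \<eta>"
        using \<rho>(2)[of a x] \<open>x \<in> K\<close> a frK te s by (auto simp: dist_norm)
      ultimately show ?thesis using a by (auto simp: dist_real_def)
    qed
    have meas: "?N \<inter> {x. real l \<le> b x / \<eta>} \<in> sets borel" for l
    proof -
      have "closed {x. real l \<le> b x / \<eta>}"
        using b(1) by (intro closed_Collect_le continuous_intros) (use \<eta> in auto)
      then show ?thesis using shift_bd_borel[OF \<open>open \<Omega>\<close>] by auto
    qed
    have A_meas: "A l \<in> sets borel" for l
    proof -
      have "closed {x. real l \<le> b x / \<eta> + 1}"
        using b(1) by (intro closed_Collect_le continuous_intros) (use \<eta> in auto)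
      then have "closed (frontier \<Omega> \<inter> {x. real l \<le> b x / \<eta> + 1})" by (intro closed_Int) auto
      then show ?thesis by (simp add: A_def Collect_conj_eq)
    qed
    have "(\<integral>\<^sup>+x. ennreal (b x) * indicator ?N x \<partial>lborel)
        \<le> (\<integral>\<^sup>+x. (\<Sum>l\<le>q. ennreal \<eta> * indicator (?N \<inter> {x. real l \<le> b x / \<eta>}) x) \<partial>lborel)"
    proof (rule nn_integral_mono)
      fix x
      show "ennreal (b x) * indicator ?N x \<le> (\<Sum>l\<le>q. ennreal \<eta> * indicator (?N \<inter> {x. real l \<le> b x / \<eta>}) x)"
      proof (cases "x \<in> ?N")
        case True
        have "b x / \<eta> \<le> (\<Sum>l\<le>q. of_bool (real l \<le> b x / \<eta>))"
          using b(2) \<eta> q N[OF True] by (intro sum_of_bool_le_ge) auto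
        then have "b x \<le> (\<Sum>l\<le>q. \<eta> * of_bool (real l \<le> b x / \<eta>))"
          using \<eta> by (simp add: field_simps flip: sum_distrib_left)
        then have "ennreal (b x) \<le> (\<Sum>l\<le>q. ennreal (\<eta> * of_bool (real l \<le> b x / \<eta>)))"
          using \<eta> by (subst sum_ennreal) (auto intro: ennreal_leI)
        also have "\<dots> = (\<Sum>l\<le>q. ennreal \<eta> * indicator (?N \<inter> {x. real l \<le> b x / \<eta>}) x)"
          using True by (intro sum.cong) (auto simp: indicator_def)
        finally show ?thesis using True by simp
      qed auto
    qed
    also have "\<dots> = (\<Sum>l\<le>q. ennreal \<eta> * emeasure lborel (?N \<inter> {x. real l \<le> b x / \<eta>}))"
      using meas
      by (subst nn_integral_sum) (auto intro!: sum.cong nn_integral_cmult_indicator)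
    also have "\<dots> \<le> (\<Sum>l\<le>q. ennreal \<eta> * (ennreal (?c * s) * ?H (A l)))"
    proof (intro sum_mono mult_left_mono emeasure_swept_le_hausdorff)
      fix l
      show "?N \<inter> {x. real l \<le> b x / \<eta>} \<subseteq> {a + t *\<^sub>R e |a t. a \<in> A l \<and> t \<in> {0..s}}"
      proof
        fix x assume x: "x \<in> ?N \<inter> {x. real l \<le> b x / \<eta>}"
        then obtain a t where a: "x = a + t *\<^sub>R e" "a \<in> frontier \<Omega>" "t \<in> {0..s}" "\<bar>b x - b a\<bar> < \<eta>"
          using N[of x] by blast
        then have "b x / \<eta> \<le> (b a + \<eta>) / \<eta>" using \<eta> by (intro divide_right_mono) auto
        then have "a \<in> A l" using a x \<eta> by (auto simp: A_def add_divide_distrib)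
        then show "x \<in> {a + t *\<^sub>R e |a t. a \<in> A l \<and> t \<in> {0..s}}" using a by blast
      qed
    qed (use s assms in auto)
    also have "\<dots> = ennreal (?c * s) * (\<Sum>l\<le>q. ennreal \<eta> * emeasure ?M (A l))"
      using A_meas by (simp add: emeasure_hausdorff_measure sum_distrib_left mult.left_commute)
    also have "(\<Sum>l\<le>q. ennreal \<eta> * emeasure ?M (A l)) = (\<integral>\<^sup>+x. (\<Sum>l\<le>q. ennreal \<eta> * indicator (A l) x) \<partial>?M)"
      using A_meas
      by (subst nn_integral_sum) (auto intro!: sum.cong nn_integral_cmult_indicator[symmetric] borel_measurable_times_ennreal borel_measurable_indicator)
    \<comment> \<open>One \<open>\<eta>\<close> pays for the shifted level sets, the other for the
      rounding.\<close>
    also have "\<dots> \<le> (\<integral>\<^sup>+x. (ennreal (b x) + ennreal (2 * \<eta>)) * indicator (frontier \<Omega>) x \<partial>?M)"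
    proof (rule nn_integral_mono)
      fix x
      show "(\<Sum>l\<le>q. ennreal \<eta> * indicator (A l) x) \<le> (ennreal (b x) + ennreal (2 * \<eta>)) * indicator (frontier \<Omega>) x"
      proof (cases "x \<in> frontier \<Omega>")
        case True
        have "(\<Sum>l\<le>q. of_bool (real l \<le> b x / \<eta> + 1)) \<le> (b x / \<eta> + 1) + 1"
          using b(2) \<eta> by (intro sum_of_bool_le_le) auto
        then have "\<eta> * (\<Sum>l\<le>q. of_bool (real l \<le> b x / \<eta> + 1)) \<le> \<eta> * ((b x / \<eta> + 1) + 1)"
          using \<eta> by (intro mult_left_mono) auto
        also have "\<dots> = b x + 2 * \<eta>" using \<eta> by (simp add: field_simps)
        finally have *: "(\<Sum>l\<le>q. \<eta> * of_bool (real l \<le> b x / \<eta> + 1)) \<le> b x + 2 * \<eta>"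
          by (simp only: sum_distrib_left)
        have "(\<Sum>l\<le>q. ennreal \<eta> * indicator (A l) x) = (\<Sum>l\<le>q. ennreal (\<eta> * of_bool (real l \<le> b x / \<eta> + 1)))"
          using True by (intro sum.cong) (auto simp: indicator_def A_def)
        also have "\<dots> \<le> ennreal (b x + 2 * \<eta>)"
          using * \<eta> by (subst sum_ennreal) (auto intro: ennreal_leI)
        finally show ?thesis using True b(2) \<eta> by simp
      next
        case False
        then have "x \<notin> A l" for l by (auto simp: A_def)
        then show ?thesis by simp
      qed
    qed
    also have "\<dots> = (\<integral>\<^sup>+x. ennreal (b x) * indicator (frontier \<Omega>) x + ennreal (2 * \<eta>) * indicator (frontier \<Omega>) x \<partial>?M)"
      by (simp add: distrib_right)
    also have "\<dots> = (\<integral>\<^sup>+x. ennreal (b x) * indicator (frontier \<Omega>) x \<partial>?M)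
        + (\<integral>\<^sup>+x. ennreal (2 * \<eta>) * indicator (frontier \<Omega>) x \<partial>?M)"
    proof (rule nn_integral_add)
      have "b \<in> borel_measurable ?M"
        using borel_measurable_continuous_onI[OF b(1)]
        by (simp add: measurable_cong_sets[OF sets_hausdorff_measure refl])
      moreover have "frontier \<Omega> \<in> sets ?M" by auto
      ultimately show "(\<lambda>x. ennreal (b x) * indicator (frontier \<Omega>) x) \<in> borel_measurable ?M"
        "(\<lambda>x. ennreal (2 * \<eta>) * indicator (frontier \<Omega>) x) \<in> borel_measurable ?M"
        by measurable
    qed
    also have "(\<integral>\<^sup>+x. ennreal (2 * \<eta>) * indicator (frontier \<Omega>) x \<partial>?M) = ennreal (2 * \<eta>) * ennreal h"
      using h(1) by (subst nn_integral_cmult_indicator) (simp_all add: emeasure_hausdorff_measure)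
    also have "\<dots> \<le> ennreal \<epsilon>" using \<eta> h by (simp add: ennreal_leI flip: ennreal_mult)
    finally show "(\<integral>\<^sup>+x. ennreal (b x) * indicator ?N x \<partial>lborel)
       \<le> ennreal (?c * s) * ((\<integral>\<^sup>+x. ennreal (b x) \<partial>boundary_measure \<Omega>) + ennreal \<epsilon>)"
      by (simp add: nn_integral_boundary_measure mult_left_mono add_left_mono)
  qed
qed

lemma lborel_integral_shift:
  fixes f :: "'a::euclidean_space \<Rightarrow> real"
  assumes "f \<in> borel_measurable borel"
  shows "(LINT x|lborel. f (x + h)) = (LINT x|lborel. f x)"
proof -
  have "(LINT x|lborel. f x) = (LINT x|distr lborel borel ((+) h). f x)"
    by (simp add: lborel_distr_plus)
  also have "\<dots> = (LINT x|lborel. f (h + x))"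
    by (rule integral_distr) (use assms in auto)
  finally show ?thesis by (simp add: add.commute)
qed

lemma set_integrable_continuous_bounded:
  fixes f :: "'a::euclidean_space \<Rightarrow> real"
  assumes "continuous_on UNIV f" "bounded S" "S \<in> sets borel"
  shows "set_integrable lborel S f"
proof -
  have "compact (closure S)" using assms by (simp add: compact_closure)
  then have "set_integrable lborel (closure S) f"
    using borel_integrable_compact continuous_on_subset[OF assms(1)] unfolding set_integrable_def by blast
  then show ?thesis
    by (rule set_integrable_subset) (use assms closure_subset in auto)
qed

text \<open>Translating the first integral turns the difference into integrals of \<open>F\<close>
  over the translate of \<open>\<Omega>\<close> and over \<open>\<Omega>\<close>, which cancel on
  the common part.\<close>

lemma abs_integral_difference_quotient_le:
  fixes \<Omega> :: "'a::euclidean_space set" and F :: "'a \<Rightarrow> real"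
  assumes "open \<Omega>" "bounded \<Omega>" and F: "continuous_on UNIV F" and "s > 0"
  shows "\<bar>LINT x:\<Omega>|lborel. (F (x + s *\<^sub>R e) - F x) / s\<bar>
    \<le> (LINT x:shift_bd \<Omega> (s *\<^sub>R e)|lborel. \<bar>F x\<bar>) / s"
proof -
  let ?N = "shift_bd \<Omega> (s *\<^sub>R e)"
  let ?I = "\<lambda>x. indicator \<Omega> x :: real"
  define \<Omega>' where "\<Omega>' = (\<lambda>x. x - s *\<^sub>R e) -` \<Omega>"
  have "open \<Omega>'" unfolding \<Omega>'_def using assms(1) by (intro open_vimage continuous_intros)
  have "\<Omega>' = (+) (s *\<^sub>R e) ` \<Omega>" by (force simp: \<Omega>'_def image_iff)
  then have "bounded \<Omega>'" using assms(2) by (simp add: bounded_translation)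
  have intF: "set_integrable lborel \<Omega> F" "set_integrable lborel \<Omega>' F"
    using assms \<open>open \<Omega>'\<close> \<open>bounded \<Omega>'\<close> by (auto intro!: set_integrable_continuous_bounded)
  have Fs: "continuous_on UNIV (\<lambda>x. F (x + s *\<^sub>R e))"
    by (intro continuous_on_compose2[OF F] continuous_intros) auto
  have intFs: "set_integrable lborel \<Omega> (\<lambda>x. F (x + s *\<^sub>R e))"
    using assms Fs by (auto intro!: set_integrable_continuous_bounded)
  have "?N \<subseteq> \<Omega> \<union> \<Omega>'" by (auto simp: shift_bd_def \<Omega>'_def)
  then have "bounded ?N" using \<open>bounded \<Omega>'\<close> assms(2) bounded_Un bounded_subset by blast
  then have intN: "set_integrable lborel ?N (\<lambda>x. \<bar>F x\<bar>)"
    using assms F shift_bd_borel[OF assms(1)] by (intro set_integrable_continuous_bounded continuous_intros)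
  have m: "(\<lambda>x. indicator \<Omega>' x * F x) \<in> borel_measurable borel"
    using borel_measurable_continuous_onI[OF F] \<open>open \<Omega>'\<close> by (intro borel_measurable_times) auto
  have "(LINT x:\<Omega>|lborel. F (x + s *\<^sub>R e)) = (LINT x|lborel. indicator \<Omega>' (x + s *\<^sub>R e) * F (x + s *\<^sub>R e))"
    unfolding set_lebesgue_integral_def by (intro Bochner_Integration.integral_cong) (auto simp: \<Omega>'_def indicator_def)
  also have "\<dots> = (LINT x:\<Omega>'|lborel. F x)"
    unfolding lborel_integral_shift[OF m] set_lebesgue_integral_def by simp
  finally have "(LINT x:\<Omega>|lborel. F (x + s *\<^sub>R e) - F x) = (LINT x:\<Omega>'|lborel. F x) - (LINT x:\<Omega>|lborel. F x)"
    using intF intFs by (simp add: set_integral_diff)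
  also have "\<dots> = (LINT x|lborel. indicator \<Omega>' x * F x - indicator \<Omega> x * F x)"
    using intF unfolding set_lebesgue_integral_def set_integrable_def
    by (subst Bochner_Integration.integral_diff) auto
  also have "\<bar>\<dots>\<bar> \<le> (LINT x|lborel. \<bar>indicator \<Omega>' x * F x - indicator \<Omega> x * F x\<bar>)"
    by (rule integral_abs_bound)
  also have "\<dots> = (LINT x:?N|lborel. \<bar>F x\<bar>)"
    unfolding set_lebesgue_integral_def
    by (intro Bochner_Integration.integral_cong) (auto simp: \<Omega>'_def indicator_def shift_bd_def)
  finally have "\<bar>LINT x:\<Omega>|lborel. F (x + s *\<^sub>R e) - F x\<bar> / s \<le> (LINT x:?N|lborel. \<bar>F x\<bar>) / s"
    using \<open>s > 0\<close> by (intro divide_right_mono) auto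
  then show ?thesis using \<open>s > 0\<close> by simp
qed

lemma nn_integral_boundary_measure_finite:
  fixes \<Omega> :: "(real^'n::finite) set"
  assumes "bounded \<Omega>" "hausdorff_outer (CARD('n) - 1) (frontier \<Omega>) < \<infinity>" and b: "continuous_on UNIV b"
  shows "(\<integral>\<^sup>+x. ennreal (b x) \<partial>boundary_measure \<Omega>) < \<infinity>"
proof -
  have "bounded (b ` frontier \<Omega>)"
    using compact_continuous_image[OF continuous_on_subset[OF b] compact_frontier_bounded[OF assms(1)]]
      compact_imp_bounded by blast
  then obtain m where m: "\<And>x. x \<in> frontier \<Omega> \<Longrightarrow> \<bar>b x\<bar> \<le> m" unfolding bounded_iff by auto
  have "(\<integral>\<^sup>+x. ennreal (b x) \<partial>boundary_measure \<Omega>) \<le> (\<integral>\<^sup>+x. ennreal m \<partial>boundary_measure \<Omega>)"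
  proof (rule nn_integral_mono)
    fix x assume "x \<in> space (boundary_measure \<Omega>)"
    then have "x \<in> frontier \<Omega>" by (simp add: boundary_measure_def space_restrict_space)
    then show "ennreal (b x) \<le> ennreal m" using m by (force intro: ennreal_leI)
  qed
  also have "\<dots> < \<infinity>"
    using assms(2) by (simp add: emeasure_boundary_measure ennreal_mult_less_top)
  finally show ?thesis .
qed

text \<open>The threshold \<open>s0\<close> is chosen before \<open>s\<close>, \<open>K\<close> and
  \<open>F\<close>. This uniformity allows \<open>F\<close> to be built from difference quotients of
  the same step \<open>s\<close>, as in the discrete divergences to which it is applied.\<close>

lemma integral_difference_quotient_boundary_bound:
  fixes \<Omega> :: "(real^'n::finite) set" and b :: "real^'n \<Rightarrow> real"
  assumes \<Omega>: "open \<Omega>" "bounded \<Omega>" "hausdorff_outer (CARD('n) - 1) (frontier \<Omega>) < \<infinity>"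
    and e: "norm e \<le> 1" and b: "continuous_on UNIV b" "\<And>x. b x \<ge> 0" and "\<epsilon> > 0"
  obtains s0 where "s0 > 0"
    "\<And>s K F. 0 < s \<Longrightarrow> s < s0 \<Longrightarrow> K \<ge> 0 \<Longrightarrow> continuous_on UNIV F \<Longrightarrow>
       (\<And>x. \<exists>a\<in>frontier \<Omega>. dist x a \<le> s \<Longrightarrow> \<bar>F x\<bar> \<le> K * b x) \<Longrightarrow>
       \<bar>LINT x:\<Omega>|lborel. (F (x + s *\<^sub>R e) - F x) / s\<bar>
       \<le> K * hausdorff_const CARD('n) * (enn2real (\<integral>\<^sup>+x. ennreal (b x) \<partial>boundary_measure \<Omega>) + \<epsilon>)"
proof -
  let ?c = "hausdorff_const CARD('n)"
  define \<beta> where "\<beta> = enn2real (\<integral>\<^sup>+x. ennreal (b x) \<partial>boundary_measure \<Omega>)"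
  have \<beta>: "(\<integral>\<^sup>+x. ennreal (b x) \<partial>boundary_measure \<Omega>) = ennreal \<beta>" "\<beta> \<ge> 0"
    using nn_integral_boundary_measure_finite[OF \<Omega>(2,3) b(1)] by (simp_all add: \<beta>_def)
  obtain s0 where s0: "s0 > 0"
    "\<And>s. 0 < s \<Longrightarrow> s < s0 \<Longrightarrow> (\<integral>\<^sup>+x. ennreal (b x) * indicator (shift_bd \<Omega> (s *\<^sub>R e)) x \<partial>lborel)
       \<le> ennreal (?c * s) * (ennreal \<beta> + ennreal \<epsilon>)"
    using nn_integral_shift_bd_le[OF \<Omega> e b \<open>\<epsilon> > 0\<close>] unfolding \<beta> by metis
  show ?thesis
  proof (rule that[OF s0(1)])
    fix s K :: real and F
    assume s: "0 < s" "s < s0" and K: "K \<ge> 0" and F: "continuous_on UNIV F"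
      and bd: "\<And>x. \<exists>a\<in>frontier \<Omega>. dist x a \<le> s \<Longrightarrow> \<bar>F x\<bar> \<le> K * b x"
    let ?N = "shift_bd \<Omega> (s *\<^sub>R e)"
    have near: "\<exists>a\<in>frontier \<Omega>. dist x a \<le> s" if x: "x \<in> ?N" for x
    proof -
      obtain a t where a: "x = a + t *\<^sub>R e" "a \<in> frontier \<Omega>" "t \<in> {0..s}"
        using subsetD[OF shift_bd_subset x] s by auto
      have "norm (t *\<^sub>R e) \<le> t" using a mult_left_mono[of "norm e" 1 t] e by auto
      then show ?thesis using a by (intro bexI[of _ a]) (auto simp: dist_norm)
    qed
    have [measurable]: "b \<in> borel_measurable borel" "F \<in> borel_measurable borel"
      using b F by (auto intro: borel_measurable_continuous_onI)
    have [measurable]: "?N \<in> sets borel" by (rule shift_bd_borel[OF \<Omega>(1)])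
    have "(LINT x:?N|lborel. \<bar>F x\<bar>) = enn2real (\<integral>\<^sup>+x. ennreal (indicator ?N x *\<^sub>R \<bar>F x\<bar>) \<partial>lborel)"
      unfolding set_lebesgue_integral_def by (rule integral_eq_nn_integral) auto
    also have "\<dots> \<le> enn2real (ennreal (K * (?c * s * (\<beta> + \<epsilon>))))"
    proof (rule enn2real_mono)
      have "(\<integral>\<^sup>+x. ennreal (indicator ?N x *\<^sub>R \<bar>F x\<bar>) \<partial>lborel)
          \<le> (\<integral>\<^sup>+x. ennreal K * (ennreal (b x) * indicator ?N x) \<partial>lborel)"
        using K b(2) bd near by (intro nn_integral_mono) (auto simp: indicator_def simp flip: ennreal_mult intro!: ennreal_leI)
      also have "\<dots> = ennreal K * (\<integral>\<^sup>+x. ennreal (b x) * indicator ?N x \<partial>lborel)"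
        by (rule nn_integral_cmult) measurable
      also have "\<dots> \<le> ennreal K * (ennreal (?c * s) * (ennreal \<beta> + ennreal \<epsilon>))"
        using s0(2) s by (intro mult_left_mono) auto
      also have "\<dots> = ennreal (K * (?c * s * (\<beta> + \<epsilon>)))"
        using K s \<beta>(2) \<open>\<epsilon> > 0\<close> hausdorff_const_pos[of "CARD('n)"] by (simp add: ennreal_mult)
      finally show "(\<integral>\<^sup>+x. ennreal (indicator ?N x *\<^sub>R \<bar>F x\<bar>) \<partial>lborel) \<le> ennreal (K * (?c * s * (\<beta> + \<epsilon>)))" .
    qed auto
    also have "\<dots> = K * (?c * s * (\<beta> + \<epsilon>))"
      using K s \<beta>(2) \<open>\<epsilon> > 0\<close> hausdorff_const_pos[of "CARD('n)"] by (intro enn2real_ennreal) auto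
    finally have "(LINT x:?N|lborel. \<bar>F x\<bar>) / s \<le> K * ?c * (\<beta> + \<epsilon>)"
      using s by (simp add: field_simps)
    with abs_integral_difference_quotient_le[OF \<Omega>(1,2) F s(1), of e]
    show "\<bar>LINT x:\<Omega>|lborel. (F (x + s *\<^sub>R e) - F x) / s\<bar>
       \<le> K * ?c * (enn2real (\<integral>\<^sup>+x. ennreal (b x) \<partial>boundary_measure \<Omega>) + \<epsilon>)"
      unfolding \<beta>_def[symmetric] by linarith
  qed
qed

section \<open>Lipschitz boundaries have finite measure\<close>

lemma hausdorff_content_le_finite:
  assumes "finite X" "A \<subseteq> (\<Union>x\<in>X. U x)" "\<And>x. bounded (U x)" "\<And>x. diameter (U x) \<le> \<epsilon>" "\<epsilon> \<ge> 0"
  shows "hausdorff_content d \<epsilon> A \<le> ennreal (real (card X) * (unit_ball_vol (real d) * (\<epsilon> / 2) ^ d))"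
proof -
  obtain f where f: "bij_betw f {0..<card X} X" using ex_bij_betw_nat_finite[OF assms(1)] by blast
  define V where "V k = (if k < card X then U (f k) else {})" for k
  have "A \<subseteq> (\<Union>k. V k)"
  proof
    fix y assume "y \<in> A"
    then obtain x where x: "x \<in> X" "y \<in> U x" using assms by blast
    then obtain k where "k < card X" "f k = x" using f
      by (metis atLeastLessThan_iff bij_betw_imp_surj_on imageE)
    then have "y \<in> V k" using x by (simp add: V_def)
    then show "y \<in> (\<Union>k. V k)" by blast
  qed
  then have "hausdorff_content d \<epsilon> A \<le> (\<Sum>k. hausdorff_gauge d (V k))"
    using assms by (intro hausdorff_content_le) (auto simp: V_def)
  also have "\<dots> = (\<Sum>k<card X. hausdorff_gauge d (V k))"
    by (rule suminf_finite) (auto simp: V_def)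
  also have "\<dots> \<le> (\<Sum>k<card X. ennreal (unit_ball_vol (real d) * (\<epsilon> / 2) ^ d))"
    using assms diameter_ge_0[OF assms(3)]
    by (intro sum_mono) (auto simp: V_def intro!: ennreal_leI mult_left_mono power_mono)
  also have "\<dots> = ennreal (\<Sum>k<card X. unit_ball_vol (real d) * (\<epsilon> / 2) ^ d)"
    using assms(5) by (intro sum_ennreal) auto
  finally show ?thesis by simp
qed

text \<open>Packing: around the points of a \<open>\<delta>\<close>-separated subset of a Lipschitz graph, the balls of
  radius \<open>c \<delta>\<close> centred at their vertical translates by multiples of \<open>\<delta>\<close> are disjoint, so a
  volume count bounds the number of points by a multiple of \<open>\<delta> ^ (1 - n)\<close>.\<close>

lemma card_separated_le:
  fixes G X :: "(real^'n::finite) set"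
  assumes G: "G \<subseteq> ball p r" and "r > 0" "norm e = 1" "L \<ge> 0"
    and lip: "\<And>x y. x \<in> G \<Longrightarrow> y \<in> G \<Longrightarrow>
      norm (x - y) \<le> (1 + L) * norm ((x - y) - ((x - y) \<bullet> e) *\<^sub>R e)"
    and X: "finite X" "X \<subseteq> G" "\<And>x y. x \<in> X \<Longrightarrow> y \<in> X \<Longrightarrow> x \<noteq> y \<Longrightarrow> \<delta> \<le> dist x y"
    and \<delta>: "0 < \<delta>" "\<delta> \<le> 1"
  shows "real (card X) * \<delta> ^ (CARD('n) - 1) \<le> ((r + 2) * (2 * (1 + L))) ^ CARD('n)"
proof -
  let ?n = "CARD('n)"
  \<comment> \<open>Chosen so that \<open>2 * c * (1 + L) = 1\<close>: by \<open>lip\<close>, two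
    points of \<open>G\<close> at distance at least \<open>\<delta>\<close> have projections at
    distance at least \<open>2 * c * \<delta>\<close>.\<close>
  define c where "c = 1 / (2 * (1 + L))"
  have c: "c > 0" "2 * c \<le> 1" "2 * c * (1 + L) = 1" using \<open>L \<ge> 0\<close> by (auto simp: c_def field_simps)
  \<comment> \<open>Each point of \<open>X\<close> carries a column of \<open>m + 1\<close> balls.
    \<open>m * \<delta> \<le> 1\<close> keeps the columns within distance 1 of \<open>G\<close>,
    while \<open>(m + 1) * \<delta> \<ge> 1\<close> saves the one factor \<open>\<delta>\<close>
    that turns the exponent \<open>n\<close> into \<open>n - 1\<close>.\<close>
  define m where "m = nat \<lfloor>1 / \<delta>\<rfloor>"
  have m: "real m * \<delta> \<le> 1" "1 \<le> (real m + 1) * \<delta>"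
  proof -
    have "real m \<le> 1 / \<delta>" "1 / \<delta> \<le> real m + 1" using \<delta> by (auto simp: m_def)
    then show "real m * \<delta> \<le> 1" "1 \<le> (real m + 1) * \<delta>" using \<delta> by (auto simp: field_simps)
  qed
  define z where "z i = fst i + (real (snd i) * \<delta>) *\<^sub>R e" for i :: "(real^'n) \<times> nat"
  define I where "I = X \<times> {..m}"
  have proj: "norm (v - (v \<bullet> e) *\<^sub>R e) \<le> norm v" for v
  proof -
    have "(norm (v - (v \<bullet> e) *\<^sub>R e))\<^sup>2 = (norm v)\<^sup>2 - (v \<bullet> e)\<^sup>2"
      using \<open>norm e = 1\<close> unfolding power2_norm_eq_inner
      by (simp add: inner_diff_left inner_diff_right inner_commute norm_eq_1 power2_eq_square)
    then show ?thesis by (metis abs_norm_cancel diff_le_eq le_add_same_cancel1 norm_ge_zero power2_le_imp_le zero_le_power2)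
  qed
  have sep: "2 * c * \<delta> \<le> dist (z i) (z j)" if "i \<in> I" "j \<in> I" "i \<noteq> j" for i j
  proof (cases "fst i = fst j")
    case True
    then have "snd i \<noteq> snd j" using that by (auto simp: prod_eq_iff)
    then have "1 \<le> \<bar>real (snd i) - real (snd j)\<bar>" by linarith
    then have "1 * \<delta> \<le> \<bar>real (snd i) - real (snd j)\<bar> * \<delta>" using \<delta> by (intro mult_right_mono) auto
    moreover have "dist (z i) (z j) = \<bar>real (snd i) - real (snd j)\<bar> * \<delta>"
    proof -
      have "z i - z j = ((real (snd i) - real (snd j)) * \<delta>) *\<^sub>R e"
        by (simp add: z_def True algebra_simps)
      then show ?thesis using \<delta> \<open>norm e = 1\<close> by (simp add: dist_norm abs_mult)
    qed
    moreover have "2 * c * \<delta> \<le> 1 * \<delta>" using c \<delta> by (intro mult_right_mono) auto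
    ultimately show ?thesis by linarith
  next
    case False
    let ?d = "fst i - fst j"
    have zz: "z i - z j = ?d + (real (snd i) * \<delta> - real (snd j) * \<delta>) *\<^sub>R e"
      by (simp add: z_def algebra_simps)
    \<comment> \<open>Translation along \<open>e\<close> does not change the projection, so centres
      over different points of \<open>X\<close> are kept apart by their projections alone.\<close>
    have "(z i - z j) - ((z i - z j) \<bullet> e) *\<^sub>R e = ?d - (?d \<bullet> e) *\<^sub>R e"
      unfolding zz using \<open>norm e = 1\<close> by (simp add: inner_add_left norm_eq_1 algebra_simps)
    then have 1: "norm (?d - (?d \<bullet> e) *\<^sub>R e) \<le> dist (z i) (z j)"
      using proj[of "z i - z j"] by (simp add: dist_norm)
    have "\<delta> \<le> norm ?d" using X(3)[of "fst i" "fst j"] that False by (auto simp: I_def dist_norm)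
    also have "\<dots> \<le> (1 + L) * norm (?d - (?d \<bullet> e) *\<^sub>R e)"
      by (rule lip) (use that X(2) in \<open>auto simp: I_def\<close>)
    also have "\<dots> \<le> (1 + L) * dist (z i) (z j)" using 1 \<open>L \<ge> 0\<close> by (intro mult_left_mono) auto
    finally have "2 * c * \<delta> \<le> 2 * c * ((1 + L) * dist (z i) (z j))" using c by (intro mult_left_mono) auto
    also have "\<dots> = dist (z i) (z j)" using c(3) by (simp add: mult.assoc[symmetric])
    finally show ?thesis .
  qed
  have disj: "disjoint_family_on (\<lambda>i. ball (z i) (c * \<delta>)) I"
    unfolding disjoint_family_on_def
  proof (intro ballI impI)
    fix i j assume ij: "i \<in> I" "j \<in> I" "i \<noteq> j"
    show "ball (z i) (c * \<delta>) \<inter> ball (z j) (c * \<delta>) = {}"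
    proof (rule ccontr)
      assume "\<not> ?thesis"
      then obtain y where "dist (z i) y < c * \<delta>" "dist (z j) y < c * \<delta>" by auto
      with sep[OF ij] show False using dist_triangle[of "z i" "z j" y] by (simp add: dist_commute)
    qed
  qed
  \<comment> \<open>\<open>r\<close> for the base point, 1 for the height of the column, 1 for the
    radius of the ball.\<close>
  have "(\<Union>i\<in>I. ball (z i) (c * \<delta>)) \<subseteq> ball p (r + 2)"
  proof
    fix y assume "y \<in> (\<Union>i\<in>I. ball (z i) (c * \<delta>))"
    then obtain i where i: "i \<in> I" "dist (z i) y < c * \<delta>" by auto
    have "dist p (fst i) < r" using i X(2) G by (auto simp: I_def)
    moreover have "dist (fst i) (z i) \<le> 1"
    proof -
      have "real (snd i) * \<delta> \<le> real m * \<delta>" using i \<delta> by (intro mult_right_mono) (auto simp: I_def)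
      from order_trans[OF this m(1)] show ?thesis using \<delta> \<open>norm e = 1\<close> by (simp add: z_def dist_norm)
    qed
    moreover have "c * \<delta> \<le> 1 * 1" using c \<delta> by (intro mult_mono) auto
    ultimately have "dist p y < r + 2"
      using i dist_triangle[of p y "fst i"] dist_triangle[of "fst i" y "z i"] by linarith
    then show "y \<in> ball p (r + 2)" by simp
  qed
  then have "emeasure lborel (\<Union>i\<in>I. ball (z i) (c * \<delta>)) \<le> emeasure lborel (ball p (r + 2))"
    by (intro emeasure_mono) auto
  moreover have "emeasure lborel (\<Union>i\<in>I. ball (z i) (c * \<delta>)) = (\<Sum>i\<in>I. emeasure lborel (ball (z i) (c * \<delta>)))"
    using X(1) by (intro sum_emeasure[symmetric] disj) (auto simp: I_def)
  ultimately have "(\<Sum>i\<in>I. ennreal (unit_ball_vol (real ?n) * (c * \<delta>) ^ ?n)) \<le> ennreal (unit_ball_vol (real ?n) * (r + 2) ^ ?n)"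
    using c \<delta> \<open>r > 0\<close> by (simp add: emeasure_ball)
  then have "ennreal (\<Sum>i\<in>I. unit_ball_vol (real ?n) * (c * \<delta>) ^ ?n) \<le> ennreal (unit_ball_vol (real ?n) * (r + 2) ^ ?n)"
    using c \<delta> by (subst (asm) sum_ennreal) auto
  then have "real (card I) * (unit_ball_vol (real ?n) * (c * \<delta>) ^ ?n) \<le> unit_ball_vol (real ?n) * (r + 2) ^ ?n"
    using \<open>r > 0\<close> by simp
  then have "unit_ball_vol (real ?n) * (real (card I) * (c * \<delta>) ^ ?n) \<le> unit_ball_vol (real ?n) * (r + 2) ^ ?n"
    by (simp add: ac_simps)
  then have *: "real (card I) * (c * \<delta>) ^ ?n \<le> (r + 2) ^ ?n"
    by (rule mult_left_le_imp_le) auto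
  have "\<delta> ^ ?n = \<delta> * \<delta> ^ (?n - 1)" by (metis power_eq_if zero_less_card_finite less_numeral_extra(3))
  then have "real (card X) * \<delta> ^ (?n - 1) * c ^ ?n * ((real m + 1) * \<delta>) = real (card I) * (c * \<delta>) ^ ?n"
    by (simp add: I_def card_cartesian_product power_mult_distrib algebra_simps)
  moreover have "real (card X) * \<delta> ^ (?n - 1) * c ^ ?n * 1 \<le> real (card X) * \<delta> ^ (?n - 1) * c ^ ?n * ((real m + 1) * \<delta>)"
    using m \<delta> c by (intro mult_left_mono) auto
  ultimately have "real (card X) * \<delta> ^ (?n - 1) * c ^ ?n \<le> (r + 2) ^ ?n" using * by linarith
  then have "real (card X) * \<delta> ^ (?n - 1) \<le> (r + 2) ^ ?n / c ^ ?n" using c by (simp add: field_simps)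
  also have "\<dots> = ((r + 2) * (2 * (1 + L))) ^ ?n" by (simp add: c_def power_divide power_mult_distrib)
  finally show ?thesis .
qed

text \<open>By the packing bound there is a \<open>\<delta>\<close>-separated subset of largest
  cardinality. Maximality makes the balls of radius \<open>\<delta>\<close> about it a cover, and
  the packing bound, used once more, makes its total weight bounded independently of
  \<open>\<delta>\<close>.\<close>

lemma hausdorff_outer_lipschitz_graph_finite:
  fixes G :: "(real^'n::finite) set"
  assumes G: "G \<subseteq> ball p r" and "r > 0" "norm e = 1" "L \<ge> 0"
    and lip: "\<And>x y. x \<in> G \<Longrightarrow> y \<in> G \<Longrightarrow>
      norm (x - y) \<le> (1 + L) * norm ((x - y) - ((x - y) \<bullet> e) *\<^sub>R e)"
  shows "hausdorff_outer (CARD('n) - 1) G < \<infinity>"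
proof -
  let ?n = "CARD('n)"
  define D where "D = ((r + 2) * (2 * (1 + L))) ^ ?n"
  define v where "v = unit_ball_vol (real (?n - 1))"
  have content: "hausdorff_content (?n - 1) (2 * \<delta>) G \<le> ennreal (v * D)" if \<delta>: "0 < \<delta>" "\<delta> \<le> 1" for \<delta>
  proof -
    define Sep where "Sep X \<longleftrightarrow> finite X \<and> X \<subseteq> G \<and> (\<forall>x\<in>X. \<forall>y\<in>X. x \<noteq> y \<longrightarrow> \<delta> \<le> dist x y)"
      for X :: "(real^'n) set"
    have Sep_card: "real (card X) * \<delta> ^ (?n - 1) \<le> D" if "Sep X" for X
      unfolding D_def
      by (rule card_separated_le[OF G assms(2-4) lip _ _ _ \<delta>]) (use that in \<open>auto simp: Sep_def\<close>)
    have "Sep {}" by (simp add: Sep_def)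
    moreover have "card X < nat \<lceil>D / \<delta> ^ (?n - 1)\<rceil> + 1" if "Sep X" for X
    proof -
      have "real (card X) \<le> D / \<delta> ^ (?n - 1)" using Sep_card[OF that] \<delta> by (simp add: field_simps)
      then show ?thesis by linarith
    qed
    ultimately obtain X where X: "Sep X" "\<And>Y. Sep Y \<Longrightarrow> card Y \<le> card X"
      using ex_has_greatest_nat[of Sep "{}" card "nat \<lceil>D / \<delta> ^ (?n - 1)\<rceil> + 1"] by (metis less_imp_le)
    have cover: "G \<subseteq> (\<Union>x\<in>X. cball x \<delta>)"
    proof (rule ccontr)
      assume "\<not> ?thesis"
      then obtain y where y: "y \<in> G" "\<And>x. x \<in> X \<Longrightarrow> \<delta> < dist x y" by force
      then have "Sep (insert y X)" using X(1) by (auto simp: Sep_def dist_commute intro: less_imp_le)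
      moreover have "y \<notin> X" using y \<delta> by force
      ultimately show False using X(2)[of "insert y X"] X(1) by (auto simp: Sep_def)
    qed
    have "hausdorff_content (?n - 1) (2 * \<delta>) G
        \<le> ennreal (real (card X) * (unit_ball_vol (real (?n - 1)) * (2 * \<delta> / 2) ^ (?n - 1)))"
      by (rule hausdorff_content_le_finite[OF _ cover]) (use X(1) \<delta> in \<open>auto simp: Sep_def\<close>)
    also have "\<dots> = ennreal (v * (real (card X) * \<delta> ^ (?n - 1)))" by (simp add: v_def ac_simps)
    also have "\<dots> \<le> ennreal (v * D)"
      using Sep_card[OF X(1)] by (intro ennreal_leI mult_left_mono) (auto simp: v_def)
    finally show ?thesis .
  qed
  have "hausdorff_outer (?n - 1) G \<le> ennreal (v * D)"
    unfolding hausdorff_outer_def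
  proof (rule SUP_least)
    fix \<delta> :: real assume "\<delta> \<in> {0<..}"
    \<comment> \<open>The bound covers meshes up to 2; for a larger \<open>\<delta>\<close> a
      smaller mesh only increases the content.\<close>
    then show "hausdorff_content (?n - 1) \<delta> G \<le> ennreal (v * D)"
      by (intro order_trans[OF hausdorff_content_antimono content[of "min (\<delta> / 2) 1"]]) auto
  qed
  then show ?thesis by (simp add: order_le_less_trans)
qed

text \<open>Near each of its points the frontier lies on the graph of \<open>g\<close>: openness of
  \<open>\<Omega>\<close> gives one inequality, passage to the closure the other. By compactness
  finitely many such pieces suffice.\<close>

lemma hausdorff_outer_frontier_finite:
  fixes \<Omega> :: "(real^'n::finite) set"
  assumes "bounded \<Omega>" "lipschitz_set \<Omega>"
  shows "hausdorff_outer (CARD('n) - 1) (frontier \<Omega>) < \<infinity>"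
proof -
  let ?H = "hausdorff_outer (CARD('n) - 1) :: (real^'n) set \<Rightarrow> ennreal"
  have "\<exists>r>0. ?H (frontier \<Omega> \<inter> ball p r) < \<infinity>" if p: "p \<in> frontier \<Omega>" for p
  proof -
    obtain r e L g where r: "r > 0" "norm e = 1" "L-lipschitz_on {y. y \<bullet> e = 0} g"
        "\<Omega> \<inter> ball p r = {x \<in> ball p r. g (x - (x \<bullet> e) *\<^sub>R e) < x \<bullet> e}"
      using bspec[OF conjunct2[OF assms(2)[unfolded lipschitz_set_def]] p] by (elim exE conjE)
    have "L \<ge> 0" using r(3) by (rule lipschitz_on_nonneg)
    define P where "P x = x - (x \<bullet> e) *\<^sub>R e" for x
    have P: "P x \<bullet> e = 0" for x
      using r(2) by (simp add: P_def inner_diff_left norm_eq_1)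
    have contg: "continuous_on UNIV (\<lambda>x. g (P x))"
    proof (rule continuous_on_compose2[OF lipschitz_on_continuous_on[OF r(3)]])
      show "continuous_on UNIV P" unfolding P_def[abs_def] by (intro continuous_intros)
    qed (use P in auto)
    have graph: "g (P x) = x \<bullet> e" if x: "x \<in> frontier \<Omega> \<inter> ball p r" for x
    proof (rule antisym)
      have "open \<Omega>" using assms(2) by (simp add: lipschitz_set_def)
      then have "x \<notin> \<Omega>" using x by (auto simp: frontier_def interior_open)
      with r(4) x show "x \<bullet> e \<le> g (P x)" unfolding P_def by force
      have "x \<in> closure (\<Omega> \<inter> ball p r)"
        using x open_Int_closure_subset[of "ball p r" \<Omega>] by (auto simp: frontier_def Int_commute)
      also have "\<dots> \<subseteq> closure {x. g (P x) \<le> x \<bullet> e}"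
        using r(4) by (intro closure_mono) (auto simp: P_def)
      also have "\<dots> = {x. g (P x) \<le> x \<bullet> e}"
        by (intro closure_closed closed_Collect_le contg continuous_intros)
      finally show "g (P x) \<le> x \<bullet> e" by simp
    qed
    have "?H (frontier \<Omega> \<inter> ball p r) < \<infinity>"
    proof (rule hausdorff_outer_lipschitz_graph_finite[OF _ r(1,2) \<open>L \<ge> 0\<close>])
      fix x y assume x: "x \<in> frontier \<Omega> \<inter> ball p r" and y: "y \<in> frontier \<Omega> \<inter> ball p r"
      have Pd: "(x - y) - ((x - y) \<bullet> e) *\<^sub>R e = P x - P y" by (simp add: P_def algebra_simps)
      have "\<bar>(x - y) \<bullet> e\<bar> = dist (g (P x)) (g (P y))"
        using graph[OF x] graph[OF y] by (simp add: dist_real_def inner_diff_left)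
      also have "\<dots> \<le> L * norm (P x - P y)"
        using lipschitz_onD[OF r(3)] P by (simp add: dist_norm)
      finally have 1: "\<bar>(x - y) \<bullet> e\<bar> \<le> L * norm (P x - P y)" .
      have "norm (x - y) = norm ((P x - P y) + ((x - y) \<bullet> e) *\<^sub>R e)" by (simp flip: Pd)
      also have "\<dots> \<le> norm (P x - P y) + \<bar>(x - y) \<bullet> e\<bar>"
        using r(2) norm_triangle_ineq[of "P x - P y" "((x - y) \<bullet> e) *\<^sub>R e"] by simp
      also have "\<dots> \<le> (1 + L) * norm (P x - P y)" using 1 by (simp add: algebra_simps)
      finally show "norm (x - y) \<le> (1 + L) * norm ((x - y) - ((x - y) \<bullet> e) *\<^sub>R e)" by (simp add: Pd)
    qed auto
    then show ?thesis using r(1) by blast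
  qed
  then obtain r where r: "\<And>p. p \<in> frontier \<Omega> \<Longrightarrow> r p > 0 \<and> ?H (frontier \<Omega> \<inter> ball p (r p)) < \<infinity>"
    by metis
  have "frontier \<Omega> \<subseteq> (\<Union>p\<in>frontier \<Omega>. ball p (r p))" using r by force
  then obtain T where T: "T \<subseteq> frontier \<Omega>" "finite T" "frontier \<Omega> \<subseteq> (\<Union>p\<in>T. ball p (r p))"
    using compactE_image[OF compact_frontier_bounded[OF assms(1)], of "frontier \<Omega>" "\<lambda>p. ball p (r p)"]
    by (metis open_ball)
  let ?M = "hausdorff_measure (CARD('n) - 1) :: (real^'n) measure"
  have "?H (frontier \<Omega>) = emeasure ?M (\<Union>p\<in>T. frontier \<Omega> \<inter> ball p (r p))"
  proof -
    have "frontier \<Omega> = (\<Union>p\<in>T. frontier \<Omega> \<inter> ball p (r p))" using T by auto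
    then show ?thesis by (metis emeasure_hausdorff_measure borel_closed frontier_closed)
  qed
  also have "\<dots> \<le> (\<Sum>p\<in>T. emeasure ?M (frontier \<Omega> \<inter> ball p (r p)))"
    using T by (intro emeasure_subadditive_finite) auto
  also have "\<dots> < \<infinity>"
    using T r by (auto simp: emeasure_hausdorff_measure less_top)
  finally show ?thesis .
qed

section \<open>The discrete null Lagrangian\<close>

definition diff_quot :: "real \<Rightarrow> 'n::finite \<Rightarrow> (real^'n \<Rightarrow> 'b::real_normed_vector) \<Rightarrow> real^'n \<Rightarrow> 'b" where
  "diff_quot s i f x = (f (x + s *\<^sub>R axis i 1) - f x) /\<^sub>R s"

lemma diff_quot_nth: "diff_quot s i u x $ l = diff_quot s i (\<lambda>y. u y $ l) x"
  by (simp add: diff_quot_def)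

lemma diff_quot_diff: "diff_quot s i (\<lambda>y. u y - w y) x = diff_quot s i u x - diff_quot s i w x"
  by (simp add: diff_quot_def algebra_simps)

text \<open>With \<open>p\<close> and \<open>q\<close> the derivatives of a field in the directions
  \<open>i\<close> and \<open>j\<close>, the sum over \<open>i\<close> and \<open>j\<close> is the
  trace of the squared Jacobian minus the square of the divergence. The form is alternating in
  \<open>p\<close> and \<open>q\<close>, and this is what cancels the leading terms when both are
  multiples of one vector.\<close>

definition wedge :: "'n \<Rightarrow> 'n \<Rightarrow> real^'n::finite \<Rightarrow> real^'n \<Rightarrow> real" where
  "wedge i j p q = p $ j * q $ i - p $ i * q $ j"

lemma wedge_self: "wedge i j p p = 0"
  by (simp add: wedge_def)

lemma abs_wedge_le: "\<bar>wedge i j p q\<bar> \<le> 2 * norm p * norm q"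
proof -
  have "\<bar>p $ j * q $ i\<bar> \<le> norm p * norm q" "\<bar>p $ i * q $ j\<bar> \<le> norm p * norm q"
    unfolding abs_mult by (auto intro!: mult_mono component_le_norm_cart)
  then show ?thesis unfolding wedge_def by linarith
qed

lemma wedge_add_left: "wedge i j (p + p') q = wedge i j p q + wedge i j p' q"
  and wedge_add_right: "wedge i j p (q + q') = wedge i j p q + wedge i j p q'"
  and wedge_diff_left: "wedge i j (p - p') q = wedge i j p q - wedge i j p' q"
  and wedge_diff_right: "wedge i j p (q - q') = wedge i j p q - wedge i j p q'"
  and wedge_scaleR_left: "wedge i j (c *\<^sub>R p) q = c * wedge i j p q"
  and wedge_scaleR_right: "wedge i j p (c *\<^sub>R q) = c * wedge i j p q"
  by (simp_all add: wedge_def algebra_simps)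

text \<open>The discretised null Lagrangian. The shift by \<open>s\<close> in the first factor makes both discrete
  divergence identities below exact.\<close>

definition null_form :: "real \<Rightarrow> (real^'n::finite \<Rightarrow> real^'n) \<Rightarrow> (real^'n \<Rightarrow> real^'n) \<Rightarrow> real^'n \<Rightarrow> real" where
  "null_form s a b x = (\<Sum>i\<in>UNIV. \<Sum>j\<in>UNIV. wedge i j (diff_quot s i a (x + s *\<^sub>R axis j 1)) (diff_quot s j b x))"

lemma null_form_diff_left: "null_form s (\<lambda>y. a y - a' y) b x = null_form s a b x - null_form s a' b x"
  by (simp add: null_form_def diff_quot_diff wedge_diff_left sum_subtractf)

lemma null_form_diff_right: "null_form s a (\<lambda>y. b y - b' y) x = null_form s a b x - null_form s a b' x"
  by (simp add: null_form_def diff_quot_diff wedge_diff_right sum_subtractf)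

text \<open>Exchanging the names of \<open>i\<close> and \<open>j\<close> in the second product
  makes both products involve the same components, \<open>a $ j\<close> and \<open>b $ i\<close>;
  they then differ only in which direction is used for which factor.\<close>

lemma null_form_alt:
  "null_form s a b x = (\<Sum>i\<in>UNIV. \<Sum>j\<in>UNIV.
     diff_quot s i a (x + s *\<^sub>R axis j 1) $ j * diff_quot s j b x $ i - diff_quot s j a (x + s *\<^sub>R axis i 1) $ j * diff_quot s i b x $ i)"
proof -
  have "(\<Sum>i\<in>UNIV. \<Sum>j\<in>UNIV. diff_quot s i a (x + s *\<^sub>R axis j 1) $ i * diff_quot s j b x $ j)
      = (\<Sum>i\<in>UNIV. \<Sum>j\<in>UNIV. diff_quot s j a (x + s *\<^sub>R axis i 1) $ j * diff_quot s i b x $ i)"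
    by (rule sum.swap)
  then show ?thesis by (simp add: null_form_def wedge_def sum_subtractf)
qed

text \<open>Discrete Leibniz rule: a difference quotient of a product leaves one factor unshifted
  and shifts the other, which is the shift built into \<open>null_form\<close>. The second
  differences of \<open>a\<close> cancel because difference quotients commute. Here \<open>b\<close>
  stays undifferentiated, so only its boundary values and the difference quotients of
  \<open>a\<close> matter.\<close>

lemma null_form_eq_divergence_left:
  "null_form s a b x = (\<Sum>i\<in>UNIV. \<Sum>j\<in>UNIV.
     diff_quot s j (\<lambda>y. b y $ i * diff_quot s i a y $ j) x - diff_quot s i (\<lambda>y. b y $ i * diff_quot s j a y $ j) x)"
  unfolding null_form_alt
proof (intro sum.cong refl)
  fix i j
  have "x + s *\<^sub>R axis i 1 + s *\<^sub>R axis j 1 = x + s *\<^sub>R axis j 1 + s *\<^sub>R axis i 1" by (simp add: algebra_simps)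
  then show "diff_quot s i a (x + s *\<^sub>R axis j 1) $ j * diff_quot s j b x $ i - diff_quot s j a (x + s *\<^sub>R axis i 1) $ j * diff_quot s i b x $ i
    = diff_quot s j (\<lambda>y. b y $ i * diff_quot s i a y $ j) x - diff_quot s i (\<lambda>y. b y $ i * diff_quot s j a y $ j) x"
    by (simp add: diff_quot_def algebra_simps)
qed

text \<open>The counterpart with \<open>a\<close> undifferentiated. Now the other choice in the
  Leibniz rule is made, so \<open>a\<close> occurs at shifted points, and the second differences of
  \<open>b\<close> cancel.\<close>

lemma null_form_eq_divergence_right:
  "null_form s a b x = (\<Sum>i\<in>UNIV. \<Sum>j\<in>UNIV.
     diff_quot s i (\<lambda>y. a (y + s *\<^sub>R axis j 1) $ j * diff_quot s j b y $ i) x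
     - diff_quot s j (\<lambda>y. a (y + s *\<^sub>R axis i 1) $ j * diff_quot s i b y $ i) x)"
  unfolding null_form_alt
proof (intro sum.cong refl)
  fix i j
  have "x + s *\<^sub>R axis i 1 + s *\<^sub>R axis j 1 = x + s *\<^sub>R axis j 1 + s *\<^sub>R axis i 1" by (simp add: algebra_simps)
  then show "diff_quot s i a (x + s *\<^sub>R axis j 1) $ j * diff_quot s j b x $ i - diff_quot s j a (x + s *\<^sub>R axis i 1) $ j * diff_quot s i b x $ i
    = diff_quot s i (\<lambda>y. a (y + s *\<^sub>R axis j 1) $ j * diff_quot s j b y $ i) x
     - diff_quot s j (\<lambda>y. a (y + s *\<^sub>R axis i 1) $ j * diff_quot s i b y $ i) x"
    by (simp add: diff_quot_def algebra_simps)
qed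

section \<open>Splitting a field along and across the direction field\<close>

definition par :: "(real^'n::finite \<Rightarrow> real^'n) \<Rightarrow> (real^'n \<Rightarrow> real^'n) \<Rightarrow> real^'n \<Rightarrow> real^'n" where
  "par \<mu> u x = (u x \<bullet> \<mu> x) *\<^sub>R \<mu> x"

text \<open>Where \<open>\<mu> x\<close> is a unit vector, as on the frontier, this is the component
  orthogonal to \<open>\<mu> x\<close>. Elsewhere \<open>\<mu> x\<close> may be shorter and
  orthogonality may fail; there only the size bounds are used.\<close>

definition perp :: "(real^'n::finite \<Rightarrow> real^'n) \<Rightarrow> (real^'n \<Rightarrow> real^'n) \<Rightarrow> real^'n \<Rightarrow> real^'n" where
  "perp \<mu> u x = u x - par \<mu> u x"

lemma par_diff: "par \<mu> (\<lambda>y. u y - w y) = (\<lambda>x. par \<mu> u x - par \<mu> w x)"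
  by (simp add: par_def fun_eq_iff inner_diff_left scaleR_left_diff_distrib)

lemma norm_par_le:
  assumes "norm (\<mu> x) \<le> 1"
  shows "norm (par \<mu> u x) \<le> norm (u x)"
proof -
  have "\<bar>u x \<bullet> \<mu> x\<bar> * norm (\<mu> x) \<le> (norm (u x) * norm (\<mu> x)) * norm (\<mu> x)"
    by (intro mult_right_mono Cauchy_Schwarz_ineq2) auto
  also have "\<dots> \<le> (norm (u x) * 1) * 1" by (intro mult_mono assms) auto
  finally show ?thesis by (simp add: par_def)
qed

lemma norm_diff_quot_le_lipschitz:
  assumes "\<And>x y. norm (m x - m y) \<le> L * norm (x - y)" "s > 0"
  shows "norm (diff_quot s i m x) \<le> L"
proof -
  have "norm (m (x + s *\<^sub>R axis i 1) - m x) \<le> L * s"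
    using assms(1)[of "x + s *\<^sub>R axis i 1" x] \<open>s > 0\<close> by simp
  moreover have "norm (diff_quot s i m x) = norm (m (x + s *\<^sub>R axis i 1) - m x) / s"
    using \<open>s > 0\<close> by (simp add: diff_quot_def divide_inverse mult.commute)
  ultimately show ?thesis using \<open>s > 0\<close> by (simp add: pos_divide_le_eq)
qed

context
  fixes \<mu> :: "real^'n::finite \<Rightarrow> real^'n" and L :: real
  assumes lip: "\<And>x y. norm (\<mu> x - \<mu> y) \<le> L * norm (x - y)" and le1: "\<And>x. norm (\<mu> x) \<le> 1"
begin

lemma L_nonneg: "L \<ge> 0"
  using order_trans[OF norm_ge_zero lip[of "axis undefined 1" 0]] by simp

lemma abs_inner_le_norm: "norm p \<le> 1 \<Longrightarrow> \<bar>q \<bullet> p\<bar> \<le> norm q" for p q :: "real^'n"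
  using Cauchy_Schwarz_ineq2[of q p] mult_left_le[of "norm p" "norm q"] by simp

lemma diff_quot_par:
  assumes "s > 0"
  shows "diff_quot s i (par \<mu> u) y = (diff_quot s i u y \<bullet> \<mu> (y + s *\<^sub>R axis i 1) + u y \<bullet> diff_quot s i \<mu> y) *\<^sub>R \<mu> (y + s *\<^sub>R axis i 1)
    + (u y \<bullet> \<mu> y) *\<^sub>R diff_quot s i \<mu> y"
  using assms by (simp add: diff_quot_def par_def algebra_simps inner_diff_left inner_diff_right)

text \<open>\<open>\<alpha>\<close> is the difference quotient of \<open>u \<bullet> \<mu>\<close>.
  Both factors of the form must be compared with the same vector \<open>\<mu> x\<close>; moving
  \<open>\<mu>\<close> to \<open>x\<close> costs \<open>2 * L * s\<close>, one step for
  \<open>y\<close> and one for its shift. Apart from this error, \<open>E\<close> contains no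
  difference quotient of \<open>u\<close>.\<close>

lemma diff_quot_par_decomp:
  assumes "s > 0" "norm (y - x) \<le> s"
  obtains \<alpha> E where "diff_quot s i (par \<mu> u) y = \<alpha> *\<^sub>R \<mu> x + E" "\<bar>\<alpha>\<bar> \<le> norm (diff_quot s i u y) + L * norm (u y)"
    "norm E \<le> 2 * L * s * (norm (diff_quot s i u y) + L * norm (u y)) + L * norm (u y)"
proof -
  let ?y' = "y + s *\<^sub>R axis i 1" and ?B = "norm (diff_quot s i u y) + L * norm (u y)"
  define \<alpha> where "\<alpha> = diff_quot s i u y \<bullet> \<mu> ?y' + u y \<bullet> diff_quot s i \<mu> y"
  define E where "E = \<alpha> *\<^sub>R (\<mu> ?y' - \<mu> x) + (u y \<bullet> \<mu> y) *\<^sub>R diff_quot s i \<mu> y"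
  have dm: "norm (diff_quot s i \<mu> y) \<le> L" by (rule norm_diff_quot_le_lipschitz[OF lip \<open>s > 0\<close>])
  have "\<bar>u y \<bullet> diff_quot s i \<mu> y\<bar> \<le> norm (u y) * L"
    by (rule order_trans[OF Cauchy_Schwarz_ineq2 mult_left_mono[OF dm]]) auto
  with abs_inner_le_norm[OF le1, of "diff_quot s i u y" ?y'] have \<alpha>: "\<bar>\<alpha>\<bar> \<le> ?B"
    unfolding \<alpha>_def by (simp add: mult.commute)
  have "norm (?y' - x) \<le> norm (y - x) + s"
    using norm_triangle_ineq[of "y - x" "s *\<^sub>R axis i 1"] \<open>s > 0\<close> by (simp add: algebra_simps)
  then have "norm (?y' - x) \<le> 2 * s" using assms by linarith
  then have "norm (\<mu> ?y' - \<mu> x) \<le> L * (2 * s)"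
    using L_nonneg by (intro order_trans[OF lip] mult_left_mono) auto
  then have "\<bar>\<alpha>\<bar> * norm (\<mu> ?y' - \<mu> x) \<le> ?B * (L * (2 * s))"
    using \<alpha> L_nonneg by (intro mult_mono) auto
  moreover have "\<bar>u y \<bullet> \<mu> y\<bar> * norm (diff_quot s i \<mu> y) \<le> norm (u y) * L"
    using dm abs_inner_le_norm[OF le1] by (intro mult_mono) auto
  ultimately have "norm E \<le> ?B * (L * (2 * s)) + norm (u y) * L"
    unfolding E_def by (intro norm_triangle_mono) auto
  then have "norm E \<le> 2 * L * s * ?B + L * norm (u y)" by (simp add: ac_simps)
  moreover have "diff_quot s i (par \<mu> u) y = \<alpha> *\<^sub>R \<mu> x + E"
    unfolding diff_quot_par[OF \<open>s > 0\<close>] \<alpha>_def[symmetric] E_def by (simp add: algebra_simps)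
  ultimately show ?thesis using \<alpha> that by blast
qed

lemma norm_diff_quot_par_le:
  assumes "s > 0"
  shows "norm (diff_quot s i (par \<mu> u) y) \<le> norm (diff_quot s i u y) + 2 * L * norm (u y)"
proof -
  let ?y' = "y + s *\<^sub>R axis i 1"
  have dm: "norm (diff_quot s i \<mu> y) \<le> L" by (rule norm_diff_quot_le_lipschitz[OF lip \<open>s > 0\<close>])
  have "\<bar>u y \<bullet> diff_quot s i \<mu> y\<bar> \<le> norm (u y) * L"
    by (rule order_trans[OF Cauchy_Schwarz_ineq2 mult_left_mono[OF dm]]) auto
  with abs_inner_le_norm[OF le1, of "diff_quot s i u y" ?y']
  have "\<bar>diff_quot s i u y \<bullet> \<mu> ?y' + u y \<bullet> diff_quot s i \<mu> y\<bar> \<le> norm (diff_quot s i u y) + norm (u y) * L" by linarith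
  then have "\<bar>diff_quot s i u y \<bullet> \<mu> ?y' + u y \<bullet> diff_quot s i \<mu> y\<bar> * norm (\<mu> ?y') \<le> (norm (diff_quot s i u y) + norm (u y) * L) * 1"
    using le1 L_nonneg by (intro mult_mono) auto
  moreover have "\<bar>u y \<bullet> \<mu> y\<bar> * norm (diff_quot s i \<mu> y) \<le> norm (u y) * L"
    using dm abs_inner_le_norm[OF le1] by (intro mult_mono) auto
  ultimately have "norm (diff_quot s i (par \<mu> u) y) \<le> (norm (diff_quot s i u y) + norm (u y) * L) * 1 + norm (u y) * L"
    unfolding diff_quot_par[OF \<open>s > 0\<close>] by (intro norm_triangle_mono) auto
  then show ?thesis by (simp add: algebra_simps)
qed

lemma norm_diff_quot_perp_le:
  assumes "s > 0"
  shows "norm (diff_quot s i (perp \<mu> u) y) \<le> 2 * (norm (diff_quot s i u y) + L * norm (u y))"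
proof -
  have "diff_quot s i (perp \<mu> u) y = diff_quot s i u y - diff_quot s i (par \<mu> u) y"
    unfolding perp_def[abs_def] by (rule diff_quot_diff)
  then have "norm (diff_quot s i (perp \<mu> u) y) \<le> norm (diff_quot s i u y) + norm (diff_quot s i (par \<mu> u) y)"
    by (simp add: norm_triangle_ineq4)
  with norm_diff_quot_par_le[OF assms, of i u y] show ?thesis by (simp add: algebra_simps)
qed

text \<open>The products of first order terms cancel because both are multiples of \<open>\<mu> x\<close>.\<close>

lemma abs_wedge_diff_quot_par_le:
  fixes u :: "real^'n \<Rightarrow> real^'n" and x :: "real^'n" and i j :: 'n and s :: real
  defines "y \<equiv> x + s *\<^sub>R axis j 1"
  defines "A \<equiv> norm (diff_quot s i u y) + L * norm (u y)" and "B \<equiv> norm (diff_quot s j u x) + L * norm (u x)"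
  assumes "s > 0"
  shows "\<bar>wedge i j (diff_quot s i (par \<mu> u) y) (diff_quot s j (par \<mu> u) x)\<bar>
    \<le> 2 * (A * (2 * L * s * B + L * norm (u x)) + (2 * L * s * A + L * norm (u y)) * B
       + (2 * L * s * A + L * norm (u y)) * (2 * L * s * B + L * norm (u x)))"
proof -
  have A0: "0 \<le> A" "0 \<le> B" using L_nonneg by (auto simp: A_def B_def)
  have yx: "norm (y - x) \<le> s" using \<open>s > 0\<close> by (simp add: y_def)
  have "norm (x - x) \<le> s" using \<open>s > 0\<close> by simp
  obtain \<alpha> E where 1: "diff_quot s i (par \<mu> u) y = \<alpha> *\<^sub>R \<mu> x + E" "\<bar>\<alpha>\<bar> \<le> A"
    "norm E \<le> 2 * L * s * A + L * norm (u y)"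
    using diff_quot_par_decomp[OF \<open>s > 0\<close> yx, of i u] unfolding A_def by metis
  obtain \<beta> E' where 2: "diff_quot s j (par \<mu> u) x = \<beta> *\<^sub>R \<mu> x + E'" "\<bar>\<beta>\<bar> \<le> B"
    "norm E' \<le> 2 * L * s * B + L * norm (u x)"
    using diff_quot_par_decomp[OF \<open>s > 0\<close> \<open>norm (x - x) \<le> s\<close>, of j u] unfolding B_def by metis
  have "wedge i j (diff_quot s i (par \<mu> u) y) (diff_quot s j (par \<mu> u) x)
      = \<alpha> * wedge i j (\<mu> x) E' + wedge i j E (\<mu> x) * \<beta> + wedge i j E E'"
    by (simp add: 1 2 wedge_add_left wedge_add_right wedge_scaleR_left wedge_scaleR_right wedge_self)
  also have "\<bar>\<dots>\<bar> \<le> \<bar>\<alpha>\<bar> * \<bar>wedge i j (\<mu> x) E'\<bar> + \<bar>wedge i j E (\<mu> x)\<bar> * \<bar>\<beta>\<bar> + \<bar>wedge i j E E'\<bar>"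
    by (simp flip: abs_mult)
  also have "\<dots> \<le> A * (2 * 1 * (2 * L * s * B + L * norm (u x))) + (2 * (2 * L * s * A + L * norm (u y)) * 1) * B
       + 2 * (2 * L * s * A + L * norm (u y)) * (2 * L * s * B + L * norm (u x))"
    using 1 2 A0 L_nonneg \<open>s > 0\<close>
    by (intro add_mono mult_mono order_trans[OF abs_wedge_le] mult_nonneg_nonneg add_nonneg_nonneg le1) auto
  finally show ?thesis by (simp add: algebra_simps)
qed

end

section \<open>Continuously differentiable fields\<close>

definition C1_fun :: "(real^'n::finite \<Rightarrow> real) \<Rightarrow> bool" where
  "C1_fun f \<longleftrightarrow> (\<forall>x. f differentiable (at x)) \<and> (\<forall>i. continuous_on UNIV (partial i f))"

lemma C_class_1_0_iff: "C_class 1 0 f \<longleftrightarrow> C1_fun f"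
  by (simp add: C1_fun_def)

lemma C1_fun_continuous: "C1_fun f \<Longrightarrow> continuous_on UNIV f"
  by (simp add: C1_fun_def continuous_at_imp_continuous_on differentiable_imp_continuous_within)

lemma C1_fun_diff:
  assumes "C1_fun f" "C1_fun g"
  shows "C1_fun (\<lambda>x. f x - g x)" "partial i (\<lambda>x. f x - g x) = (\<lambda>x. partial i f x - partial i g x)"
proof -
  have p: "partial i (\<lambda>x. f x - g x) = (\<lambda>x. partial i f x - partial i g x)" for i
  proof
    fix x
    have "((\<lambda>x. f x - g x) has_derivative
        (\<lambda>v. frechet_derivative f (at x) v - frechet_derivative g (at x) v)) (at x)"
      using assms by (intro has_derivative_diff) (auto simp: C1_fun_def frechet_derivative_works[symmetric])
    from frechet_derivative_at[OF this, symmetric]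
    show "partial i (\<lambda>x. f x - g x) x = partial i f x - partial i g x"
      by (simp add: partial_def)
  qed
  then show "partial i (\<lambda>x. f x - g x) = (\<lambda>x. partial i f x - partial i g x)" .
  show "C1_fun (\<lambda>x. f x - g x)"
    using assms by (auto simp: C1_fun_def p intro!: differentiable_diff continuous_intros)
qed

lemma diff_quot_mean_value:
  fixes f :: "real^'n::finite \<Rightarrow> real"
  assumes "\<And>x. f differentiable (at x)" "s > 0"
  obtains \<theta> where "0 \<le> \<theta>" "\<theta> \<le> s" "diff_quot s i f x = partial i f (x + \<theta> *\<^sub>R axis i 1)"
proof -
  let ?e = "axis i (1::real) :: real^'n"
  have der: "((\<lambda>t. f (x + t *\<^sub>R ?e)) has_field_derivative partial i f (x + t *\<^sub>R ?e)) (at t)" for t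
  proof -
    have "(f has_derivative frechet_derivative f (at (x + t *\<^sub>R ?e))) (at (x + t *\<^sub>R ?e))"
      using assms(1) frechet_derivative_works by blast
    moreover have "((\<lambda>t. x + t *\<^sub>R ?e) has_derivative (\<lambda>h. h *\<^sub>R ?e)) (at t)"
      by (auto intro!: derivative_eq_intros)
    ultimately have "(f \<circ> (\<lambda>t. x + t *\<^sub>R ?e) has_derivative
        frechet_derivative f (at (x + t *\<^sub>R ?e)) \<circ> (\<lambda>h. h *\<^sub>R ?e)) (at t)"
      by (rule diff_chain_at[rotated])
    moreover have "linear (frechet_derivative f (at (x + t *\<^sub>R ?e)))"
      using assms(1) linear_frechet_derivative by blast
    then have "frechet_derivative f (at (x + t *\<^sub>R ?e)) \<circ> (\<lambda>h. h *\<^sub>R ?e) = (*) (partial i f (x + t *\<^sub>R ?e))"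
      by (auto simp: fun_eq_iff partial_def linear_scale)
    ultimately show ?thesis by (simp add: has_field_derivative_def o_def)
  qed
  obtain z where z: "0 < z" "z < s" "f (x + s *\<^sub>R ?e) - f (x + 0 *\<^sub>R ?e) = (s - 0) * partial i f (x + z *\<^sub>R ?e)"
    using MVT2[OF \<open>s > 0\<close>, of "\<lambda>t. f (x + t *\<^sub>R ?e)" "\<lambda>t. partial i f (x + t *\<^sub>R ?e)"] der by blast
  then have "diff_quot s i f x = partial i f (x + z *\<^sub>R ?e)" using \<open>s > 0\<close> by (simp add: diff_quot_def)
  then show ?thesis using z that by (auto intro: less_imp_le)
qed

definition C1_field :: "(real^'n::finite \<Rightarrow> real^'n) \<Rightarrow> bool" where
  "C1_field u \<longleftrightarrow> (\<forall>l. C1_fun (\<lambda>x. u x $ l))"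

definition partial_vec :: "'n \<Rightarrow> (real^'n::finite \<Rightarrow> real^'n) \<Rightarrow> real^'n \<Rightarrow> real^'n" where
  "partial_vec i u x = (\<chi> l. partial i (\<lambda>y. u y $ l) x)"

text \<open>The value at \<open>s = 0\<close> is the limit, so that letting \<open>s\<close> tend to
  0 becomes continuity in the pair of \<open>s\<close> and \<open>x\<close> up to
  \<open>s = 0\<close>.\<close>

definition diff_quot0 :: "real \<Rightarrow> 'n \<Rightarrow> (real^'n::finite \<Rightarrow> real^'n) \<Rightarrow> real^'n \<Rightarrow> real^'n" where
  "diff_quot0 s i u x = (if s = 0 then partial_vec i u x else diff_quot s i u x)"

lemma C1_field_continuous: "C1_field u \<Longrightarrow> continuous_on UNIV u"
  using continuous_on_vec_lambda[of UNIV "\<lambda>l x. u x $ l"] by (simp add: C1_field_def C1_fun_continuous)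

lemma C1_field_diff:
  assumes "C1_field u" "C1_field w"
  shows "C1_field (\<lambda>x. u x - w x)" "partial_vec i (\<lambda>x. u x - w x) x = partial_vec i u x - partial_vec i w x"
proof -
  have u: "C1_fun (\<lambda>y. u y $ l)" "C1_fun (\<lambda>y. w y $ l)" for l using assms by (auto simp: C1_field_def)
  show "C1_field (\<lambda>x. u x - w x)" using C1_fun_diff(1)[OF u] by (simp add: C1_field_def)
  show "partial_vec i (\<lambda>x. u x - w x) x = partial_vec i u x - partial_vec i w x"
    using C1_fun_diff(2)[OF u] by (simp add: partial_vec_def vec_eq_iff)
qed

text \<open>At \<open>s = 0\<close> the mean value theorem applies: the quotient at a nearby pair is
  a partial derivative at a nearby point, and partial derivatives are continuous.\<close>

lemma continuous_on_diff_quot_scalar: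
  fixes f :: "real^'n::finite \<Rightarrow> real"
  assumes "C1_fun f"
  shows "continuous_on ({0..} \<times> UNIV) (\<lambda>p. if fst p = 0 then partial i f (snd p) else diff_quot (fst p) i f (snd p))"
  unfolding continuous_on_eq_continuous_within
proof
  let ?g = "\<lambda>p. if fst p = 0 then partial i f (snd p) else diff_quot (fst p) i f (snd p)" and ?e = "axis i (1::real) :: real^'n"
  have f: "continuous_on UNIV f" by (rule C1_fun_continuous[OF assms])
  have diff: "\<And>x. f differentiable (at x)" and pc: "continuous_on UNIV (partial i f)"
    using assms by (auto simp: C1_fun_def)
  fix p :: "real \<times> (real^'n)" assume p: "p \<in> {0..} \<times> UNIV"
  show "continuous (at p within {0..} \<times> UNIV) ?g"
  proof (cases "fst p = 0")
    case False
    let ?S = "{0::real<..} \<times> (UNIV :: (real^'n) set)"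
    have "continuous_on ?S (\<lambda>p. diff_quot (fst p) i f (snd p))"
      unfolding diff_quot_def by (intro continuous_intros continuous_on_compose2[OF f]) auto
    moreover have "open ?S" by (intro open_Times) auto
    moreover have "p \<in> ?S" using p False by (cases p) auto
    ultimately have 1: "continuous (at p) (\<lambda>p. diff_quot (fst p) i f (snd p))"
      using continuous_on_eq_continuous_at by blast
    have "eventually (\<lambda>q. q \<in> ?S) (nhds p)"
      using \<open>open ?S\<close> \<open>p \<in> ?S\<close> by (rule eventually_nhds_in_open)
    then have "eventually (\<lambda>q. diff_quot (fst q) i f (snd q) = ?g q) (nhds p)"
      by eventually_elim auto
    then have "continuous (at p) ?g" using 1 by (simp add: isCont_cong)
    then show ?thesis by (rule continuous_at_imp_continuous_at_within)
  next
    case True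
    then obtain x0 where x0: "p = (0, x0)" by (cases p) auto
    show ?thesis
      unfolding continuous_within_eps_delta x0
    proof (intro allI impI)
      fix \<epsilon> :: real assume "\<epsilon> > 0"
      then obtain d where d: "d > 0" "\<And>x. dist x x0 < d \<Longrightarrow> dist (partial i f x) (partial i f x0) < \<epsilon>"
        using pc unfolding continuous_on_iff by (metis UNIV_I)
      show "\<exists>d>0. \<forall>q\<in>{0..} \<times> UNIV. dist q (0, x0) < d \<longrightarrow> dist (?g q) (?g (0, x0)) < \<epsilon>"
      proof (intro exI conjI ballI impI)
        \<comment> \<open>One half of \<open>d\<close> for the distance from \<open>x\<close> to
          \<open>x0\<close>, the other for that from \<open>x\<close> to the intermediate
          point.\<close>
        show "d / 2 > 0" using d by simp
        fix q :: "real \<times> (real^'n)" assume q: "q \<in> {0..} \<times> UNIV" "dist q (0, x0) < d / 2"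
        obtain s x where sx: "q = (s, x)" by (cases q)
        have "s \<ge> 0" using q sx by auto
        have s: "s < d / 2" "dist x x0 < d / 2"
          using q sx dist_fst_le[of q "(0, x0)"] dist_snd_le[of q "(0, x0)"] by (auto simp: dist_real_def)
        show "dist (?g q) (?g (0, x0)) < \<epsilon>"
        proof (cases "s = 0")
          case True
          then show ?thesis using d s sx by auto
        next
          case False
          then obtain \<theta> where \<theta>: "0 \<le> \<theta>" "\<theta> \<le> s" "diff_quot s i f x = partial i f (x + \<theta> *\<^sub>R ?e)"
            using diff_quot_mean_value[OF diff, of s i x] \<open>s \<ge> 0\<close> by auto
          have "dist (x + \<theta> *\<^sub>R ?e) x0 \<le> dist (x + \<theta> *\<^sub>R ?e) x + dist x x0" by (rule dist_triangle)
          also have "\<dots> < d" using \<theta> s by (simp add: dist_norm)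
          finally show ?thesis using d(2) \<theta>(3) False sx by auto
        qed
      qed
    qed
  qed
qed

lemma diff_quot0_nth: "diff_quot0 s i u x $ l = (if s = 0 then partial i (\<lambda>y. u y $ l) x else diff_quot s i (\<lambda>y. u y $ l) x)"
proof (cases "s = 0")
  case True
  then show ?thesis by (simp add: diff_quot0_def partial_vec_def)
next
  case False
  then show ?thesis using diff_quot_nth[of s i u x l] by (simp add: diff_quot0_def)
qed

lemma continuous_on_diff_quot0:
  fixes u :: "real^'n::finite \<Rightarrow> real^'n"
  assumes "C1_field u"
  shows "continuous_on ({0..} \<times> UNIV) (\<lambda>p :: real \<times> (real^'n). diff_quot0 (fst p) i u (snd p))"
proof -
  have "continuous_on ({0..} \<times> UNIV) (\<lambda>p :: real \<times> (real^'n). \<chi> l. diff_quot0 (fst p) i u (snd p) $ l)"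
    unfolding diff_quot0_nth
    by (rule continuous_on_vec_lambda, rule continuous_on_diff_quot_scalar) (use assms in \<open>simp add: C1_field_def\<close>)
  then show ?thesis unfolding vec_nth_inverse .
qed

lemma continuous_on_diff_quot0_shift [continuous_intros]:
  fixes u :: "real^'n::finite \<Rightarrow> real^'n"
  assumes "C1_field u"
  shows "continuous_on ({0..} \<times> UNIV) (\<lambda>p :: real \<times> (real^'n). diff_quot0 (fst p) i u (snd p + fst p *\<^sub>R h))"
proof -
  have 1: "continuous_on ({0..} \<times> UNIV) (\<lambda>p :: real \<times> (real^'n). (fst p, snd p + fst p *\<^sub>R h))"
    by (intro continuous_intros)
  have 2: "(\<lambda>p :: real \<times> (real^'n). (fst p, snd p + fst p *\<^sub>R h)) ` ({0..} \<times> UNIV) \<subseteq> {0..} \<times> UNIV"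
    by auto
  show ?thesis
    using continuous_on_compose2[OF continuous_on_diff_quot0[OF assms, of i] 1 2] by (simp only: fst_conv snd_conv)
qed

lemma diff_quot_bounded:
  fixes u :: "real^'n::finite \<Rightarrow> real^'n"
  assumes "C1_field u" "bounded S"
  obtains K where "K \<ge> 0" "\<And>s i x. 0 < s \<Longrightarrow> s \<le> 1 \<Longrightarrow> x \<in> S \<Longrightarrow> norm (diff_quot s i u x) \<le> K"
proof -
  let ?T = "{0..1::real} \<times> closure S"
  define P where "P i K \<longleftrightarrow> (\<forall>p\<in>?T. norm (diff_quot0 (fst p) i u (snd p)) \<le> K)" for i K
  have "\<exists>K. P i K" for i
  proof -
    have "continuous_on ?T (\<lambda>p. diff_quot0 (fst p) i u (snd p))"
      by (rule continuous_on_subset[OF continuous_on_diff_quot0[OF assms(1)]]) auto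
    moreover have "compact ?T" using assms(2) by (intro compact_Times) auto
    ultimately have "compact ((\<lambda>p. diff_quot0 (fst p) i u (snd p)) ` ?T)"
      by (rule compact_continuous_image)
    from compact_imp_bounded[OF this] show ?thesis
      unfolding bounded_iff P_def ball_simps .
  qed
  then obtain K where K: "\<And>i. P i (K i)" by metis
  show ?thesis
  proof (rule that[of "\<Sum>i\<in>UNIV. \<bar>K i\<bar>"])
    fix s :: real and i x assume sx: "0 < s" "s \<le> 1" "x \<in> S"
    then have "(s, x) \<in> ?T" using closure_subset[of S] by auto
    then have "norm (diff_quot0 s i u x) \<le> K i" using K[of i] unfolding P_def by fastforce
    then have "norm (diff_quot s i u x) \<le> \<bar>K i\<bar>" using sx by (simp add: diff_quot0_def)
    also have "\<dots> \<le> (\<Sum>i\<in>UNIV. \<bar>K i\<bar>)" by (rule member_le_sum) auto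
    finally show "norm (diff_quot s i u x) \<le> (\<Sum>i\<in>UNIV. \<bar>K i\<bar>)" .
  qed (auto intro: sum_nonneg)
qed

text \<open>Uniform continuity on the compact product of the unit interval and
  \<open>closure \<Omega>\<close> gives uniform convergence of the integrands, and the measure of
  \<open>\<Omega>\<close> is finite.\<close>

lemma tendsto_set_integral_at_right_0:
  fixes F :: "real \<times> 'a::euclidean_space \<Rightarrow> real"
  assumes F: "continuous_on ({0..} \<times> UNIV) F" and \<Omega>: "open \<Omega>" "bounded \<Omega>"
  shows "((\<lambda>s. LINT x:\<Omega>|lborel. F (s, x)) \<longlongrightarrow> (LINT x:\<Omega>|lborel. F (0, x))) (at_right 0)"
proof (rule tendstoI)
  fix \<epsilon> :: real assume "\<epsilon> > 0"
  let ?T = "{0..1::real} \<times> closure \<Omega>"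
  define \<eta> where "\<eta> = \<epsilon> / (measure lborel \<Omega> + 1)"
  have pos: "measure lborel \<Omega> + 1 > 0" using measure_nonneg[of lborel \<Omega>] by linarith
  then have "\<eta> > 0" using \<open>\<epsilon> > 0\<close> by (simp add: \<eta>_def)
  moreover have "\<eta> * (measure lborel \<Omega> + 1) = \<epsilon>" using pos by (simp add: \<eta>_def)
  ultimately have \<eta>: "\<eta> > 0" "\<eta> * measure lborel \<Omega> < \<epsilon>" by (simp_all add: distrib_left)
  have "compact ?T" using \<Omega> by (intro compact_Times) auto
  moreover have "continuous_on ?T F" by (rule continuous_on_subset[OF F]) auto
  ultimately have "uniformly_continuous_on ?T F" by (rule compact_uniformly_continuous[rotated])
  then have "\<exists>d>0. \<forall>p\<in>?T. \<forall>q\<in>?T. dist q p < d \<longrightarrow> dist (F q) (F p) < \<eta>"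
    using \<eta>(1) unfolding uniformly_continuous_on_def by blast
  then obtain d where d: "d > 0" "\<And>p q. p \<in> ?T \<Longrightarrow> q \<in> ?T \<Longrightarrow> dist q p < d \<Longrightarrow> dist (F q) (F p) < \<eta>"
    by blast
  have c: "continuous_on UNIV (\<lambda>x. F (s, x))" if "s \<ge> 0" for s
    using that by (intro continuous_on_compose2[OF F] continuous_intros) auto
  have int: "set_integrable lborel \<Omega> (\<lambda>x. F (s, x))" if "s \<ge> 0" for s
    using \<Omega> by (intro set_integrable_continuous_bounded c that) auto
  have "dist (LINT x:\<Omega>|lborel. F (s, x)) (LINT x:\<Omega>|lborel. F (0, x)) < \<epsilon>" if s: "0 < s" "s < min 1 d" for s
  proof -
    have "(LINT x:\<Omega>|lborel. F (s, x)) - (LINT x:\<Omega>|lborel. F (0, x)) = (LINT x:\<Omega>|lborel. F (s, x) - F (0, x))"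
      using int s by (subst set_integral_diff) auto
    also have "\<bar>\<dots>\<bar> \<le> (LINT x:\<Omega>|lborel. \<bar>F (s, x) - F (0, x)\<bar>)"
      using set_integral_norm_bound[OF set_integral_diff(1)[OF int int], of s 0] s by simp
    also have "\<dots> \<le> (LINT x:\<Omega>|lborel. \<eta>)"
    proof (rule set_integral_mono)
      show "set_integrable lborel \<Omega> (\<lambda>x. \<bar>F (s, x) - F (0, x)\<bar>)"
        using s \<Omega> by (intro set_integrable_continuous_bounded continuous_intros c) auto
      show "set_integrable lborel \<Omega> (\<lambda>x. \<eta>)"
        using \<Omega> by (intro set_integrable_continuous_bounded continuous_intros) auto
      fix x assume "x \<in> \<Omega>"
      then have "(s, x) \<in> ?T" "(0, x) \<in> ?T" using s closure_subset[of \<Omega>] by auto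
      then show "\<bar>F (s, x) - F (0, x)\<bar> \<le> \<eta>"
        using d(2)[of "(0, x)" "(s, x)"] s by (simp add: dist_real_def dist_Pair_Pair)
    qed
    also have "\<dots> = \<eta> * measure lborel \<Omega>" using \<Omega> by (simp add: set_lebesgue_integral_def)
    also have "\<dots> < \<epsilon>" by (rule \<eta>)
    finally show ?thesis by (simp add: dist_real_def)
  qed
  then show "\<forall>\<^sub>F s in at_right 0. dist (LINT x:\<Omega>|lborel. F (s, x)) (LINT x:\<Omega>|lborel. F (0, x)) < \<epsilon>"
    unfolding eventually_at_right_field using d(1) by (intro exI[of _ "min 1 d"]) auto
qed

section \<open>Boundary terms and the limit of vanishing step\<close>

definition boundary_integral :: "(real^'n::finite) set \<Rightarrow> (real^'n \<Rightarrow> real) \<Rightarrow> real" where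
  "boundary_integral \<Omega> b = enn2real (\<integral>\<^sup>+x. ennreal (b x) \<partial>boundary_measure \<Omega>)"

lemma boundary_integral_nonneg: "boundary_integral \<Omega> b \<ge> 0"
  by (simp add: boundary_integral_def)

definition frontier_nbhd :: "'a::metric_space set \<Rightarrow> real \<Rightarrow> 'a set" where
  "frontier_nbhd \<Omega> r = {x. \<exists>a\<in>frontier \<Omega>. dist x a \<le> r}"

lemma frontier_nbhd_mono: "r \<le> r' \<Longrightarrow> frontier_nbhd \<Omega> r \<subseteq> frontier_nbhd \<Omega> r'"
  by (force simp: frontier_nbhd_def)

lemma bounded_frontier_nbhd:
  fixes \<Omega> :: "'a::heine_borel set"
  assumes "bounded \<Omega>"
  shows "bounded (frontier_nbhd \<Omega> r)"
proof -
  have "bounded (frontier \<Omega>)" by (rule compact_imp_bounded[OF compact_frontier_bounded[OF assms]])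
  then obtain c R where "\<And>a. a \<in> frontier \<Omega> \<Longrightarrow> dist c a \<le> R" unfolding bounded_def by blast
  then have "dist c x \<le> R + r" if "x \<in> frontier_nbhd \<Omega> r" for x
    using that dist_triangle[of c x] unfolding frontier_nbhd_def by (smt (verit) dist_commute mem_Collect_eq)
  then show ?thesis unfolding bounded_def by blast
qed

lemma continuous_on_diff_quot:
  fixes f :: "real^'n::finite \<Rightarrow> 'b::real_normed_vector"
  assumes "continuous_on UNIV f"
  shows "continuous_on UNIV (diff_quot s i f)"
  unfolding diff_quot_def[abs_def]
  by (intro continuous_intros continuous_on_compose2[OF assms]) auto

text \<open>What the limit of vanishing step retains of the Lipschitz boundary.\<close>

locale finite_boundary =
  fixes \<Omega> :: "(real^'n::finite) set"
  assumes \<Omega>: "open \<Omega>" "bounded \<Omega>" "hausdorff_outer (CARD('n) - 1) (frontier \<Omega>) < \<infinity>"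
begin

lemma boundary_integral_add_const:
  assumes b: "continuous_on UNIV b" "\<And>x. b x \<ge> 0" and "c \<ge> 0"
  shows "boundary_integral \<Omega> (\<lambda>x. b x + c) = boundary_integral \<Omega> b + c * enn2real (hausdorff_outer (CARD('n) - 1) (frontier \<Omega>))"
proof -
  have "(\<integral>\<^sup>+x. ennreal (b x + c) \<partial>boundary_measure \<Omega>)
      = (\<integral>\<^sup>+x. ennreal (b x) + ennreal c \<partial>boundary_measure \<Omega>)"
    using assms by (simp add: ennreal_plus)
  also have "\<dots> = (\<integral>\<^sup>+x. ennreal (b x) \<partial>boundary_measure \<Omega>) + (\<integral>\<^sup>+x. ennreal c \<partial>boundary_measure \<Omega>)"
    using borel_measurable_boundary_measure[OF borel_measurable_continuous_onI[OF b(1)]]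
    by (intro nn_integral_add) auto
  also have "(\<integral>\<^sup>+x. ennreal c \<partial>boundary_measure \<Omega>) = ennreal c * hausdorff_outer (CARD('n) - 1) (frontier \<Omega>)"
    by (simp add: emeasure_boundary_measure)
  finally show ?thesis
    using nn_integral_boundary_measure_finite[OF \<Omega>(2,3) b(1)] \<Omega>(3) \<open>c \<ge> 0\<close>
    by (simp add: boundary_integral_def enn2real_plus enn2real_mult ennreal_mult_less_top)
qed

text \<open>The slack \<open>\<eta>\<close> allows for factors evaluated a step away from
  \<open>x\<close>. It adds \<open>\<eta>\<close> times the measure of the frontier, which takes one
  half of \<open>\<epsilon>\<close>; the other half goes to the layer estimate.\<close>

lemma eventually_integral_diff_quot_le:
  fixes F :: "real \<Rightarrow> real^'n \<Rightarrow> real"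
  assumes b: "continuous_on UNIV b" "\<And>x. b x \<ge> 0" and K: "K \<ge> 0" and "\<epsilon> > 0"
    and F: "\<And>s. continuous_on UNIV (F s)"
    and bd: "\<And>\<eta>. \<eta> > 0 \<Longrightarrow> \<forall>\<^sub>F s in at_right 0. \<forall>x\<in>frontier_nbhd \<Omega> s. \<bar>F s x\<bar> \<le> K * (b x + \<eta>)"
  shows "\<forall>\<^sub>F s in at_right 0. \<bar>LINT x:\<Omega>|lborel. diff_quot s i (F s) x\<bar>
    \<le> K * hausdorff_const CARD('n) * (boundary_integral \<Omega> b + \<epsilon>)"
proof -
  define h where "h = enn2real (hausdorff_outer (CARD('n) - 1) (frontier \<Omega>))"
  have h: "h \<ge> 0" by (simp add: h_def)
  define \<eta> where "\<eta> = \<epsilon> / (2 * (h + 1))"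
  have \<eta>: "\<eta> > 0" "\<eta> * h \<le> \<epsilon> / 2" using \<open>\<epsilon> > 0\<close> h by (auto simp: \<eta>_def field_simps)
  have b': "continuous_on UNIV (\<lambda>x. b x + \<eta>)" "\<And>x. b x + \<eta> \<ge> 0"
    using b \<eta>(1) by (auto intro!: continuous_intros add_nonneg_nonneg)
  have "norm (axis i (1::real) :: real^'n) \<le> 1" "\<epsilon> / 2 > 0" using \<open>\<epsilon> > 0\<close> by auto
  from integral_difference_quotient_boundary_bound[OF \<Omega> this(1) b' this(2)]
  obtain s0 where s0: "s0 > 0"
    "\<And>s K F. 0 < s \<Longrightarrow> s < s0 \<Longrightarrow> K \<ge> 0 \<Longrightarrow> continuous_on UNIV F \<Longrightarrow>
       (\<And>x. \<exists>a\<in>frontier \<Omega>. dist x a \<le> s \<Longrightarrow> \<bar>F x\<bar> \<le> K * (b x + \<eta>)) \<Longrightarrow>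
       \<bar>LINT x:\<Omega>|lborel. (F (x + s *\<^sub>R axis i 1) - F x) / s\<bar>
       \<le> K * hausdorff_const CARD('n) * (boundary_integral \<Omega> (\<lambda>x. b x + \<eta>) + \<epsilon> / 2)"
    unfolding boundary_integral_def by blast
  have "\<forall>\<^sub>F s in at_right 0. 0 < s \<and> s < s0"
    using s0(1) unfolding eventually_at_right_field by blast
  with bd[OF \<eta>(1)] show ?thesis
  proof eventually_elim
    case (elim s)
    have "\<bar>LINT x:\<Omega>|lborel. (F s (x + s *\<^sub>R axis i 1) - F s x) / s\<bar>
        \<le> K * hausdorff_const CARD('n) * (boundary_integral \<Omega> (\<lambda>x. b x + \<eta>) + \<epsilon> / 2)"
      using elim K F by (intro s0(2)) (auto simp: frontier_nbhd_def)
    also have "boundary_integral \<Omega> (\<lambda>x. b x + \<eta>) = boundary_integral \<Omega> b + \<eta> * h"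
      unfolding h_def by (rule boundary_integral_add_const[OF b]) (use \<eta> in auto)
    also have "K * hausdorff_const CARD('n) * (boundary_integral \<Omega> b + \<eta> * h + \<epsilon> / 2) \<le> K * hausdorff_const CARD('n) * (boundary_integral \<Omega> b + \<epsilon>)"
      using \<eta> K hausdorff_const_pos[of "CARD('n)"] by (intro mult_left_mono) auto
    finally show ?case by (simp add: diff_quot_def divide_inverse mult.commute)
  qed
qed

text \<open>The factor \<open>2 * (real CARD('n))\<^sup>2\<close> counts two difference quotients
  for each pair of indices.\<close>

lemma eventually_integral_sum_diff_quot_le:
  fixes F G :: "'n \<Rightarrow> 'n \<Rightarrow> real \<Rightarrow> real^'n \<Rightarrow> real"
  assumes b: "continuous_on UNIV b" "\<And>x. b x \<ge> 0" and K: "K \<ge> 0" and "\<epsilon> > 0"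
    and F: "\<And>i j s. continuous_on UNIV (F i j s)" and G: "\<And>i j s. continuous_on UNIV (G i j s)"
    and bd: "\<And>i j \<eta>. \<eta> > 0 \<Longrightarrow> \<forall>\<^sub>F s in at_right 0. \<forall>x\<in>frontier_nbhd \<Omega> s. \<bar>F i j s x\<bar> \<le> K * (b x + \<eta>)"
      "\<And>i j \<eta>. \<eta> > 0 \<Longrightarrow> \<forall>\<^sub>F s in at_right 0. \<forall>x\<in>frontier_nbhd \<Omega> s. \<bar>G i j s x\<bar> \<le> K * (b x + \<eta>)"
  shows "\<forall>\<^sub>F s in at_right 0. \<bar>LINT x:\<Omega>|lborel. (\<Sum>i\<in>UNIV. \<Sum>j\<in>UNIV.
      diff_quot s (k i j) (F i j s) x - diff_quot s (l i j) (G i j s) x)\<bar>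
    \<le> 2 * (real CARD('n))\<^sup>2 * K * hausdorff_const CARD('n) * (boundary_integral \<Omega> b + \<epsilon>)"
proof -
  let ?B = "K * hausdorff_const CARD('n) * (boundary_integral \<Omega> b + \<epsilon>)"
  have "\<forall>\<^sub>F s in at_right 0. \<forall>i\<in>UNIV. \<forall>j\<in>UNIV. \<bar>LINT x:\<Omega>|lborel. diff_quot s (k i j) (F i j s) x\<bar> \<le> ?B"
    by (intro eventually_ball_finite ballI eventually_integral_diff_quot_le assms finite)
  moreover have "\<forall>\<^sub>F s in at_right 0. \<forall>i\<in>UNIV. \<forall>j\<in>UNIV. \<bar>LINT x:\<Omega>|lborel. diff_quot s (l i j) (G i j s) x\<bar> \<le> ?B"
    by (intro eventually_ball_finite ballI eventually_integral_diff_quot_le assms finite)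
  ultimately show ?thesis
  proof eventually_elim
    case (elim s)
    have int: "set_integrable lborel \<Omega> (diff_quot s (k i j) (F i j s))" "set_integrable lborel \<Omega> (diff_quot s (l i j) (G i j s))" for i j
      using \<Omega> F G by (auto intro!: set_integrable_continuous_bounded continuous_on_diff_quot)
    have "(LINT x:\<Omega>|lborel. (\<Sum>i\<in>UNIV. \<Sum>j\<in>UNIV. diff_quot s (k i j) (F i j s) x - diff_quot s (l i j) (G i j s) x))
      = (\<Sum>i\<in>UNIV. \<Sum>j\<in>UNIV. (LINT x:\<Omega>|lborel. diff_quot s (k i j) (F i j s) x) - (LINT x:\<Omega>|lborel. diff_quot s (l i j) (G i j s) x))"
      using int unfolding set_lebesgue_integral_def set_integrable_def
      by (simp add: sum_distrib_left right_diff_distrib)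
    also have "\<bar>\<dots>\<bar> \<le> (\<Sum>i\<in>(UNIV::'n set). \<Sum>j\<in>(UNIV::'n set). ?B + ?B)"
      using elim by (intro order_trans[OF sum_abs] sum_mono order_trans[OF abs_triangle_ineq4] add_mono) auto
    also have "\<dots> = 2 * (real CARD('n))\<^sup>2 * K * hausdorff_const CARD('n) * (boundary_integral \<Omega> b + \<epsilon>)"
      by (simp add: power2_eq_square)
    finally show ?case .
  qed
qed

lemma eventually_at_right_0_le_1: "\<forall>\<^sub>F s::real in at_right 0. 0 < s \<and> s \<le> 1"
  unfolding eventually_at_right_field by (intro exI[of _ 1]) auto

text \<open>To be applied with \<open>a = par \<mu> w\<close> and \<open>b = perp \<mu> u\<close>:
  the bound \<open>K\<close> then depends on \<open>w\<close> and \<open>\<mu>\<close> alone, and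
  \<open>u\<close> enters through the boundary integral.\<close>

lemma eventually_integral_null_form_left:
  fixes a b :: "real^'n \<Rightarrow> real^'n"
  assumes a: "continuous_on UNIV a" and b: "continuous_on UNIV b" and K: "K \<ge> 0" and "\<epsilon> > 0"
    and bd: "\<And>s i x. 0 < s \<Longrightarrow> s \<le> 1 \<Longrightarrow> x \<in> frontier_nbhd \<Omega> 1 \<Longrightarrow> norm (diff_quot s i a x) \<le> K"
  shows "\<forall>\<^sub>F s in at_right 0. \<bar>LINT x:\<Omega>|lborel. null_form s a b x\<bar>
    \<le> 2 * (real CARD('n))\<^sup>2 * K * hausdorff_const CARD('n) * (boundary_integral \<Omega> (\<lambda>x. norm (b x)) + \<epsilon>)"
  unfolding null_form_eq_divergence_left
proof (rule eventually_integral_sum_diff_quot_le[OF _ _ K \<open>\<epsilon> > 0\<close>])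
  show "continuous_on UNIV (\<lambda>x. norm (b x))" using b by (intro continuous_intros)
  show "continuous_on UNIV (\<lambda>y. b y $ i * diff_quot s i a y $ j)" "continuous_on UNIV (\<lambda>y. b y $ i * diff_quot s j a y $ j)" for i j s
    by (intro continuous_intros b continuous_on_diff_quot a)+
  have *: "\<bar>b x $ i * diff_quot s k a x $ j\<bar> \<le> K * (norm (b x) + \<eta>)"
    if "\<eta> > 0" "0 < s" "s \<le> 1" "x \<in> frontier_nbhd \<Omega> s" for i j k \<eta> s x
  proof -
    have "x \<in> frontier_nbhd \<Omega> 1" using frontier_nbhd_mono that by blast
    then have "\<bar>diff_quot s k a x $ j\<bar> \<le> K"
      using bd[of s x k] that component_le_norm_cart order_trans by blast
    then have "\<bar>b x $ i\<bar> * \<bar>diff_quot s k a x $ j\<bar> \<le> (norm (b x) + \<eta>) * K"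
      using component_le_norm_cart[of "b x" i] that by (intro mult_mono) auto
    then show ?thesis by (simp add: abs_mult mult.commute)
  qed
  show "\<forall>\<^sub>F s in at_right 0. \<forall>x\<in>frontier_nbhd \<Omega> s. \<bar>b x $ i * diff_quot s i a x $ j\<bar> \<le> K * (norm (b x) + \<eta>)"
    "\<forall>\<^sub>F s in at_right 0. \<forall>x\<in>frontier_nbhd \<Omega> s. \<bar>b x $ i * diff_quot s j a x $ j\<bar> \<le> K * (norm (b x) + \<eta>)" if "\<eta> > 0" for i j \<eta>
    using eventually_at_right_0_le_1 by (eventually_elim, use * that in blast)+
qed auto

text \<open>To be applied with \<open>a = perp \<mu> u\<close> and \<open>b = w\<close>. Since
  \<open>a\<close> sits at a point shifted by \<open>s\<close>, its uniform continuity near the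
  frontier is needed to return to \<open>x\<close> at the cost \<open>\<eta>\<close>; radius 2
  leaves room for a point within 1 of the frontier and a shift of at most 1.\<close>

lemma eventually_integral_null_form_right:
  fixes a b :: "real^'n \<Rightarrow> real^'n"
  assumes a: "continuous_on UNIV a" and b: "continuous_on UNIV b" and K: "K \<ge> 0" and "\<epsilon> > 0"
    and bd: "\<And>s i x. 0 < s \<Longrightarrow> s \<le> 1 \<Longrightarrow> x \<in> frontier_nbhd \<Omega> 1 \<Longrightarrow> norm (diff_quot s i b x) \<le> K"
  shows "\<forall>\<^sub>F s in at_right 0. \<bar>LINT x:\<Omega>|lborel. null_form s a b x\<bar>
    \<le> 2 * (real CARD('n))\<^sup>2 * K * hausdorff_const CARD('n) * (boundary_integral \<Omega> (\<lambda>x. norm (a x)) + \<epsilon>)"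
  unfolding null_form_eq_divergence_right
proof (rule eventually_integral_sum_diff_quot_le[OF _ _ K \<open>\<epsilon> > 0\<close>])
  show "continuous_on UNIV (\<lambda>x. norm (a x))" using a by (intro continuous_intros)
  have as: "continuous_on UNIV (\<lambda>y. a (y + h))" for h
    by (intro continuous_on_compose2[OF a] continuous_intros) auto
  show "continuous_on UNIV (\<lambda>y. a (y + s *\<^sub>R axis j 1) $ j * diff_quot s j b y $ i)"
    "continuous_on UNIV (\<lambda>y. a (y + s *\<^sub>R axis i 1) $ j * diff_quot s i b y $ i)" for i j s
    by (intro continuous_intros b continuous_on_diff_quot as)+
  have *: "\<forall>\<^sub>F s in at_right 0. \<forall>x\<in>frontier_nbhd \<Omega> s. \<forall>k m i j. \<bar>a (x + s *\<^sub>R axis k 1) $ j * diff_quot s m b x $ i\<bar> \<le> K * (norm (a x) + \<eta>)"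
    if "\<eta> > 0" for \<eta>
  proof -
    let ?T = "closure (frontier_nbhd \<Omega> 2)"
    have "compact ?T" using bounded_frontier_nbhd[OF \<Omega>(2)] by simp
    then have "uniformly_continuous_on ?T a"
      using compact_uniformly_continuous continuous_on_subset[OF a] by blast
    then obtain d where d: "d > 0" "\<And>x y. x \<in> ?T \<Longrightarrow> y \<in> ?T \<Longrightarrow> dist y x < d \<Longrightarrow> dist (a y) (a x) < \<eta>"
      using \<open>\<eta> > 0\<close> unfolding uniformly_continuous_on_def by blast
    have "\<forall>\<^sub>F s in at_right 0. s < d"
      using d(1) unfolding eventually_at_right_field by blast
    with eventually_at_right_0_le_1 show ?thesis
    proof eventually_elim
      case (elim s)
      show ?case
      proof (intro ballI allI)
        fix x k m i j assume "x \<in> frontier_nbhd \<Omega> s"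
        then obtain p where p: "p \<in> frontier \<Omega>" "dist x p \<le> s" by (auto simp: frontier_nbhd_def)
        let ?y = "x + s *\<^sub>R axis k 1"
        have "dist ?y x = s" using elim by (simp add: dist_norm)
        then have "dist ?y p \<le> 2" using p elim dist_triangle[of ?y p x] by linarith
        then have "?y \<in> frontier_nbhd \<Omega> 2" "x \<in> frontier_nbhd \<Omega> 2" "x \<in> frontier_nbhd \<Omega> 1" using p elim
          by (auto simp: frontier_nbhd_def intro!: bexI[of _ p])
        then have "?y \<in> ?T" "x \<in> ?T" using closure_subset by blast+
        then have "dist (a ?y) (a x) < \<eta>" using d(2) elim \<open>dist ?y x = s\<close> by simp
        then have "norm (a ?y) \<le> norm (a x) + \<eta>"
          using norm_triangle_ineq2[of "a ?y" "a x"] by (simp add: dist_norm)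
        then have 1: "\<bar>a ?y $ j\<bar> \<le> norm (a x) + \<eta>" using component_le_norm_cart order_trans by blast
        have "\<bar>diff_quot s m b x $ i\<bar> \<le> K"
          using bd[of s x m] \<open>x \<in> frontier_nbhd \<Omega> 1\<close> elim component_le_norm_cart order_trans by blast
        with 1 have "\<bar>a ?y $ j\<bar> * \<bar>diff_quot s m b x $ i\<bar> \<le> (norm (a x) + \<eta>) * K"
          using \<open>\<eta> > 0\<close> by (intro mult_mono) auto
        then show "\<bar>a ?y $ j * diff_quot s m b x $ i\<bar> \<le> K * (norm (a x) + \<eta>)" by (simp add: abs_mult mult.commute)
      qed
    qed
  qed
  show "\<forall>\<^sub>F s in at_right 0. \<forall>x\<in>frontier_nbhd \<Omega> s. \<bar>a (x + s *\<^sub>R axis j 1) $ j * diff_quot s j b x $ i\<bar> \<le> K * (norm (a x) + \<eta>)"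
    "\<forall>\<^sub>F s in at_right 0. \<forall>x\<in>frontier_nbhd \<Omega> s. \<bar>a (x + s *\<^sub>R axis i 1) $ j * diff_quot s i b x $ i\<bar> \<le> K * (norm (a x) + \<eta>)"
    if "\<eta> > 0" for i j \<eta>
    using *[OF that] by (eventually_elim, blast)+
qed auto

section \<open>The terms that are estimated pointwise\<close>

definition diff_quot_size :: "real \<Rightarrow> (real^'n \<Rightarrow> real^'n) \<Rightarrow> real \<Rightarrow> 'n \<Rightarrow> real^'n \<Rightarrow> real^'n \<Rightarrow> real" where
  "diff_quot_size L u s i h x = norm (diff_quot0 s i u (x + s *\<^sub>R h)) + L * norm (u (x + s *\<^sub>R h))"

text \<open>Three bounds for each pair of indices: that of \<open>abs_wedge_diff_quot_par_le\<close>
  for \<open>par \<mu> u\<close> paired with itself, and those for \<open>perp \<mu> u\<close>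
  paired with \<open>z\<close> and \<open>par \<mu> z\<close> paired with
  \<open>perp \<mu> u\<close>, where \<open>z\<close> stands for \<open>u - w\<close>. Each 4 is the
  2 of \<open>abs_wedge_le\<close> times the 2 of \<open>norm_diff_quot_perp_le\<close>;
  \<open>2 * L\<close> comes from \<open>norm_diff_quot_par_le\<close>.\<close>

definition remainder :: "real \<Rightarrow> (real^'n \<Rightarrow> real^'n) \<Rightarrow> (real^'n \<Rightarrow> real^'n) \<Rightarrow> real \<times> (real^'n) \<Rightarrow> real" where
  "remainder L u z p = (case p of (s, x) \<Rightarrow> \<Sum>i\<in>UNIV. \<Sum>j\<in>UNIV.
     2 * (diff_quot_size L u s i (axis j 1) x * (2 * L * s * diff_quot_size L u s j 0 x + L * norm (u x))
       + (2 * L * s * diff_quot_size L u s i (axis j 1) x + L * norm (u (x + s *\<^sub>R axis j 1))) * diff_quot_size L u s j 0 x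
       + (2 * L * s * diff_quot_size L u s i (axis j 1) x + L * norm (u (x + s *\<^sub>R axis j 1)))
         * (2 * L * s * diff_quot_size L u s j 0 x + L * norm (u x)))
     + 4 * diff_quot_size L u s i (axis j 1) x * norm (diff_quot0 s j z x)
     + 4 * diff_quot_size (2 * L) z s i (axis j 1) x * diff_quot_size L u s j 0 x)"

lemma continuous_on_remainder:
  assumes u: "C1_field u" and z: "C1_field z"
  shows "continuous_on ({0..} \<times> UNIV) (remainder L u z)"
proof -
  have c: "continuous_on ({0..} \<times> UNIV) (\<lambda>p :: real \<times> (real^'n). v (snd p + fst p *\<^sub>R h))"
    if "C1_field v" for v :: "real^'n \<Rightarrow> real^'n" and h
    by (intro continuous_on_compose2[OF C1_field_continuous[OF that]] continuous_intros) auto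
  have c0: "continuous_on ({0..} \<times> UNIV) (\<lambda>p :: real \<times> (real^'n). v (snd p))"
    if "C1_field v" for v :: "real^'n \<Rightarrow> real^'n"
    by (intro continuous_on_compose2[OF C1_field_continuous[OF that]] continuous_intros) auto
  have d: "continuous_on ({0..} \<times> UNIV) (\<lambda>p :: real \<times> (real^'n). diff_quot_size M v (fst p) i h (snd p))"
    if "C1_field v" for v :: "real^'n \<Rightarrow> real^'n" and M i h
    unfolding diff_quot_size_def by (intro continuous_intros c that)
  show ?thesis
    unfolding remainder_def[abs_def] case_prod_beta
    by (intro continuous_intros c c0 d u z continuous_on_diff_quot0)
qed

lemma C1_null_form_limit:
  assumes u: "C1_field u"
  shows "((\<lambda>s. LINT x:\<Omega>|lborel. null_form s u u x) \<longlongrightarrow>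
    (LINT x:\<Omega>|lborel. (\<Sum>i\<in>UNIV. \<Sum>j\<in>UNIV. wedge i j (partial_vec i u x) (partial_vec j u x)))) (at_right 0)"
proof -
  let ?F = "\<lambda>p. \<Sum>i\<in>UNIV. \<Sum>j\<in>UNIV. wedge i j (diff_quot0 (fst p) i u (snd p + fst p *\<^sub>R axis j 1)) (diff_quot0 (fst p) j u (snd p))"
  have "continuous_on ({0..} \<times> UNIV) ?F"
    unfolding wedge_def by (intro continuous_intros u continuous_on_diff_quot0)
  from tendsto_set_integral_at_right_0[OF this \<Omega>(1,2)]
  have "((\<lambda>s. LINT x:\<Omega>|lborel. ?F (s, x)) \<longlongrightarrow>
    (LINT x:\<Omega>|lborel. (\<Sum>i\<in>UNIV. \<Sum>j\<in>UNIV. wedge i j (partial_vec i u x) (partial_vec j u x)))) (at_right 0)"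
    by (simp add: diff_quot0_def)
  moreover have "\<forall>\<^sub>F s in at_right 0. (LINT x:\<Omega>|lborel. ?F (s, x)) = (LINT x:\<Omega>|lborel. null_form s u u x)"
    using eventually_at_right_0_le_1 by eventually_elim (simp add: diff_quot0_def null_form_def)
  ultimately show ?thesis by (rule Lim_transform_eventually)
qed

lemma continuous_on_null_form:
  assumes "continuous_on UNIV a" "continuous_on UNIV b"
  shows "continuous_on UNIV (null_form s a b)"
proof -
  have "continuous_on UNIV (\<lambda>x. diff_quot s i a (x + h))" for i h
    by (intro continuous_on_compose2[OF continuous_on_diff_quot[OF assms(1)]] continuous_intros) auto
  then show ?thesis
    unfolding null_form_def[abs_def] wedge_def by (intro continuous_intros continuous_on_diff_quot assms)
qed

text \<open>Expand with \<open>u = par \<mu> u + perp \<mu> u\<close>, then write \<open>u\<close>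
  as \<open>w\<close> plus \<open>u - w\<close> in the partner of \<open>perp \<mu> u\<close>. The
  two terms with \<open>w\<close> are kept: there \<open>perp \<mu> u\<close> can be left
  undifferentiated against a fixed field. All others are estimated pointwise.\<close>

lemma null_form_le_remainder:
  fixes \<mu> u w :: "real^'n \<Rightarrow> real^'n"
  assumes \<mu>: "\<And>x y. norm (\<mu> x - \<mu> y) \<le> L * norm (x - y)" "\<And>x. norm (\<mu> x) \<le> 1" and "s > 0"
  shows "null_form s u u x \<le> remainder L u (\<lambda>y. u y - w y) (s, x)
    + null_form s (perp \<mu> u) w x + null_form s (par \<mu> w) (perp \<mu> u) x"
proof -
  let ?z = "\<lambda>y. u y - w y" and ?Q = "par \<mu>" and ?t = "perp \<mu> u"
  have L: "L \<ge> 0" by (rule L_nonneg[OF \<mu>])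
  have t: "?t = (\<lambda>y. u y - ?Q u y)" by (simp add: fun_eq_iff perp_def)
  have "null_form s u u x = null_form s (?Q u) (?Q u) x + null_form s ?t u x + null_form s (?Q u) ?t x"
    unfolding t null_form_diff_left null_form_diff_right by simp
  also have "null_form s ?t u x = null_form s ?t ?z x + null_form s ?t w x"
    unfolding null_form_diff_right by simp
  also have "null_form s (?Q u) ?t x = null_form s (?Q ?z) ?t x + null_form s (?Q w) ?t x"
    unfolding par_diff null_form_diff_left by simp
  finally have eq: "null_form s u u x = (null_form s (?Q u) (?Q u) x + null_form s ?t ?z x + null_form s (?Q ?z) ?t x)
    + null_form s ?t w x + null_form s (?Q w) ?t x" by simp
  have diff_quot_size: "diff_quot_size M v s i h x = norm (diff_quot s i v (x + s *\<^sub>R h)) + M * norm (v (x + s *\<^sub>R h))" for M v i h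
    using \<open>s > 0\<close> by (simp add: diff_quot_size_def diff_quot0_def)
  have dd0: "diff_quot_size M v s i 0 x = norm (diff_quot s i v x) + M * norm (v x)" for M v i
    using diff_quot_size[of M v i 0] by simp
  have nn: "diff_quot_size M v s i h x \<ge> 0" if "M \<ge> 0" for M v i h using that by (simp add: diff_quot_size_def)
  have "null_form s (?Q u) (?Q u) x + null_form s ?t ?z x + null_form s (?Q ?z) ?t x \<le> remainder L u ?z (s, x)"
    unfolding null_form_def remainder_def prod.case sum.distrib[symmetric]
  proof (intro sum_mono add_mono)
    fix i j
    let ?y = "x + s *\<^sub>R axis j 1"
    show "wedge i j (diff_quot s i (?Q u) ?y) (diff_quot s j (?Q u) x)
      \<le> 2 * (diff_quot_size L u s i (axis j 1) x * (2 * L * s * diff_quot_size L u s j 0 x + L * norm (u x))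
       + (2 * L * s * diff_quot_size L u s i (axis j 1) x + L * norm (u (x + s *\<^sub>R axis j 1))) * diff_quot_size L u s j 0 x
       + (2 * L * s * diff_quot_size L u s i (axis j 1) x + L * norm (u (x + s *\<^sub>R axis j 1)))
         * (2 * L * s * diff_quot_size L u s j 0 x + L * norm (u x)))"
      using order_trans[OF abs_ge_self abs_wedge_diff_quot_par_le[OF \<mu> \<open>s > 0\<close>, of i j u x]]
      by (simp only: diff_quot_size scaleR_zero_right add_0_right)
    have "wedge i j (diff_quot s i ?t ?y) (diff_quot s j ?z x) \<le> 2 * norm (diff_quot s i ?t ?y) * norm (diff_quot s j ?z x)"
      by (rule order_trans[OF abs_ge_self abs_wedge_le])
    also have "\<dots> \<le> 2 * (2 * diff_quot_size L u s i (axis j 1) x) * norm (diff_quot s j ?z x)"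
      using norm_diff_quot_perp_le[OF \<mu> \<open>s > 0\<close>, of i u ?y] by (intro mult_right_mono mult_left_mono) (auto simp: diff_quot_size)
    finally show "wedge i j (diff_quot s i ?t ?y) (diff_quot s j ?z x) \<le> 4 * diff_quot_size L u s i (axis j 1) x * norm (diff_quot0 s j ?z x)"
      using \<open>s > 0\<close> by (simp add: diff_quot0_def)
    have "wedge i j (diff_quot s i (?Q ?z) ?y) (diff_quot s j ?t x) \<le> 2 * norm (diff_quot s i (?Q ?z) ?y) * norm (diff_quot s j ?t x)"
      by (rule order_trans[OF abs_ge_self abs_wedge_le])
    also have "\<dots> \<le> 2 * diff_quot_size (2 * L) ?z s i (axis j 1) x * (2 * diff_quot_size L u s j 0 x)"
      using norm_diff_quot_perp_le[OF \<mu> \<open>s > 0\<close>, of j u x] norm_diff_quot_par_le[OF \<mu> \<open>s > 0\<close>, of i ?z ?y] nn[of "2 * L"] L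
      by (intro mult_mono) (simp_all add: diff_quot_size dd0)
    finally show "wedge i j (diff_quot s i (?Q ?z) ?y) (diff_quot s j ?t x) \<le> 4 * diff_quot_size (2 * L) ?z s i (axis j 1) x * diff_quot_size L u s j 0 x"
      by simp
  qed
  with eq show ?thesis by linarith
qed

text \<open>\<open>M\<close> is built from bounds for the difference quotients of \<open>w\<close>
  and \<open>par \<mu> w\<close> near the frontier, so it serves all \<open>u\<close> at
  once.\<close>

lemma integral_null_form_le:
  fixes \<mu> w :: "real^'n \<Rightarrow> real^'n"
  assumes \<mu>: "\<And>x y. norm (\<mu> x - \<mu> y) \<le> L * norm (x - y)" "\<And>x. norm (\<mu> x) \<le> 1" and w: "C1_field w"
  obtains M where "M \<ge> 0" "\<And>u. C1_field u \<Longrightarrow>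
    (LINT x:\<Omega>|lborel. (\<Sum>i\<in>UNIV. \<Sum>j\<in>UNIV. wedge i j (partial_vec i u x) (partial_vec j u x)))
    \<le> (LINT x:\<Omega>|lborel. remainder L u (\<lambda>y. u y - w y) (0, x)) + M * boundary_integral \<Omega> (\<lambda>x. norm (perp \<mu> u x))"
proof -
  let ?N = "frontier_nbhd \<Omega> 1" and ?Q = "par \<mu>"
  have L: "L \<ge> 0" by (rule L_nonneg[OF \<mu>])
  have "L-lipschitz_on UNIV \<mu>" using \<mu>(1) L by (intro lipschitz_onI) (auto simp: dist_norm)
  then have c\<mu>: "continuous_on UNIV \<mu>" by (rule lipschitz_on_continuous_on)
  have cw: "continuous_on UNIV w" using w by (rule C1_field_continuous)
  have cQ: "continuous_on UNIV (?Q v)" if "continuous_on UNIV v" for v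
    unfolding par_def[abs_def] by (intro continuous_intros that c\<mu>)
  obtain K where K: "K \<ge> 0" "\<And>s i x. 0 < s \<Longrightarrow> s \<le> 1 \<Longrightarrow> x \<in> ?N \<Longrightarrow> norm (diff_quot s i w x) \<le> K"
    using diff_quot_bounded[OF w bounded_frontier_nbhd[OF \<Omega>(2)]] by metis
  have "compact (w ` closure ?N)"
    using bounded_frontier_nbhd[OF \<Omega>(2)] by (intro compact_continuous_image continuous_on_subset[OF cw]) auto
  then have "bounded (w ` closure ?N)" by (rule compact_imp_bounded)
  then obtain m where "\<forall>x\<in>closure ?N. norm (w x) \<le> m" unfolding bounded_iff ball_simps by (elim exE)
  then have m: "norm (w x) \<le> m" if "x \<in> ?N" for x
    using subsetD[OF closure_subset that] by (rule bspec)
  \<comment> \<open>The Leibniz rule for \<open>par \<mu> w\<close> costs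
    \<open>2 * L * norm (w x)\<close>; the maximum with 0 keeps the bound nonnegative when the
    neighbourhood is empty and \<open>m\<close> is arbitrary.\<close>
  define K' where "K' = K + 2 * L * max m 0"
  have K': "K' \<ge> 0" using K L by (simp add: K'_def)
  have QK: "norm (diff_quot s i (?Q w) x) \<le> K'" if "0 < s" "s \<le> 1" "x \<in> ?N" for s i x
  proof -
    have "norm (diff_quot s i (?Q w) x) \<le> norm (diff_quot s i w x) + 2 * L * norm (w x)"
      by (rule norm_diff_quot_par_le[OF \<mu> that(1)])
    also have "\<dots> \<le> K + 2 * L * max m 0"
      using K(2)[OF that, of i] m[OF that(3)] L by (intro add_mono mult_left_mono) auto
    finally show ?thesis by (simp add: K'_def)
  qed
  define c where "c = 2 * (real CARD('n))\<^sup>2 * hausdorff_const CARD('n)"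
  have c: "c \<ge> 0" using hausdorff_const_pos[of "CARD('n)"] by (simp add: c_def)
  show ?thesis
  proof (rule that[of "c * (K + K')"])
    show "c * (K + K') \<ge> 0" using c K K' by simp
    fix u :: "real^'n \<Rightarrow> real^'n" assume u: "C1_field u"
    let ?t = "perp \<mu> u" and ?z = "\<lambda>y. u y - w y"
    let ?b = "boundary_integral \<Omega> (\<lambda>x. norm (?t x))"
    have cu: "continuous_on UNIV u" using u by (rule C1_field_continuous)
    have ct: "continuous_on UNIV ?t" unfolding perp_def[abs_def] by (intro continuous_intros cu cQ)
    have cR: "continuous_on ({0..} \<times> UNIV) (remainder L u ?z)"
      by (intro continuous_on_remainder u C1_field_diff w)
    show "(LINT x:\<Omega>|lborel. (\<Sum>i\<in>UNIV. \<Sum>j\<in>UNIV. wedge i j (partial_vec i u x) (partial_vec j u x)))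
      \<le> (LINT x:\<Omega>|lborel. remainder L u ?z (0, x)) + c * (K + K') * ?b"
    proof (rule field_le_epsilon)
      fix e :: real assume "e > 0"
      define \<epsilon> where "\<epsilon> = e / (c * (K + K') + 1)"
      have pos: "c * (K + K') + 1 > 0" using c K K' by (intro add_nonneg_pos mult_nonneg_nonneg) auto
      then have \<epsilon>: "\<epsilon> > 0" using \<open>e > 0\<close> by (simp add: \<epsilon>_def)
      have "\<epsilon> * (c * (K + K') + 1) = e" using pos by (simp add: \<epsilon>_def)
      then have \<epsilon>e: "c * (K + K') * \<epsilon> \<le> e" using \<epsilon> by (simp add: algebra_simps)
      let ?I = "\<lambda>f. (LINT x:\<Omega>|lborel. f x)"
      have cc: "2 * (real CARD('n))\<^sup>2 * k * hausdorff_const CARD('n) * B = c * k * B" for k B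
        by (simp add: c_def)
      \<comment> \<open>\<open>perp \<mu> u\<close> is the left argument in one term and the right
        argument in the other, so each of the two divergence identities is used once to leave it
        undifferentiated.\<close>
      have ev1: "\<forall>\<^sub>F s in at_right 0. \<bar>?I (null_form s ?t w)\<bar> \<le> c * K * (?b + \<epsilon>)"
        using eventually_integral_null_form_right[OF ct cw K(1) \<epsilon> K(2)] by (simp only: cc)
      have ev2: "\<forall>\<^sub>F s in at_right 0. \<bar>?I (null_form s (?Q w) ?t)\<bar> \<le> c * K' * (?b + \<epsilon>)"
        using eventually_integral_null_form_left[OF cQ[OF cw] ct K' \<epsilon> QK] by (simp only: cc)
      have "\<forall>\<^sub>F s in at_right 0. ?I (null_form s u u) \<le> ?I (\<lambda>x. remainder L u ?z (s, x)) + c * (K + K') * (?b + \<epsilon>)"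
        using ev1 ev2 eventually_at_right_0_le_1
      proof eventually_elim
        case (elim s)
        have cRs: "continuous_on UNIV (\<lambda>x. remainder L u ?z (s, x))"
          using elim by (intro continuous_on_compose2[OF cR] continuous_intros) auto
        have i1: "set_integrable lborel \<Omega> (\<lambda>x. remainder L u ?z (s, x))"
          and i2: "set_integrable lborel \<Omega> (null_form s ?t w)"
          and i3: "set_integrable lborel \<Omega> (null_form s (?Q w) ?t)"
          and i0: "set_integrable lborel \<Omega> (null_form s u u)"
          by (intro set_integrable_continuous_bounded continuous_on_null_form cRs cu cw ct cQ \<Omega> borel_open)+
        have "?I (null_form s u u) \<le> ?I (\<lambda>x. remainder L u ?z (s, x) + null_form s ?t w x + null_form s (?Q w) ?t x)"
          using elim by (intro set_integral_mono i0 set_integral_add(1) i1 i2 i3 null_form_le_remainder[OF \<mu>]) auto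
        also have "\<dots> = ?I (\<lambda>x. remainder L u ?z (s, x)) + ?I (null_form s ?t w) + ?I (null_form s (?Q w) ?t)"
          by (simp only: set_integral_add(2)[OF set_integral_add(1)[OF i1 i2] i3] set_integral_add(2)[OF i1 i2])
        finally show ?case
          using elim unfolding distrib_left[of c] distrib_right by linarith
      qed
      moreover have "((\<lambda>s. ?I (\<lambda>x. remainder L u ?z (s, x)) + c * (K + K') * (?b + \<epsilon>)) \<longlongrightarrow>
          ?I (\<lambda>x. remainder L u ?z (0, x)) + c * (K + K') * (?b + \<epsilon>)) (at_right 0)"
        by (intro tendsto_intros tendsto_set_integral_at_right_0 cR \<Omega>)
      ultimately have "(LINT x:\<Omega>|lborel. (\<Sum>i\<in>UNIV. \<Sum>j\<in>UNIV. wedge i j (partial_vec i u x) (partial_vec j u x)))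
          \<le> ?I (\<lambda>x. remainder L u ?z (0, x)) + c * (K + K') * (?b + \<epsilon>)"
        using C1_null_form_limit[OF u] by (intro tendsto_le[of "at_right 0"]) auto
      then show "(LINT x:\<Omega>|lborel. (\<Sum>i\<in>UNIV. \<Sum>j\<in>UNIV. wedge i j (partial_vec i u x) (partial_vec j u x)))
          \<le> ?I (\<lambda>x. remainder L u ?z (0, x)) + c * (K + K') * ?b + e"
        using \<epsilon>e by (simp add: distrib_left)
    qed
  qed
qed

end

section \<open>The estimate for continuously differentiable fields\<close>

lemma norm_vec_power2: "(norm x)\<^sup>2 = (\<Sum>i\<in>UNIV. (norm (x $ i))\<^sup>2)" for x :: "'b::real_normed_vector^'n::finite"
  by (simp add: norm_vec_def L2_set_def real_sqrt_pow2 sum_nonneg)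

lemma L2_normsq_vec:
  fixes f :: "'a \<Rightarrow> 'b::real_normed_vector^'n::finite"
  assumes "\<And>i. (\<lambda>x. norm (f x $ i)) \<in> borel_measurable M"
  shows "L2_normsq M f = (\<Sum>i\<in>UNIV. L2_normsq M (\<lambda>x. f x $ i))"
proof -
  have "L2_normsq M f = (\<integral>\<^sup>+x. (\<Sum>i\<in>UNIV. ennreal ((norm (f x $ i))\<^sup>2)) \<partial>M)"
    unfolding L2_normsq_def norm_vec_power2[of "f _"] by (simp add: sum_ennreal)
  also have "\<dots> = (\<Sum>i\<in>UNIV. \<integral>\<^sup>+x. ennreal ((norm (f x $ i))\<^sup>2) \<partial>M)"
    using assms by (intro nn_integral_sum) auto
  finally show ?thesis by (simp add: L2_normsq_def)
qed

lemma L2_normsq_le: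
  assumes f: "(\<lambda>x. norm (f x)) \<in> borel_measurable M" and g: "(\<lambda>x. norm (g x)) \<in> borel_measurable M"
    and c: "c \<ge> 0" "d \<ge> 0" and le: "\<And>x. (norm (h x))\<^sup>2 \<le> c * (norm (f x))\<^sup>2 + d * (norm (g x))\<^sup>2"
  shows "L2_normsq M h \<le> ennreal c * L2_normsq M f + ennreal d * L2_normsq M g"
proof -
  have "L2_normsq M h \<le> (\<integral>\<^sup>+x. ennreal c * ennreal ((norm (f x))\<^sup>2) + ennreal d * ennreal ((norm (g x))\<^sup>2) \<partial>M)"
    unfolding L2_normsq_def using le c
    by (intro nn_integral_mono) (simp add: ennreal_leI flip: ennreal_mult ennreal_plus)
  also have "\<dots> = ennreal c * L2_normsq M f + ennreal d * L2_normsq M g"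
    unfolding L2_normsq_def using f g by (simp add: nn_integral_add nn_integral_cmult)
  finally show ?thesis .
qed

lemma power2_norm_add_le: "(norm (x + y))\<^sup>2 \<le> 2 * (norm x)\<^sup>2 + 2 * (norm y)\<^sup>2"
proof -
  have "(norm (x + y))\<^sup>2 \<le> (norm x + norm y)\<^sup>2" by (intro power_mono norm_triangle_ineq) auto
  also have "\<dots> \<le> 2 * (norm x)\<^sup>2 + 2 * (norm y)\<^sup>2"
    using zero_le_power2[of "norm x - norm y"] by (simp add: power2_eq_square algebra_simps)
  finally show ?thesis .
qed

lemma L2_normsq_triangle:
  assumes "(\<lambda>x. norm (f x)) \<in> borel_measurable M" "(\<lambda>x. norm (g x)) \<in> borel_measurable M"
  shows "L2_normsq M (\<lambda>x. f x + g x) \<le> 2 * L2_normsq M f + 2 * L2_normsq M g"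
  using L2_normsq_le[OF assms, of 2 2 "\<lambda>x. f x + g x"] power2_norm_add_le by auto

lemma L2_normsq_commute: "L2_normsq M (\<lambda>x. f x - g x) = L2_normsq M (\<lambda>x. g x - f x)"
  by (simp add: L2_normsq_def norm_minus_commute)

section \<open>Pointwise algebra of gradient, curl and divergence\<close>

definition jacobian :: "(real^'n::finite \<Rightarrow> real^'n) \<Rightarrow> real^'n \<Rightarrow> real^'n^'n" where
  "jacobian u x = (\<chi> l i. partial_vec i u x $ l)"

definition mat_curl :: "((real,'n::{finite,linorder}) vec,'n) vec \<Rightarrow> ((real,'n) vec,'n) vec" where
  "mat_curl A = (\<chi> i j. if i < j then A $ j $ i - A $ i $ j else 0)"

definition mat_div :: "real^'n^'n::finite \<Rightarrow> real" where
  "mat_div A = (\<Sum>i\<in>UNIV. A $ i $ i)"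

lemma mat_curl_add: "mat_curl (A + B) = mat_curl A + mat_curl B"
  by (simp add: mat_curl_def vec_eq_iff)

lemma mat_div_add: "mat_div (A + B) = mat_div A + mat_div B"
  by (simp add: mat_div_def sum.distrib)

lemma norm_mat_power2: "(norm A)\<^sup>2 = (\<Sum>i\<in>UNIV. \<Sum>j\<in>UNIV. (A $ i $ j)\<^sup>2)" for A :: "real^'n::finite^'m::finite"
  by (simp add: norm_vec_power2)

text \<open>\<open>mat_curl\<close> keeps each pair of indices once. Adding the sum with exchanged
  indices gives the sum of \<open>(A $ j $ i - A $ i $ j)\<^sup>2\<close> over all pairs, equal to
  twice the squared norm minus twice the trace of the square of \<open>A\<close>.\<close>

lemma norm_mat_eq_curl_div:
  fixes A :: "((real,'n::{finite,linorder}) vec,'n) vec"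
  shows "(norm A)\<^sup>2 = (\<Sum>i\<in>UNIV. \<Sum>j\<in>UNIV. A $ j $ i * A $ i $ j - A $ i $ i * A $ j $ j)
    + (norm (mat_curl A))\<^sup>2 + (mat_div A)\<^sup>2"
proof -
  let ?c = "\<lambda>i j. if i < j then (A $ j $ i - A $ i $ j)\<^sup>2 else 0"
  have "2 * (norm (mat_curl A))\<^sup>2 = (\<Sum>i\<in>UNIV. \<Sum>j\<in>UNIV. ?c i j) + (\<Sum>j\<in>UNIV. \<Sum>i\<in>UNIV. ?c i j)"
    by (subst (2) sum.swap) (simp add: norm_mat_power2 mat_curl_def if_distrib[of "\<lambda>x. x\<^sup>2"] cong: if_cong)
  also have "\<dots> = (\<Sum>i\<in>UNIV. \<Sum>j\<in>UNIV. ?c i j + ?c j i)" by (simp add: sum.distrib)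
  also have "\<dots> = (\<Sum>i\<in>UNIV. \<Sum>j\<in>UNIV. (A $ i $ j)\<^sup>2 + (A $ j $ i)\<^sup>2 - 2 * (A $ j $ i * A $ i $ j))"
    by (intro sum.cong refl) (auto simp: power2_eq_square algebra_simps not_less order_le_less)
  also have "\<dots> = (\<Sum>i\<in>UNIV. \<Sum>j\<in>UNIV. (A $ i $ j)\<^sup>2) + (\<Sum>i\<in>UNIV. \<Sum>j\<in>UNIV. (A $ j $ i)\<^sup>2)
      - 2 * (\<Sum>i\<in>UNIV. \<Sum>j\<in>UNIV. A $ j $ i * A $ i $ j)"
    by (simp add: sum.distrib sum_subtractf sum_distrib_left)
  also have "(\<Sum>i\<in>UNIV. \<Sum>j\<in>UNIV. (A $ j $ i)\<^sup>2) = (norm A)\<^sup>2"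
    unfolding norm_mat_power2 by (rule sum.swap)
  finally have "(norm (mat_curl A))\<^sup>2 = (norm A)\<^sup>2 - (\<Sum>i\<in>UNIV. \<Sum>j\<in>UNIV. A $ j $ i * A $ i $ j)"
    by (simp add: norm_mat_power2[of A])
  moreover have "(mat_div A)\<^sup>2 = (\<Sum>i\<in>UNIV. \<Sum>j\<in>UNIV. A $ i $ i * A $ j $ j)"
    by (simp add: mat_div_def power2_eq_square sum_product)
  ultimately show ?thesis by (simp add: sum_subtractf)
qed

lemma norm_mat_curl_le: "(norm (mat_curl A))\<^sup>2 \<le> 4 * (norm A)\<^sup>2"
proof -
  have "(norm (mat_curl A))\<^sup>2 \<le> (\<Sum>i\<in>UNIV. \<Sum>j\<in>UNIV. 2 * (A $ i $ j)\<^sup>2 + 2 * (A $ j $ i)\<^sup>2)"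
    unfolding norm_mat_power2[of "mat_curl A"]
  proof (intro sum_mono)
    fix i j
    show "(mat_curl A $ i $ j)\<^sup>2 \<le> 2 * (A $ i $ j)\<^sup>2 + 2 * (A $ j $ i)\<^sup>2"
      using zero_le_power2[of "A $ i $ j + A $ j $ i"] by (auto simp: mat_curl_def power2_eq_square algebra_simps)
  qed
  also have "\<dots> = 2 * (norm A)\<^sup>2 + 2 * (\<Sum>i\<in>UNIV. \<Sum>j\<in>UNIV. (A $ j $ i)\<^sup>2)"
    by (simp add: sum.distrib sum_distrib_left norm_mat_power2)
  also have "(\<Sum>i\<in>UNIV. \<Sum>j\<in>UNIV. (A $ j $ i)\<^sup>2) = (norm A)\<^sup>2"
    unfolding norm_mat_power2 by (rule sum.swap)
  finally show ?thesis by simp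
qed

lemma abs_mat_nth_le: "\<bar>A $ i $ j\<bar> \<le> norm A" for A :: "real^'n::finite^'m::finite"
  by (rule order_trans[OF component_le_norm_cart Finite_Cartesian_Product.norm_nth_le])

lemma mat_div_le: "(mat_div A)\<^sup>2 \<le> (real CARD('n))\<^sup>2 * (norm A)\<^sup>2" for A :: "real^'n^'n::finite"
proof -
  have "\<bar>mat_div A\<bar> \<le> (\<Sum>i\<in>(UNIV::'n set). norm A)"
    unfolding mat_div_def by (intro order_trans[OF sum_abs] sum_mono abs_mat_nth_le)
  then have "\<bar>mat_div A\<bar>\<^sup>2 \<le> (real CARD('n) * norm A)\<^sup>2" by (intro power_mono) auto
  then show ?thesis by (simp add: power_mult_distrib)
qed

lemma norm_partial_vec_le_jacobian: "norm (partial_vec i u x) \<le> norm (jacobian u x)"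
proof -
  have "(norm (partial_vec i u x))\<^sup>2 = (\<Sum>l\<in>UNIV. (jacobian u x $ l $ i)\<^sup>2)"
    by (simp add: norm_vec_power2 jacobian_def)
  also have "\<dots> \<le> (\<Sum>l\<in>UNIV. \<Sum>j\<in>UNIV. (jacobian u x $ l $ j)\<^sup>2)"
    by (intro sum_mono member_le_sum) auto
  finally show ?thesis unfolding norm_mat_power2[symmetric] by (rule power2_le_imp_le) simp
qed

lemma young: "a * b \<le> a\<^sup>2 / 8 + 2 * b\<^sup>2" for a b :: real
  using zero_le_power2[of "a - 4 * b"] by (simp add: power2_eq_square algebra_simps)

text \<open>The left side bounds the remainder at \<open>s = 0\<close>, with \<open>m\<close> the
  number of index pairs and \<open>g\<close>, \<open>N\<close>, \<open>h\<close>, \<open>M\<close>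
  the sizes of the gradient of \<open>u\<close>, of \<open>u\<close>, of the gradient of
  \<open>u - w\<close>, and of \<open>u - w\<close>. No term is quadratic in \<open>g\<close>, so
  Young's inequality with small weights leaves at most \<open>g\<^sup>2 / 2\<close>, which can be
  absorbed.\<close>

lemma absorption_inequality:
  fixes g N h M L m :: real
  assumes "m \<ge> 0"
  shows "m * (4 * (L * N) * (g + L * N) + 2 * (L * N)\<^sup>2 + 8 * (g + L * N) * (h + L * M))
    \<le> g\<^sup>2 / 2 + (6 * m * L\<^sup>2 + 32 * m\<^sup>2 * L\<^sup>2 + L\<^sup>2 + 256 * m\<^sup>2 + 256 * m\<^sup>2 * L\<^sup>2) * (N\<^sup>2 + h\<^sup>2 + M\<^sup>2)"
proof -
  have 1: "g * (4 * m * L * N) \<le> g\<^sup>2 / 8 + 32 * m\<^sup>2 * L\<^sup>2 * N\<^sup>2"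
    using young[of g "4 * m * L * N"] by (simp add: power_mult_distrib)
  have 2: "(g + L * N) * (8 * m * (h + L * M)) \<le> (g + L * N)\<^sup>2 / 8 + 128 * m\<^sup>2 * (h + L * M)\<^sup>2"
    using young[of "g + L * N" "8 * m * (h + L * M)"] by (simp add: power_mult_distrib)
  have 3: "(g + L * N)\<^sup>2 \<le> 2 * g\<^sup>2 + 2 * (L\<^sup>2 * N\<^sup>2)" "(h + L * M)\<^sup>2 \<le> 2 * h\<^sup>2 + 2 * (L * M)\<^sup>2"
    using power2_norm_add_le[of g "L * N"] power2_norm_add_le[of h "L * M"] by (auto simp: power_mult_distrib)
  have "128 * m\<^sup>2 * (h + L * M)\<^sup>2 \<le> 128 * m\<^sup>2 * (2 * h\<^sup>2 + 2 * (L * M)\<^sup>2)"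
    by (intro mult_left_mono 3) auto
  then have 4: "128 * m\<^sup>2 * (h + L * M)\<^sup>2 \<le> 256 * m\<^sup>2 * h\<^sup>2 + 256 * m\<^sup>2 * L\<^sup>2 * M\<^sup>2"
    by (simp add: power_mult_distrib algebra_simps)
  have "m * (4 * (L * N) * (g + L * N) + 2 * (L * N)\<^sup>2 + 8 * (g + L * N) * (h + L * M))
      = g * (4 * m * L * N) + 6 * m * L\<^sup>2 * N\<^sup>2 + (g + L * N) * (8 * m * (h + L * M))"
    by (simp add: algebra_simps power2_eq_square)
  also have "\<dots> \<le> g\<^sup>2 / 8 + 32 * m\<^sup>2 * L\<^sup>2 * N\<^sup>2 + 6 * m * L\<^sup>2 * N\<^sup>2 + (g\<^sup>2 / 4 + L\<^sup>2 * N\<^sup>2 / 4)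
      + 256 * m\<^sup>2 * h\<^sup>2 + 256 * m\<^sup>2 * L\<^sup>2 * M\<^sup>2"
    using 1 2 3(1) 4 by linarith
  also have "\<dots> \<le> g\<^sup>2 / 2 + (6 * m * L\<^sup>2 + 32 * m\<^sup>2 * L\<^sup>2 + L\<^sup>2 + 256 * m\<^sup>2 + 256 * m\<^sup>2 * L\<^sup>2) * (N\<^sup>2 + h\<^sup>2 + M\<^sup>2)"
  proof -
    have "g\<^sup>2 / 2 + (6 * m * L\<^sup>2 + 32 * m\<^sup>2 * L\<^sup>2 + L\<^sup>2 + 256 * m\<^sup>2 + 256 * m\<^sup>2 * L\<^sup>2) * (N\<^sup>2 + h\<^sup>2 + M\<^sup>2)
      = (g\<^sup>2 / 8 + 32 * m\<^sup>2 * L\<^sup>2 * N\<^sup>2 + 6 * m * L\<^sup>2 * N\<^sup>2 + (g\<^sup>2 / 4 + L\<^sup>2 * N\<^sup>2 / 4)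
        + 256 * m\<^sup>2 * h\<^sup>2 + 256 * m\<^sup>2 * L\<^sup>2 * M\<^sup>2)
        + (g\<^sup>2 / 8 + 3 / 4 * (L\<^sup>2 * N\<^sup>2) + L\<^sup>2 * h\<^sup>2 + L\<^sup>2 * M\<^sup>2 + 256 * m\<^sup>2 * (N\<^sup>2 + M\<^sup>2)
          + 256 * m\<^sup>2 * L\<^sup>2 * N\<^sup>2 + 288 * m\<^sup>2 * L\<^sup>2 * h\<^sup>2 + 32 * m\<^sup>2 * L\<^sup>2 * M\<^sup>2
          + 6 * m * L\<^sup>2 * (h\<^sup>2 + M\<^sup>2))"
      by (simp add: field_simps)
    moreover have "0 \<le> g\<^sup>2 / 8 + 3 / 4 * (L\<^sup>2 * N\<^sup>2) + L\<^sup>2 * h\<^sup>2 + L\<^sup>2 * M\<^sup>2 + 256 * m\<^sup>2 * (N\<^sup>2 + M\<^sup>2)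
          + 256 * m\<^sup>2 * L\<^sup>2 * N\<^sup>2 + 288 * m\<^sup>2 * L\<^sup>2 * h\<^sup>2 + 32 * m\<^sup>2 * L\<^sup>2 * M\<^sup>2
          + 6 * m * L\<^sup>2 * (h\<^sup>2 + M\<^sup>2)"
      using assms by simp
    ultimately show ?thesis by linarith
  qed
  finally show ?thesis .
qed

text \<open>At \<open>s = 0\<close> the commutation errors carrying the factor \<open>s\<close>
  disappear, in particular those quadratic in the gradient of \<open>u\<close>.\<close>

lemma (in finite_boundary) remainder_0_le:
  assumes L: "L \<ge> 0"
  defines "m \<equiv> (real CARD('n))\<^sup>2"
  shows "remainder L u z (0, x) \<le> (norm (jacobian u x))\<^sup>2 / 2
    + (6 * m * L\<^sup>2 + 32 * m\<^sup>2 * L\<^sup>2 + L\<^sup>2 + 256 * m\<^sup>2 + 256 * m\<^sup>2 * L\<^sup>2)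
      * ((norm (u x))\<^sup>2 + (norm (jacobian z x))\<^sup>2 + (norm (z x))\<^sup>2)"
proof -
  let ?g = "norm (jacobian u x)" and ?N = "norm (u x)" and ?h = "norm (jacobian z x)" and ?M = "norm (z x)"
  have "remainder L u z (0, x) = (\<Sum>i\<in>UNIV. \<Sum>j\<in>UNIV.
     2 * ((norm (partial_vec i u x) + L * ?N) * (L * ?N) + (L * ?N) * (norm (partial_vec j u x) + L * ?N) + (L * ?N) * (L * ?N))
     + 4 * (norm (partial_vec i u x) + L * ?N) * norm (partial_vec j z x)
     + 4 * (norm (partial_vec i z x) + 2 * L * ?M) * (norm (partial_vec j u x) + L * ?N))"
    by (simp add: remainder_def diff_quot_size_def diff_quot0_def)
  also have "\<dots> \<le> (\<Sum>i\<in>(UNIV::'n set). \<Sum>j\<in>(UNIV::'n set).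
     2 * ((?g + L * ?N) * (L * ?N) + (L * ?N) * (?g + L * ?N) + (L * ?N) * (L * ?N))
     + 4 * (?g + L * ?N) * ?h + 4 * (?h + 2 * L * ?M) * (?g + L * ?N))"
    using L by (intro sum_mono add_mono mult_mono mult_left_mono mult_right_mono norm_partial_vec_le_jacobian order_refl
        add_nonneg_nonneg mult_nonneg_nonneg) auto
  also have "\<dots> = m * (4 * (L * ?N) * (?g + L * ?N) + 2 * (L * ?N)\<^sup>2 + 8 * (?g + L * ?N) * (?h + L * ?M))"
    by (simp add: m_def power2_eq_square algebra_simps)
  also have "\<dots> \<le> ?g\<^sup>2 / 2 + (6 * m * L\<^sup>2 + 32 * m\<^sup>2 * L\<^sup>2 + L\<^sup>2 + 256 * m\<^sup>2 + 256 * m\<^sup>2 * L\<^sup>2) * (?N\<^sup>2 + ?h\<^sup>2 + ?M\<^sup>2)"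
    by (rule absorption_inequality) (simp add: m_def)
  finally show ?thesis .
qed

text \<open>The Sobolev norms are taken over \<open>lebesgue_on \<Omega>\<close>, the translation
  argument over \<open>lborel\<close>; continuous integrands link the two.\<close>

lemma nn_integral_lebesgue_on_continuous:
  fixes f :: "'a::euclidean_space \<Rightarrow> real"
  assumes "continuous_on UNIV f" "\<And>x. f x \<ge> 0" "open \<Omega>" "bounded \<Omega>"
  shows "(\<integral>\<^sup>+x. ennreal (f x) \<partial>lebesgue_on \<Omega>) = ennreal (LINT x:\<Omega>|lborel. f x)"
proof -
  have [measurable]: "f \<in> borel_measurable borel" "\<Omega> \<in> sets borel"
    using assms by (auto intro: borel_measurable_continuous_onI)
  have "(\<integral>\<^sup>+x. ennreal (f x) \<partial>lebesgue_on \<Omega>) = (\<integral>\<^sup>+x. ennreal (f x) * indicator \<Omega> x \<partial>lebesgue)"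
    using assms(3) by (intro nn_integral_restrict_space) auto
  also have "\<dots> = (\<integral>\<^sup>+x. ennreal (f x) * indicator \<Omega> x \<partial>lborel)"
    by (rule nn_integral_completion) measurable
  also have "\<dots> = (\<integral>\<^sup>+x. ennreal (indicator \<Omega> x *\<^sub>R f x) \<partial>lborel)"
    by (intro nn_integral_cong) (auto simp: indicator_def)
  also have "\<dots> = ennreal (LINT x:\<Omega>|lborel. f x)"
    unfolding set_lebesgue_integral_def using assms set_integrable_continuous_bounded[OF assms(1,4)]
    by (intro nn_integral_eq_integral) (auto simp: set_integrable_def)
  finally show ?thesis .
qed

lemma continuous_on_jacobian:
  assumes "C1_field u"
  shows "continuous_on UNIV (jacobian u)"
  unfolding jacobian_def[abs_def] partial_vec_def using assms
  by (intro continuous_on_vec_lambda) (simp add: C1_field_def C1_fun_def)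

lemma jacobian_diff: "C1_field u \<Longrightarrow> C1_field w \<Longrightarrow> jacobian (\<lambda>y. u y - w y) x = jacobian u x - jacobian w x"
  by (simp add: jacobian_def vec_eq_iff C1_field_diff)

lemma (in finite_boundary) L2_normsq_continuous:
  assumes "continuous_on UNIV f"
  shows "L2_normsq (lebesgue_on \<Omega>) f = ennreal (LINT x:\<Omega>|lborel. (norm (f x))\<^sup>2)"
  unfolding L2_normsq_def using assms \<Omega>
  by (intro nn_integral_lebesgue_on_continuous) (auto intro!: continuous_intros)

lemma continuous_on_mat_curl:
  assumes "continuous_on S f"
  shows "continuous_on S (\<lambda>x. mat_curl (f x))"
proof -
  have "continuous_on S (\<lambda>x. if i < j then f x $ j $ i - f x $ i $ j else 0)" for i j
    by (cases "i < j") (auto intro!: continuous_intros assms)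
  then show ?thesis unfolding mat_curl_def by (intro continuous_on_vec_lambda)
qed

lemma continuous_on_mat_div: "continuous_on S f \<Longrightarrow> continuous_on S (\<lambda>x. mat_div (f x))"
  unfolding mat_div_def by (intro continuous_intros)

text \<open>The order of quantifiers is the point: \<open>C\<close> comes before \<open>w\<close>,
  whereas \<open>M\<close> may depend on \<open>w\<close> but not on \<open>u\<close>.\<close>

lemma gaffney_C1:
  fixes \<Omega> :: "(real,'n::{finite,linorder}) vec set" and \<mu> :: "(real,'n) vec \<Rightarrow> (real,'n) vec"
  assumes fb: "finite_boundary \<Omega>"
    and \<mu>: "\<And>x y. norm (\<mu> x - \<mu> y) \<le> L * norm (x - y)" "\<And>x. norm (\<mu> x) \<le> 1"
  obtains C :: real where "C \<ge> 0"
    "\<And>w. C1_field w \<Longrightarrow> \<exists>M\<ge>0. \<forall>u. C1_field u \<longrightarrow>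
       L2_normsq (lebesgue_on \<Omega>) (jacobian u)
       \<le> ennreal C * (L2_normsq (lebesgue_on \<Omega>) (\<lambda>x. mat_curl (jacobian u x)) + L2_normsq (lebesgue_on \<Omega>) (\<lambda>x. mat_div (jacobian u x))
           + L2_normsq (lebesgue_on \<Omega>) u + L2_normsq (lebesgue_on \<Omega>) (\<lambda>x. jacobian u x - jacobian w x)
           + L2_normsq (lebesgue_on \<Omega>) (\<lambda>x. u x - w x))
         + ennreal M * (\<integral>\<^sup>+x. ennreal (norm (perp \<mu> u x)) \<partial>boundary_measure \<Omega>)"
proof -
  interpret finite_boundary \<Omega> by (rule fb)
  have L: "L \<ge> 0" by (rule L_nonneg[OF \<mu>])
  define m where "m = (real CARD('n))\<^sup>2"
  define D where "D = 6 * m * L\<^sup>2 + 32 * m\<^sup>2 * L\<^sup>2 + L\<^sup>2 + 256 * m\<^sup>2 + 256 * m\<^sup>2 * L\<^sup>2"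
  have D: "D \<ge> 0" by (simp add: D_def m_def)
  let ?I = "\<lambda>f :: (real,'n) vec \<Rightarrow> real. (LINT x:\<Omega>|lborel. f x)" and ?L = "\<lambda>f. L2_normsq (lebesgue_on \<Omega>) f"
  show ?thesis
  \<comment> \<open>Absorbing half of the gradient doubles everything else: curl and div receive 2,
    the terms with \<open>u\<close> and \<open>u - w\<close> receive \<open>2 * D\<close>, and the
    sum covers both.\<close>
  proof (rule that[of "2 * D + 2"])
    show "2 * D + 2 \<ge> 0" using D by simp
    fix w :: "(real,'n) vec \<Rightarrow> (real,'n) vec" assume w: "C1_field w"
    obtain M where M: "M \<ge> 0" "\<And>u. C1_field u \<Longrightarrow>
      ?I (\<lambda>x. \<Sum>i\<in>UNIV. \<Sum>j\<in>UNIV. wedge i j (partial_vec i u x) (partial_vec j u x))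
      \<le> ?I (\<lambda>x. remainder L u (\<lambda>y. u y - w y) (0, x)) + M * boundary_integral \<Omega> (\<lambda>x. norm (perp \<mu> u x))"
      using integral_null_form_le[OF \<mu> w] by blast
    show "\<exists>M\<ge>0. \<forall>u. C1_field u \<longrightarrow> ?L (jacobian u)
       \<le> ennreal (2 * D + 2) * (?L (\<lambda>x. mat_curl (jacobian u x)) + ?L (\<lambda>x. mat_div (jacobian u x)) + ?L u
           + ?L (\<lambda>x. jacobian u x - jacobian w x) + ?L (\<lambda>x. u x - w x))
         + ennreal M * (\<integral>\<^sup>+x. ennreal (norm (perp \<mu> u x)) \<partial>boundary_measure \<Omega>)"
    proof (intro exI[of _ "2 * M"] conjI allI impI)
      show "2 * M \<ge> 0" using M by simp
      fix u :: "(real,'n) vec \<Rightarrow> (real,'n) vec" assume u: "C1_field u"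
      let ?z = "\<lambda>y. u y - w y"
      have z: "C1_field ?z" by (rule C1_field_diff[OF u w])
      have cu: "continuous_on UNIV u" and cz: "continuous_on UNIV ?z"
        using u z by (auto intro: C1_field_continuous)
      note cJ = continuous_on_jacobian[OF u] and cJz = continuous_on_jacobian[OF z]
      note cc = continuous_on_mat_curl[OF cJ] and cd = continuous_on_mat_div[OF cJ]
      define a where "a = ?I (\<lambda>x. (norm (jacobian u x))\<^sup>2)"
      define b where "b = ?I (\<lambda>x. (norm (mat_curl (jacobian u x)))\<^sup>2)"
      define c where "c = ?I (\<lambda>x. (norm (mat_div (jacobian u x)))\<^sup>2)"
      define d where "d = ?I (\<lambda>x. (norm (u x))\<^sup>2)"
      define e where "e = ?I (\<lambda>x. (norm (jacobian ?z x))\<^sup>2)"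
      define f where "f = ?I (\<lambda>x. (norm (?z x))\<^sup>2)"
      define t where "t = boundary_integral \<Omega> (\<lambda>x. norm (perp \<mu> u x))"
      note defs = a_def b_def c_def d_def e_def f_def
      have nn: "0 \<le> a" "0 \<le> b" "0 \<le> c" "0 \<le> d" "0 \<le> e" "0 \<le> f" "0 \<le> t"
        by (auto simp: defs t_def boundary_integral_nonneg set_lebesgue_integral_def)
      have int: "set_integrable lborel \<Omega> (\<lambda>x. (norm (g x))\<^sup>2)" if "continuous_on UNIV g"
        for g :: "(real,'n) vec \<Rightarrow> 'b::real_normed_vector"
        using \<Omega> that by (intro set_integrable_continuous_bounded continuous_intros) auto
      note ints = int[OF cJ] int[OF cc] int[OF cd] int[OF cu] int[OF cJz] int[OF cz]
      have "?I (\<lambda>x. \<Sum>i\<in>UNIV. \<Sum>j\<in>UNIV. wedge i j (partial_vec i u x) (partial_vec j u x))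
          = ?I (\<lambda>x. (norm (jacobian u x))\<^sup>2 - (norm (mat_curl (jacobian u x)))\<^sup>2 - (norm (mat_div (jacobian u x)))\<^sup>2)"
      proof (intro arg_cong[where f = "?I"] ext)
        fix x
        show "(\<Sum>i\<in>UNIV. \<Sum>j\<in>UNIV. wedge i j (partial_vec i u x) (partial_vec j u x))
          = (norm (jacobian u x))\<^sup>2 - (norm (mat_curl (jacobian u x)))\<^sup>2 - (norm (mat_div (jacobian u x)))\<^sup>2"
          using norm_mat_eq_curl_div[of "jacobian u x"] by (simp add: jacobian_def wedge_def)
      qed
      also have "\<dots> = a - b - c"
        unfolding defs using ints by (simp add: set_integral_diff)
      finally have 1: "a - b - c \<le> ?I (\<lambda>x. remainder L u ?z (0, x)) + M * t"
        using M(2)[OF u] by (simp add: t_def)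
      have "?I (\<lambda>x. remainder L u ?z (0, x)) \<le> ?I (\<lambda>x. (norm (jacobian u x))\<^sup>2 / 2
          + D * ((norm (u x))\<^sup>2 + (norm (jacobian ?z x))\<^sup>2 + (norm (?z x))\<^sup>2))"
      proof (rule set_integral_mono)
        have "continuous_on UNIV (\<lambda>x. remainder L u ?z (0, x))"
          by (intro continuous_on_compose2[OF continuous_on_remainder[OF u z]] continuous_intros) auto
        then show "set_integrable lborel \<Omega> (\<lambda>x. remainder L u ?z (0, x))"
          using \<Omega> by (intro set_integrable_continuous_bounded) auto
        show "set_integrable lborel \<Omega> (\<lambda>x. (norm (jacobian u x))\<^sup>2 / 2
          + D * ((norm (u x))\<^sup>2 + (norm (jacobian ?z x))\<^sup>2 + (norm (?z x))\<^sup>2))"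
          using \<Omega> by (intro set_integrable_continuous_bounded continuous_intros cJ cJz cu cz) auto
        show "remainder L u ?z (0, x) \<le> (norm (jacobian u x))\<^sup>2 / 2
          + D * ((norm (u x))\<^sup>2 + (norm (jacobian ?z x))\<^sup>2 + (norm (?z x))\<^sup>2)" for x
          unfolding D_def m_def by (rule remainder_0_le[OF L])
      qed
      also have "\<dots> = a / 2 + D * (d + e + f)"
        unfolding defs using ints by (simp add: set_integral_add set_integral_divide_zero)
      finally have "a \<le> 2 * b + 2 * c + 2 * D * (d + e + f) + 2 * M * t" using 1 by (simp add: algebra_simps)
      also have "\<dots> \<le> (2 * D + 2) * (b + c + d + e + f) + 2 * M * t"
        using nn D by (simp add: algebra_simps)
      finally have "ennreal a \<le> ennreal ((2 * D + 2) * (b + c + d + e + f) + 2 * M * t)" by (rule ennreal_leI)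
      also have "\<dots> = ennreal (2 * D + 2) * (ennreal b + ennreal c + ennreal d + ennreal e + ennreal f)
          + ennreal (2 * M) * ennreal t"
      proof -
        have "ennreal b + ennreal c + ennreal d + ennreal e + ennreal f = ennreal (b + c + d + e + f)"
          using nn by simp
        moreover have "ennreal ((2 * D + 2) * (b + c + d + e + f)) = ennreal (2 * D + 2) * ennreal (b + c + d + e + f)"
          using nn D by (intro ennreal_mult) auto
        moreover have "ennreal (2 * M * t) = ennreal (2 * M) * ennreal t"
          using nn M(1) by (intro ennreal_mult) auto
        moreover have "ennreal ((2 * D + 2) * (b + c + d + e + f) + 2 * M * t)
            = ennreal ((2 * D + 2) * (b + c + d + e + f)) + ennreal (2 * M * t)"
          using nn D M(1) by (intro ennreal_plus) auto
        ultimately show ?thesis by (simp only:)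
      qed
      also have "ennreal t = (\<integral>\<^sup>+x. ennreal (norm (perp \<mu> u x)) \<partial>boundary_measure \<Omega>)"
      proof -
        have "L-lipschitz_on UNIV \<mu>" using \<mu>(1) L by (intro lipschitz_onI) (auto simp: dist_norm)
        then have c\<mu>: "continuous_on UNIV \<mu>" by (rule lipschitz_on_continuous_on)
        have "continuous_on UNIV (\<lambda>x. norm (perp \<mu> u x))"
          unfolding perp_def par_def by (intro continuous_intros cu c\<mu>)
        from nn_integral_boundary_measure_finite[OF \<Omega>(2,3) this] show ?thesis
          by (simp add: t_def boundary_integral_def)
      qed
      finally show "?L (jacobian u)
       \<le> ennreal (2 * D + 2) * (?L (\<lambda>x. mat_curl (jacobian u x)) + ?L (\<lambda>x. mat_div (jacobian u x)) + ?L u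
           + ?L (\<lambda>x. jacobian u x - jacobian w x) + ?L (\<lambda>x. u x - w x))
         + ennreal (2 * M) * (\<integral>\<^sup>+x. ennreal (norm (perp \<mu> u x)) \<partial>boundary_measure \<Omega>)"
        unfolding jacobian_diff[OF u w, symmetric] defs
        by (simp only: L2_normsq_continuous cJ cJz cc cd cu cz)
    qed
  qed
qed

section \<open>Passage to Sobolev fields\<close>

lemma C1_fun_lipschitz_on_cball:
  fixes f :: "real^'n::finite \<Rightarrow> real"
  assumes f: "C1_fun f"
  shows "\<exists>K. \<forall>x\<in>cball 0 R. \<forall>y\<in>cball 0 R. \<bar>f x - f y\<bar> \<le> K * norm (x - y)"
proof -
  let ?S = "cball 0 R :: (real^'n) set"
  define P where "P i k \<longleftrightarrow> (\<forall>x\<in>?S. \<bar>partial i f x\<bar> \<le> k)" for i k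
  have "\<exists>k. P i k" for i
  proof -
    have "continuous_on ?S (partial i f)"
      using f by (intro continuous_on_subset[of UNIV "partial i f" ?S]) (auto simp: C1_fun_def)
    then have "bounded (partial i f ` ?S)"
      by (intro compact_imp_bounded compact_continuous_image) auto
    then show ?thesis unfolding bounded_iff P_def by auto
  qed
  then obtain k where k: "\<And>i. P i (k i)" by metis
  have "\<bar>f x - f y\<bar> \<le> (\<Sum>i\<in>UNIV. \<bar>k i\<bar>) * norm (x - y)" if xy: "x \<in> ?S" "y \<in> ?S" for x y
  proof -
    have "norm (f x - f y) \<le> (\<Sum>i\<in>UNIV. \<bar>k i\<bar>) * norm (x - y)"
    proof (rule differentiable_bound[of ?S f "\<lambda>z. frechet_derivative f (at z)"])
      show "convex ?S" by (rule convex_cball)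
      fix z assume z: "z \<in> ?S"
      have der: "(f has_derivative frechet_derivative f (at z)) (at z)"
        using f frechet_derivative_works by (auto simp: C1_fun_def)
      then show "(f has_derivative frechet_derivative f (at z)) (at z within ?S)"
        by (rule has_derivative_at_withinI)
      have lin: "linear (frechet_derivative f (at z))" using der by (rule has_derivative_linear)
      \<comment> \<open>Expansion along the axes bounds the operator norm by the sum of the bounds
        for the partial derivatives.\<close>
      show "onorm (frechet_derivative f (at z)) \<le> (\<Sum>i\<in>UNIV. \<bar>k i\<bar>)"
      proof (rule onorm_le)
        fix v :: "real^'n"
        have "frechet_derivative f (at z) v = frechet_derivative f (at z) (\<Sum>i\<in>UNIV. (v $ i) *\<^sub>R axis i 1)"
          using basis_expansion[of v] by (simp add: scalar_mult_eq_scaleR)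
        also have "\<dots> = (\<Sum>i\<in>UNIV. v $ i * partial i f z)"
          by (simp add: linear_sum[OF lin] linear_scale[OF lin] partial_def)
        finally have "norm (frechet_derivative f (at z) v) \<le> (\<Sum>i\<in>UNIV. \<bar>v $ i * partial i f z\<bar>)"
          using sum_abs[of "\<lambda>i. v $ i * partial i f z" UNIV] by simp
        also have "\<dots> \<le> (\<Sum>i\<in>UNIV. norm v * \<bar>k i\<bar>)"
        proof (rule sum_mono)
          fix i
          have "\<bar>partial i f z\<bar> \<le> k i" using k[of i] z unfolding P_def by (rule bspec)
          then have "\<bar>partial i f z\<bar> \<le> \<bar>k i\<bar>" by linarith
          then show "\<bar>v $ i * partial i f z\<bar> \<le> norm v * \<bar>k i\<bar>"
            unfolding abs_mult by (intro mult_mono component_le_norm_cart) auto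
        qed
        finally show "norm (frechet_derivative f (at z) v) \<le> (\<Sum>i\<in>UNIV. \<bar>k i\<bar>) * norm v"
          by (simp add: sum_distrib_left mult.commute[of _ "norm v"])
      qed
    qed (use xy in auto)
    then show ?thesis by simp
  qed
  then show ?thesis by blast
qed

text \<open>The cut-off at \<open>\<delta>\<close> keeps the normalisation Lipschitz near the origin
  and changes nothing where the norm is at least \<open>\<delta>\<close>. One
  \<open>1 / \<delta>\<close> comes from the numerator, one from the denominator.\<close>

lemma lipschitz_normalize:
  fixes a b :: "'a::real_normed_vector"
  assumes "\<delta> > 0"
  shows "norm (a /\<^sub>R max (norm a) \<delta> - b /\<^sub>R max (norm b) \<delta>) \<le> 2 / \<delta> * norm (a - b)"
proof -
  let ?p = "max (norm a) \<delta>" and ?q = "max (norm b) \<delta>"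
  have p: "?p > 0" "?q > 0" "?p \<ge> \<delta>" using assms by auto
  have pq: "\<bar>?q - ?p\<bar> \<le> norm (a - b)"
    using norm_triangle_ineq3[of a b] by linarith
  have "a /\<^sub>R ?p - b /\<^sub>R ?q = (a - b) /\<^sub>R ?p + (1 / ?p - 1 / ?q) *\<^sub>R b"
    using p by (simp add: algebra_simps divide_inverse)
  moreover have "1 / ?p - 1 / ?q = (?q - ?p) / (?p * ?q)" using p by (simp add: field_simps)
  ultimately have "a /\<^sub>R ?p - b /\<^sub>R ?q = (a - b) /\<^sub>R ?p + ((?q - ?p) / (?p * ?q)) *\<^sub>R b" by (simp only:)
  then have "norm (a /\<^sub>R ?p - b /\<^sub>R ?q) \<le> norm ((a - b) /\<^sub>R ?p) + norm (((?q - ?p) / (?p * ?q)) *\<^sub>R b)"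
    by (metis norm_triangle_ineq)
  also have "norm ((a - b) /\<^sub>R ?p) = norm (a - b) / ?p" using p by (simp add: divide_inverse mult.commute)
  also have "norm (((?q - ?p) / (?p * ?q)) *\<^sub>R b) = \<bar>?q - ?p\<bar> / ?p * (norm b / ?q)"
    using p by (simp add: abs_mult)
  also have "\<bar>?q - ?p\<bar> / ?p * (norm b / ?q) \<le> norm (a - b) / ?p * 1"
    using p pq by (intro mult_mono divide_right_mono) auto
  also have "norm (a - b) / ?p + norm (a - b) / ?p * 1 = 2 * (norm (a - b) / ?p)" by simp
  also have "\<dots> \<le> 2 * (norm (a - b) / \<delta>)"
    using p assms by (intro mult_left_mono divide_left_mono) auto
  finally show ?thesis by (simp add: mult.commute)
qed

text \<open>Composing with the projection to a large ball makes the local Lipschitz bound global.\<close>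

lemma unit_lipschitz_extension:
  fixes \<Omega> :: "(real^'n::finite) set" and l :: "real^'n \<Rightarrow> real^'n"
  assumes "bounded \<Omega>" and l: "C_field_on 1 0 (frontier \<Omega>) l \<or> C_field_on 0 1 (frontier \<Omega>) l"
    and l0: "\<forall>x\<in>frontier \<Omega>. l x \<noteq> 0"
  obtains \<mu> L where "\<And>x y. norm (\<mu> x - \<mu> y) \<le> L * norm (x - y)" "\<And>x. norm (\<mu> x) \<le> 1"
    "\<And>x. x \<in> frontier \<Omega> \<Longrightarrow> norm (\<mu> x) = 1" "\<And>x. x \<in> frontier \<Omega> \<Longrightarrow> \<exists>c. \<mu> x = c *\<^sub>R l x"
proof -
  have cf: "compact (frontier \<Omega>)" by (rule compact_frontier_bounded[OF assms(1)])
  obtain R0 where "\<forall>x\<in>frontier \<Omega>. norm x \<le> R0"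
    using compact_imp_bounded[OF cf] unfolding bounded_iff by blast
  then have R: "frontier \<Omega> \<subseteq> cball 0 (max R0 0)" by force
  let ?B = "cball 0 (max R0 0) :: (real^'n) set"
  \<comment> \<open>Extension and Lipschitz constant are paired so that a single choice provides
    both for every component.\<close>
  define P where "P i FK \<longleftrightarrow> (\<forall>x\<in>frontier \<Omega>. fst FK x = l x $ i) \<and>
    (\<forall>x\<in>?B. \<forall>y\<in>?B. \<bar>fst FK x - fst FK y\<bar> \<le> snd FK * norm (x - y))"
    for i and FK :: "(real^'n \<Rightarrow> real) \<times> real"
  have "\<exists>FK. P i FK" for i
  proof -
    from l have "C_class_on 1 0 (frontier \<Omega>) (\<lambda>x. l x $ i) \<or> C_class_on 0 1 (frontier \<Omega>) (\<lambda>x. l x $ i)"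
      unfolding C_field_on_def by blast
    then show ?thesis
    proof
      assume "C_class_on 1 0 (frontier \<Omega>) (\<lambda>x. l x $ i)"
      then obtain F where F: "C1_fun F" "\<forall>x\<in>frontier \<Omega>. F x = l x $ i"
        unfolding C_class_on_def C_class_1_0_iff by blast
      obtain K where "\<forall>x\<in>?B. \<forall>y\<in>?B. \<bar>F x - F y\<bar> \<le> K * norm (x - y)"
        using C1_fun_lipschitz_on_cball[OF F(1)] by blast
      with F(2) show ?thesis by (intro exI[of _ "(F, K)"]) (simp add: P_def)
    next
      assume "C_class_on 0 1 (frontier \<Omega>) (\<lambda>x. l x $ i)"
      then obtain F where F: "C_class 0 1 F" "\<forall>x\<in>frontier \<Omega>. F x = l x $ i"
        unfolding C_class_on_def by blast
      then obtain K where "\<forall>x y. \<bar>F x - F y\<bar> \<le> K * dist x y powr 1" by auto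
      then have "\<forall>x y. \<bar>F x - F y\<bar> \<le> K * norm (x - y)" by (simp add: dist_norm)
      with F(2) show ?thesis by (intro exI[of _ "(F, K)"]) (simp add: P_def)
    qed
  qed
  then obtain FK where FK: "\<And>i. P i (FK i)" by metis
  define \<Lambda> where "\<Lambda> x = (\<chi> i. fst (FK i) x)" for x
  define K where "K = (\<Sum>i\<in>UNIV. \<bar>snd (FK i)\<bar>)"
  have \<Lambda>l: "\<Lambda> x = l x" if "x \<in> frontier \<Omega>" for x
    using FK that by (simp add: \<Lambda>_def P_def vec_eq_iff)
  have \<Lambda>lip: "norm (\<Lambda> x - \<Lambda> y) \<le> K * norm (x - y)" if "x \<in> ?B" "y \<in> ?B" for x y
  proof -
    have "norm (\<Lambda> x - \<Lambda> y) \<le> (\<Sum>i\<in>UNIV. \<bar>(\<Lambda> x - \<Lambda> y) $ i\<bar>)" by (rule norm_le_l1_cart)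
    also have "\<dots> \<le> (\<Sum>i\<in>UNIV. \<bar>snd (FK i)\<bar> * norm (x - y))"
    proof (rule sum_mono)
      fix i
      have "\<bar>(\<Lambda> x - \<Lambda> y) $ i\<bar> \<le> snd (FK i) * norm (x - y)"
        using FK[of i] that unfolding P_def \<Lambda>_def by simp
      also have "\<dots> \<le> \<bar>snd (FK i)\<bar> * norm (x - y)" by (intro mult_right_mono) auto
      finally show "\<bar>(\<Lambda> x - \<Lambda> y) $ i\<bar> \<le> \<bar>snd (FK i)\<bar> * norm (x - y)" .
    qed
    finally show ?thesis by (simp add: K_def sum_distrib_right)
  qed
  have K: "K \<ge> 0" by (simp add: K_def sum_nonneg)
  \<comment> \<open>On the compact frontier the continuous nonvanishing field attains a positive
    minimal norm; if the frontier is empty, any positive number will do.\<close>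
  have "\<exists>\<delta>>0. \<forall>x\<in>frontier \<Omega>. \<delta> \<le> norm (l x)"
  proof (cases "frontier \<Omega> = {}")
    case False
    have "K-lipschitz_on ?B \<Lambda>" using \<Lambda>lip K by (intro lipschitz_onI) (simp_all add: dist_norm)
    then have "continuous_on ?B \<Lambda>" by (rule lipschitz_on_continuous_on)
    then have "continuous_on (frontier \<Omega>) (\<lambda>x. norm (\<Lambda> x))"
      by (rule continuous_on_norm[OF continuous_on_subset[OF _ R]])
    from continuous_attains_inf[OF cf False this] obtain x0 where "x0 \<in> frontier \<Omega>" "\<forall>x\<in>frontier \<Omega>. norm (\<Lambda> x0) \<le> norm (\<Lambda> x)" by blast
    then show ?thesis by (intro exI[of _ "norm (l x0)"]) (simp add: l0 \<Lambda>l)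
  next
    case True
    then show ?thesis by (intro exI[of _ 1]) simp
  qed
  then obtain \<delta> where \<delta>: "\<delta> > 0" "\<And>x. x \<in> frontier \<Omega> \<Longrightarrow> \<delta> \<le> norm (l x)" by blast
  define p where "p x = closest_point ?B x" for x
  have pB: "p x \<in> ?B" for x unfolding p_def by (rule closest_point_in_set) auto
  have plip: "norm (p x - p y) \<le> norm (x - y)" for x y
    using closest_point_lipschitz[of ?B x y] by (simp add: p_def dist_norm)
  have p_id: "p x = x" if "x \<in> frontier \<Omega>" for x
    unfolding p_def using R that by (intro closest_point_self) auto
  define \<mu> where "\<mu> x = \<Lambda> (p x) /\<^sub>R max (norm (\<Lambda> (p x))) \<delta>" for x
  show ?thesis
  proof (rule that[of \<mu> "2 / \<delta> * K"])
    fix x y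
    have "norm (\<mu> x - \<mu> y) \<le> 2 / \<delta> * norm (\<Lambda> (p x) - \<Lambda> (p y))"
      unfolding \<mu>_def by (rule lipschitz_normalize[OF \<delta>(1)])
    also have "\<dots> \<le> 2 / \<delta> * (K * norm (x - y))"
      using \<delta>(1) K by (intro mult_left_mono order_trans[OF \<Lambda>lip[OF pB pB]] plip) auto
    finally show "norm (\<mu> x - \<mu> y) \<le> 2 / \<delta> * K * norm (x - y)" by (simp add: mult.assoc)
  next
    fix x show "norm (\<mu> x) \<le> 1"
      using \<delta>(1) by (simp add: \<mu>_def field_simps)
  next
    fix x assume x: "x \<in> frontier \<Omega>"
    then have eq: "\<mu> x = l x /\<^sub>R norm (l x)"
      using \<delta>(2)[OF x] by (simp add: \<mu>_def p_id \<Lambda>l max_def)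
    show "norm (\<mu> x) = 1" using eq l0 x by simp
    show "\<exists>c. \<mu> x = c *\<^sub>R l x" unfolding eq by (rule exI) (rule refl)
  qed
qed

text \<open>The relations for \<open>i < j\<close> extend to all pairs by antisymmetry and pass to
  the multiple \<open>\<mu> x\<close> of \<open>v\<close>. Contracting them with the unit vector
  \<open>\<mu> x\<close> gives \<open>T x\<close> back as its own component along
  \<open>\<mu> x\<close>.\<close>

lemma perp_eq_0_of_cross_prod:
  fixes v :: "(real,'n::{finite,linorder}) vec"
  assumes "cross_prod v (T x) = 0" "\<mu> x = c *\<^sub>R v" "norm (\<mu> x) = 1"
  shows "perp \<mu> T x = 0"
proof -
  have "v $ i * T x $ j = v $ j * T x $ i" if "i < j" for i j
    using arg_cong[OF assms(1), of "\<lambda>A. A $ i $ j"] that by (simp add: cross_prod_def)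
  then have "v $ i * T x $ j = v $ j * T x $ i" for i j
    by (metis linorder_less_linear)
  then have *: "\<mu> x $ i * T x $ j = \<mu> x $ j * T x $ i" for i j
    by (simp add: assms(2))
  have "(T x \<bullet> \<mu> x) * \<mu> x $ i = T x $ i" for i
  proof -
    have "(T x \<bullet> \<mu> x) * \<mu> x $ i = (\<Sum>j\<in>UNIV. \<mu> x $ j * (\<mu> x $ i * T x $ j))"
      by (simp add: inner_vec_def sum_distrib_left mult_ac)
    also have "\<dots> = (\<Sum>j\<in>UNIV. \<mu> x $ j * \<mu> x $ j) * T x $ i"
      unfolding * by (simp add: sum_distrib_right sum_distrib_left mult_ac)
    also have "(\<Sum>j\<in>UNIV. \<mu> x $ j * \<mu> x $ j) = 1"
      using assms(3) by (simp add: norm_eq_1 inner_vec_def)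
    finally show ?thesis by simp
  qed
  then show ?thesis by (simp add: perp_def par_def vec_eq_iff)
qed

lemma borel_measurable_vec:
  fixes f :: "'a \<Rightarrow> 'b::euclidean_space^'n::finite"
  assumes "\<And>i. (\<lambda>x. f x $ i) \<in> borel_measurable M"
  shows "f \<in> borel_measurable M"
proof (rule borel_measurable_euclidean_space[THEN iffD2], rule ballI)
  fix b :: "'b^'n" assume "b \<in> Basis"
  then obtain i u where b: "b = axis i u" by (auto simp: Basis_vec_def)
  show "(\<lambda>x. f x \<bullet> b) \<in> borel_measurable M"
    unfolding b inner_axis using assms[of i] by measurable
qed

lemma L2_normsq_vec_tendsto_0:
  fixes f :: "nat \<Rightarrow> 'a \<Rightarrow> 'b::euclidean_space^'n::finite"
  assumes "\<And>k i. (\<lambda>x. f k x $ i) \<in> borel_measurable M"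
    and "\<And>i. (\<lambda>k. L2_normsq M (\<lambda>x. f k x $ i)) \<longlonglongrightarrow> 0"
  shows "(\<lambda>k. L2_normsq M (f k)) \<longlonglongrightarrow> 0"
proof -
  have "(\<lambda>k. \<Sum>i\<in>UNIV. L2_normsq M (\<lambda>x. f k x $ i)) \<longlonglongrightarrow> (\<Sum>i\<in>(UNIV::'n set). 0)"
    by (intro tendsto_sum assms)
  moreover have "L2_normsq M (f k) = (\<Sum>i\<in>UNIV. L2_normsq M (\<lambda>x. f k x $ i))" for k
    by (rule L2_normsq_vec) (rule measurable_compose[OF assms(1) borel_measurable_norm])
  ultimately show ?thesis by simp
qed

lemma perp_diff: "perp \<mu> (\<lambda>y. u y - w y) x = perp \<mu> u x - perp \<mu> w x"
  by (simp add: perp_def par_diff)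

text \<open>Weighted AM-GM in place of the Cauchy-Schwarz inequality.\<close>

lemma nn_integral_perp_le:
  fixes \<Omega> :: "(real^'n::finite) set" and u T :: "real^'n \<Rightarrow> real^'n"
  assumes le1: "\<And>x. norm (\<mu> x) \<le> 1" and "\<eta> > 0"
    and T0: "AE x in boundary_measure \<Omega>. perp \<mu> T x = 0"
    and meas: "(\<lambda>x. norm (u x - T x)) \<in> borel_measurable (boundary_measure \<Omega>)"
  shows "(\<integral>\<^sup>+x. ennreal (norm (perp \<mu> u x)) \<partial>boundary_measure \<Omega>)
    \<le> ennreal \<eta> * hausdorff_outer (CARD('n) - 1) (frontier \<Omega>)
      + ennreal (1 / \<eta>) * L2_normsq (boundary_measure \<Omega>) (\<lambda>x. u x - T x)"
proof -
  let ?M = "boundary_measure \<Omega>"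
  have "(\<integral>\<^sup>+x. ennreal (norm (perp \<mu> u x)) \<partial>?M)
      \<le> (\<integral>\<^sup>+x. ennreal \<eta> + ennreal (1 / \<eta>) * ennreal ((norm (u x - T x))\<^sup>2) \<partial>?M)"
  proof (rule nn_integral_mono_AE, use T0 in eventually_elim)
    case (elim x)
    let ?d = "norm (u x - T x)"
    \<comment> \<open>Subtracting \<open>T\<close> changes nothing, because \<open>perp\<close> is
      linear and kills \<open>T\<close> here; the size of \<open>u - T\<close> then controls the
      left side.\<close>
    have "perp \<mu> u x = perp \<mu> (\<lambda>y. u y - T y) x" using elim by (simp add: perp_diff)
    also have "norm \<dots> \<le> ?d + norm (par \<mu> (\<lambda>y. u y - T y) x)"
      unfolding perp_def by (rule norm_triangle_ineq4)
    also have "norm (par \<mu> (\<lambda>y. u y - T y) x) \<le> ?d" by (rule norm_par_le) (rule le1)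
    finally have "norm (perp \<mu> u x) \<le> 2 * ?d" by simp
    also have "\<dots> \<le> \<eta> + 1 / \<eta> * ?d\<^sup>2"
    proof -
      have "0 \<le> (\<eta> - ?d)\<^sup>2 / \<eta>" using \<open>\<eta> > 0\<close> by simp
      also have "\<dots> = \<eta> + 1 / \<eta> * ?d\<^sup>2 - 2 * ?d" using \<open>\<eta> > 0\<close> by (simp add: field_simps power2_eq_square)
      finally show ?thesis by simp
    qed
    finally have "ennreal (norm (perp \<mu> u x)) \<le> ennreal (\<eta> + 1 / \<eta> * ?d\<^sup>2)" by (rule ennreal_leI)
    also have "\<dots> = ennreal \<eta> + ennreal (1 / \<eta> * ?d\<^sup>2)" using \<open>\<eta> > 0\<close> by (intro ennreal_plus) auto
    also have "ennreal (1 / \<eta> * ?d\<^sup>2) = ennreal (1 / \<eta>) * ennreal (?d\<^sup>2)" using \<open>\<eta> > 0\<close> by (intro ennreal_mult) auto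
    finally show ?case .
  qed
  also have "\<dots> = (\<integral>\<^sup>+x. ennreal \<eta> \<partial>?M) + (\<integral>\<^sup>+x. ennreal (1 / \<eta>) * ennreal ((norm (u x - T x))\<^sup>2) \<partial>?M)"
    using meas by (intro nn_integral_add) auto
  also have "(\<integral>\<^sup>+x. ennreal (1 / \<eta>) * ennreal ((norm (u x - T x))\<^sup>2) \<partial>?M)
      = ennreal (1 / \<eta>) * L2_normsq ?M (\<lambda>x. u x - T x)"
    unfolding L2_normsq_def using meas by (intro nn_integral_cmult) auto
  finally show ?thesis by (simp add: emeasure_boundary_measure)
qed

lemma L2_normsq_diff_triangle:
  fixes f g h :: "'a \<Rightarrow> 'b::euclidean_space"
  assumes "f \<in> borel_measurable M" "g \<in> borel_measurable M" "h \<in> borel_measurable M"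
    and "L2_normsq M (\<lambda>x. f x - g x) \<le> a" "L2_normsq M (\<lambda>x. h x - g x) \<le> b"
  shows "L2_normsq M (\<lambda>x. f x - h x) \<le> 2 * a + 2 * b"
proof -
  have "L2_normsq M (\<lambda>x. (f x - g x) + (g x - h x)) \<le> 2 * L2_normsq M (\<lambda>x. f x - g x) + 2 * L2_normsq M (\<lambda>x. g x - h x)"
    by (rule L2_normsq_triangle; rule measurable_compose[OF _ borel_measurable_norm])
      (intro borel_measurable_diff assms)+
  also have "\<dots> \<le> 2 * a + 2 * b"
    unfolding L2_normsq_commute[of M g] by (intro add_mono mult_left_mono assms) auto
  finally show ?thesis by simp
qed

theorem theorem4:
  fixes \<Omega> :: "(real,'n::{finite,linorder}) vec set"
    and l :: "(real,'n) vec \<Rightarrow> (real,'n) vec"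
  assumes "CARD('n) \<ge> 2"
    and "bounded \<Omega>" and "lipschitz_set \<Omega>"
    and "C_field_on 1 0 (frontier \<Omega>) l \<or> (CARD('n) = 2 \<and> C_field_on 0 1 (frontier \<Omega>) l)"
    and "\<forall>x\<in>frontier \<Omega>. l x \<noteq> 0"
  shows "\<exists>C::real. \<forall>\<omega> T. H1_field \<Omega> \<omega> \<and> has_trace_field \<Omega> \<omega> T \<and>
           (AE x in boundary_measure \<Omega>. cross_prod (l x) (T x) = 0) \<longrightarrow>
           L2_normsq (lebesgue_on \<Omega>) (grad_field \<Omega> \<omega>)
             \<le> ennreal C * (L2_normsq (lebesgue_on \<Omega>) (curl_field \<Omega> \<omega>)
                           + L2_normsq (lebesgue_on \<Omega>) (div_field \<Omega> \<omega>)
                           + L2_normsq (lebesgue_on \<Omega>) \<omega>)"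
proof -
  have op: "open \<Omega>" using assms(3) by (simp add: lipschitz_set_def)
  have Hfin: "hausdorff_outer (CARD('n) - 1) (frontier \<Omega>) < \<infinity>"
    by (rule hausdorff_outer_frontier_finite[OF assms(2,3)])
  have fb: "finite_boundary \<Omega>" using op assms(2) Hfin by unfold_locales
  obtain h where h: "hausdorff_outer (CARD('n) - 1) (frontier \<Omega>) = ennreal h" "h \<ge> 0"
    using Hfin by (cases "hausdorff_outer (CARD('n) - 1) (frontier \<Omega>)") auto
  have l: "C_field_on 1 0 (frontier \<Omega>) l \<or> C_field_on 0 1 (frontier \<Omega>) l" using assms(4) by blast
  obtain \<mu> L where \<mu>: "\<And>x y. norm (\<mu> x - \<mu> y) \<le> L * norm (x - y)" "\<And>x. norm (\<mu> x) \<le> 1"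
    "\<And>x. x \<in> frontier \<Omega> \<Longrightarrow> norm (\<mu> x) = 1" "\<And>x. x \<in> frontier \<Omega> \<Longrightarrow> \<exists>c. \<mu> x = c *\<^sub>R l x"
    using unit_lipschitz_extension[OF assms(2) l assms(5)] by metis
  let ?N = "lebesgue_on \<Omega>" and ?M = "boundary_measure \<Omega>"
  obtain C where C: "C \<ge> 0"
    "\<And>w. C1_field w \<Longrightarrow> \<exists>M\<ge>0. \<forall>u. C1_field u \<longrightarrow> L2_normsq ?N (jacobian u)
       \<le> ennreal C * (L2_normsq ?N (\<lambda>x. mat_curl (jacobian u x)) + L2_normsq ?N (\<lambda>x. mat_div (jacobian u x))
           + L2_normsq ?N u + L2_normsq ?N (\<lambda>x. jacobian u x - jacobian w x) + L2_normsq ?N (\<lambda>x. u x - w x))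
         + ennreal M * (\<integral>\<^sup>+x. ennreal (norm (perp \<mu> u x)) \<partial>?M)"
    using gaffney_C1[OF fb \<mu>(1,2)] by blast
  define n where "n = real CARD('n)"
  show ?thesis
  \<comment> \<open>One factor 2 is lost in passing from the gradient of \<open>\<omega>\<close> to
    that of an approximation, another in passing back from the curl, divergence and norm of the
    approximation to those of \<open>\<omega>\<close>.\<close>
  proof (intro exI[of _ "4 * C"] allI impI, elim conjE)
    fix \<omega> T :: "(real,'n) vec \<Rightarrow> (real,'n) vec"
    assume H1: "H1_field \<Omega> \<omega>" and tr: "has_trace_field \<Omega> \<omega> T"
      and AE: "AE x in ?M. cross_prod (l x) (T x) = 0"
    let ?G = "grad_field \<Omega> \<omega>"
    define P where "P i \<phi> \<longleftrightarrow> (\<forall>k. smooth_fun (\<phi> k)) \<and>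
        (\<lambda>k. L2_normsq ?N (\<lambda>x. \<phi> k x - \<omega> x $ i)) \<longlonglongrightarrow> 0 \<and>
        (\<forall>j. (\<lambda>k. L2_normsq ?N (\<lambda>x. partial j (\<phi> k) x - weak_partial \<Omega> j (\<lambda>y. \<omega> y $ i) x)) \<longlonglongrightarrow> 0) \<and>
        (\<lambda>k. L2_normsq ?M (\<lambda>x. \<phi> k x - T x $ i)) \<longlonglongrightarrow> 0" for i \<phi>
    have "\<exists>\<phi>. P i \<phi>" for i
      using tr unfolding has_trace_field_def has_trace_def P_def by blast
    then obtain \<phi> where \<phi>: "\<And>i. P i (\<phi> i)" by metis
    \<comment> \<open>The trace relation supplies approximations for each component separately.
      Assembled with a common index they converge at once in the Sobolev norm inside and to
      \<open>T\<close> on the boundary.\<close>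
    define u where "u k x = (\<chi> i. \<phi> i k x)" for k x
    have sm: "smooth_fun (\<phi> i k)" for i k using \<phi>[of i] by (simp add: P_def)
    have uC1: "C1_field (u k)" for k
      using sm unfolding C1_field_def C_class_1_0_iff[symmetric] u_def smooth_fun_def by simp
    have contN: "f \<in> borel_measurable ?N" if "continuous_on UNIV f" for f :: "(real,'n) vec \<Rightarrow> 'b::topological_space"
      using borel_measurable_continuous_onI[OF that]
      by (intro measurable_restrict_space1 measurable_completion) simp
    have contM: "f \<in> borel_measurable ?M" if "continuous_on UNIV f" for f :: "(real,'n) vec \<Rightarrow> 'b::topological_space"
      using borel_measurable_boundary_measure[OF borel_measurable_continuous_onI[OF that]] .
    have \<omega>m: "\<omega> \<in> borel_measurable ?N"
      by (rule borel_measurable_vec) (use H1 in \<open>simp add: H1_field_def H1_def L2_def\<close>)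
    have wm: "weak_partial \<Omega> j (\<lambda>y. \<omega> y $ i) \<in> borel_measurable ?N" for i j
      using H1 by (simp add: H1_field_def H1_def L2_def)
    have Gm: "?G \<in> borel_measurable ?N"
      by (intro borel_measurable_vec) (simp add: grad_field_def wm)
    have Tm: "T \<in> borel_measurable ?M"
      by (rule borel_measurable_vec) (use tr in \<open>simp add: has_trace_field_def has_trace_def L2_def\<close>)
    have um: "u k \<in> borel_measurable ?N" "u k \<in> borel_measurable ?M" for k
      using contN contM C1_field_continuous[OF uC1] by auto
    have Jm: "jacobian (u k) \<in> borel_measurable ?N" for k
      using contN continuous_on_jacobian[OF uC1] by auto
    have nth_m: "(\<lambda>x. f x $ i) \<in> borel_measurable M" if "f \<in> borel_measurable M"
      for f :: "(real,'n) vec \<Rightarrow> ('b::euclidean_space,'n) vec" and M i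
      using that by (rule measurable_compose) (intro borel_measurable_continuous_onI continuous_intros)
    have du: "(\<lambda>k. L2_normsq ?N (\<lambda>x. u k x - \<omega> x)) \<longlonglongrightarrow> 0"
    proof (rule L2_normsq_vec_tendsto_0)
      show "(\<lambda>x. (u k x - \<omega> x) $ i) \<in> borel_measurable ?N" for k i
        by (intro nth_m borel_measurable_diff um \<omega>m)
      show "(\<lambda>k. L2_normsq ?N (\<lambda>x. (u k x - \<omega> x) $ i)) \<longlonglongrightarrow> 0" for i
        using \<phi>[of i] by (simp add: P_def u_def)
    qed
    have dJ: "(\<lambda>k. L2_normsq ?N (\<lambda>x. jacobian (u k) x - ?G x)) \<longlonglongrightarrow> 0"
    proof (intro L2_normsq_vec_tendsto_0[where f = "\<lambda>k x. jacobian (u k) x - ?G x"]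
        L2_normsq_vec_tendsto_0[where f = "\<lambda>k x. (jacobian (u k) x - ?G x) $ i" for i])
      show "(\<lambda>x. (jacobian (u k) x - ?G x) $ i) \<in> borel_measurable ?N" for k i
        by (intro nth_m borel_measurable_diff Jm Gm)
      show "(\<lambda>x. (jacobian (u k) x - ?G x) $ i $ j) \<in> borel_measurable ?N" for k i j
        by (intro nth_m borel_measurable_diff Jm Gm)
      show "(\<lambda>k. L2_normsq ?N (\<lambda>x. (jacobian (u k) x - ?G x) $ i $ j)) \<longlonglongrightarrow> 0" for i j
        using \<phi>[of i] by (simp add: P_def u_def jacobian_def partial_vec_def grad_field_def)
    qed
    have dT: "(\<lambda>k. L2_normsq ?M (\<lambda>x. u k x - T x)) \<longlonglongrightarrow> 0"
    proof (rule L2_normsq_vec_tendsto_0)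
      show "(\<lambda>x. (u k x - T x) $ i) \<in> borel_measurable ?M" for k i
        by (intro nth_m borel_measurable_diff um Tm)
      show "(\<lambda>k. L2_normsq ?M (\<lambda>x. (u k x - T x) $ i)) \<longlonglongrightarrow> 0" for i
        using \<phi>[of i] by (simp add: P_def u_def)
    qed
    have T0: "AE x in ?M. perp \<mu> T x = 0"
      using AE AE_space
    proof eventually_elim
      case (elim x)
      then have "x \<in> frontier \<Omega>" by (simp add: boundary_measure_def space_restrict_space)
      then show ?case using \<mu>(3,4) elim perp_eq_0_of_cross_prod by metis
    qed
    have curl: "curl_field \<Omega> \<omega> = (\<lambda>x. mat_curl (?G x))"
      by (simp add: fun_eq_iff curl_field_def mat_curl_def grad_field_def)
    have div: "div_field \<Omega> \<omega> = (\<lambda>x. mat_div (?G x))"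
      by (simp add: fun_eq_iff div_field_def mat_div_def grad_field_def)
    define X where "X = L2_normsq ?N (\<lambda>x. mat_curl (?G x)) + L2_normsq ?N (\<lambda>x. mat_div (?G x)) + L2_normsq ?N \<omega>"
    define a where "a k = L2_normsq ?N (\<lambda>x. jacobian (u k) x - ?G x) + L2_normsq ?N (\<lambda>x. u k x - \<omega> x)" for k
    have a0: "a \<longlonglongrightarrow> 0"
      using tendsto_add[OF dJ du] by (simp add: a_def[abs_def])
    \<comment> \<open>The coefficients of \<open>a k\<close> in \<open>b2\<close> to
      \<open>b6\<close>. Finiteness is what counts: it gives \<open>e * a k\<close> the limit
      0.\<close>
    define e where "e = (8 + ennreal (2 * n\<^sup>2) + 2 + 2 + 2 :: ennreal)"
    have e: "e < top" by (simp add: e_def ennreal_add_less_top)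
    have norm_m: "(\<lambda>x. norm (f x)) \<in> borel_measurable M"
      if "f \<in> borel_measurable M" for f :: "(real,'n) vec \<Rightarrow> 'b::euclidean_space" and M
      by (rule measurable_compose[OF that borel_measurable_norm])
    have JGm: "(\<lambda>x. jacobian (u k) x - ?G x) \<in> borel_measurable ?N" for k
      by (intro borel_measurable_diff Jm Gm)
    have u\<omega>m: "(\<lambda>x. u k x - \<omega> x) \<in> borel_measurable ?N" for k
      by (intro borel_measurable_diff um \<omega>m)
    have curl_m: "(\<lambda>x. mat_curl (?G x)) \<in> borel_measurable ?N"
      by (rule measurable_compose[OF Gm]) (intro borel_measurable_continuous_onI continuous_on_mat_curl continuous_on_id)
    have div_m: "(\<lambda>x. mat_div (?G x)) \<in> borel_measurable ?N"
      by (rule measurable_compose[OF Gm]) (intro borel_measurable_continuous_onI continuous_on_mat_div continuous_on_id)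
    have aJ: "L2_normsq ?N (\<lambda>x. jacobian (u k) x - ?G x) \<le> a k" and au: "L2_normsq ?N (\<lambda>x. u k x - \<omega> x) \<le> a k" for k
      by (simp_all add: a_def)
    \<comment> \<open>Taking the zero field and negated fields in the triangle inequality gives a
      bound for \<open>?G\<close> itself; \<open>b4\<close> is obtained likewise.\<close>
    have b1: "L2_normsq ?N ?G \<le> 2 * L2_normsq ?N (jacobian (u k)) + 2 * a k" for k
      using L2_normsq_diff_triangle[of "\<lambda>_. 0" ?N "\<lambda>x. - jacobian (u k) x" "\<lambda>x. - ?G x" "L2_normsq ?N (jacobian (u k))" "a k"]
        Jm Gm aJ[of k] L2_normsq_commute[of ?N ?G "jacobian (u k)"] by simp
    have b2: "L2_normsq ?N (\<lambda>x. mat_curl (jacobian (u k) x)) \<le> 2 * L2_normsq ?N (\<lambda>x. mat_curl (?G x)) + 8 * a k" for k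
    proof -
      have "L2_normsq ?N (\<lambda>x. mat_curl (jacobian (u k) x))
          \<le> ennreal 2 * L2_normsq ?N (\<lambda>x. mat_curl (?G x)) + ennreal 8 * L2_normsq ?N (\<lambda>x. jacobian (u k) x - ?G x)"
      proof (rule L2_normsq_le[OF norm_m[OF curl_m] norm_m[OF JGm]])
        fix x
        have "(norm (mat_curl (jacobian (u k) x)))\<^sup>2 \<le> 2 * (norm (mat_curl (?G x)))\<^sup>2 + 2 * (norm (mat_curl (jacobian (u k) x - ?G x)))\<^sup>2"
          using power2_norm_add_le[of "mat_curl (?G x)" "mat_curl (jacobian (u k) x - ?G x)"] by (simp flip: mat_curl_add)
        with norm_mat_curl_le[of "jacobian (u k) x - ?G x"]
        show "(norm (mat_curl (jacobian (u k) x)))\<^sup>2 \<le> 2 * (norm (mat_curl (?G x)))\<^sup>2 + 8 * (norm (jacobian (u k) x - ?G x))\<^sup>2"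
          by linarith
      qed auto
      also have "\<dots> \<le> 2 * L2_normsq ?N (\<lambda>x. mat_curl (?G x)) + 8 * a k" using aJ[of k] by (simp add: add_left_mono mult_left_mono)
      finally show ?thesis .
    qed
    have b3: "L2_normsq ?N (\<lambda>x. mat_div (jacobian (u k) x)) \<le> 2 * L2_normsq ?N (\<lambda>x. mat_div (?G x)) + ennreal (2 * n\<^sup>2) * a k" for k
    proof -
      have "L2_normsq ?N (\<lambda>x. mat_div (jacobian (u k) x))
          \<le> ennreal 2 * L2_normsq ?N (\<lambda>x. mat_div (?G x)) + ennreal (2 * n\<^sup>2) * L2_normsq ?N (\<lambda>x. jacobian (u k) x - ?G x)"
      proof (rule L2_normsq_le[OF norm_m[OF div_m] norm_m[OF JGm]])
        fix x
        have "(norm (mat_div (jacobian (u k) x)))\<^sup>2 \<le> 2 * (norm (mat_div (?G x)))\<^sup>2 + 2 * (norm (mat_div (jacobian (u k) x - ?G x)))\<^sup>2"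
          using power2_norm_add_le[of "mat_div (?G x)" "mat_div (jacobian (u k) x - ?G x)"] by (simp flip: mat_div_add)
        with mat_div_le[of "jacobian (u k) x - ?G x"]
        show "(norm (mat_div (jacobian (u k) x)))\<^sup>2 \<le> 2 * (norm (mat_div (?G x)))\<^sup>2 + 2 * n\<^sup>2 * (norm (jacobian (u k) x - ?G x))\<^sup>2"
          by (simp add: n_def)
      qed auto
      also have "\<dots> \<le> 2 * L2_normsq ?N (\<lambda>x. mat_div (?G x)) + ennreal (2 * n\<^sup>2) * a k"
        using aJ[of k] by (simp add: add_left_mono mult_left_mono)
      finally show ?thesis .
    qed
    have b4: "L2_normsq ?N (u k) \<le> 2 * L2_normsq ?N \<omega> + 2 * a k" for k
      using L2_normsq_diff_triangle[of "\<lambda>_. 0" ?N "\<lambda>x. - \<omega> x" "\<lambda>x. - u k x" "L2_normsq ?N \<omega>" "a k"]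
        um \<omega>m au[of k] L2_normsq_commute[of ?N \<omega> "u k"] by simp
    have b5: "L2_normsq ?N (\<lambda>x. jacobian (u k) x - jacobian (u m) x) \<le> 2 * a k + 2 * a m" for k m
      by (rule L2_normsq_diff_triangle[OF Jm Gm Jm aJ aJ])
    have b6: "L2_normsq ?N (\<lambda>x. u k x - u m x) \<le> 2 * a k + 2 * a m" for k m
      by (rule L2_normsq_diff_triangle[OF um(1) \<omega>m um(1) au au])
    have sum: "L2_normsq ?N (\<lambda>x. mat_curl (jacobian (u k) x)) + L2_normsq ?N (\<lambda>x. mat_div (jacobian (u k) x)) + L2_normsq ?N (u k)
        + L2_normsq ?N (\<lambda>x. jacobian (u k) x - jacobian (u m) x) + L2_normsq ?N (\<lambda>x. u k x - u m x)
        \<le> 2 * X + e * a k + (2 + 2) * a m" for k m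
    proof -
      have "L2_normsq ?N (\<lambda>x. mat_curl (jacobian (u k) x)) + L2_normsq ?N (\<lambda>x. mat_div (jacobian (u k) x)) + L2_normsq ?N (u k)
        + L2_normsq ?N (\<lambda>x. jacobian (u k) x - jacobian (u m) x) + L2_normsq ?N (\<lambda>x. u k x - u m x)
        \<le> (2 * L2_normsq ?N (\<lambda>x. mat_curl (?G x)) + 8 * a k)
          + (2 * L2_normsq ?N (\<lambda>x. mat_div (?G x)) + ennreal (2 * n\<^sup>2) * a k)
          + (2 * L2_normsq ?N \<omega> + 2 * a k) + (2 * a k + 2 * a m) + (2 * a k + 2 * a m)"
        by (intro add_mono b2 b3 b4 b5 b6)
      also have "\<dots> = 2 * X + e * a k + (2 + 2) * a m"
        unfolding X_def e_def distrib_left distrib_right by (simp only: add_ac)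
      finally show ?thesis .
    qed
    \<comment> \<open>The comparison field is \<open>u m\<close>, and \<open>B\<close> depends on
      \<open>m\<close>. First \<open>k\<close> tends to infinity for fixed \<open>\<eta>\<close>,
      since the boundary error carries the factor \<open>1 / \<eta>\<close>; then
      \<open>\<eta>\<close> tends to 0, which removes the term with the measure \<open>h\<close> of
      the frontier. The limit in \<open>m\<close> is left for the end, when no constant depending on
      \<open>m\<close> remains.\<close>
    have lim: "L2_normsq ?N ?G \<le> 2 * (ennreal C * (2 * X + (2 + 2) * a m))" for m
    proof -
      obtain B where B: "B \<ge> 0" "\<And>k. L2_normsq ?N (jacobian (u k))
          \<le> ennreal C * (L2_normsq ?N (\<lambda>x. mat_curl (jacobian (u k) x)) + L2_normsq ?N (\<lambda>x. mat_div (jacobian (u k) x))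
             + L2_normsq ?N (u k) + L2_normsq ?N (\<lambda>x. jacobian (u k) x - jacobian (u m) x) + L2_normsq ?N (\<lambda>x. u k x - u m x))
           + ennreal B * (\<integral>\<^sup>+x. ennreal (norm (perp \<mu> (u k) x)) \<partial>?M)"
        using C(2)[OF uC1[of m]] uC1 by blast
      let ?b = "\<lambda>k. L2_normsq ?M (\<lambda>x. u k x - T x)"
      have k_bound: "L2_normsq ?N ?G \<le> 2 * (ennreal C * (2 * X + e * a k + (2 + 2) * a m)
          + ennreal B * (ennreal \<eta> * ennreal h + ennreal (1 / \<eta>) * ?b k)) + 2 * a k" if "\<eta> > 0" for k \<eta>
      proof -
        have "(\<integral>\<^sup>+x. ennreal (norm (perp \<mu> (u k) x)) \<partial>?M) \<le> ennreal \<eta> * ennreal h + ennreal (1 / \<eta>) * ?b k"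
          unfolding h(1)[symmetric]
          by (rule nn_integral_perp_le[OF \<mu>(2) that T0]) (intro norm_m borel_measurable_diff um Tm)
        then show ?thesis
          by (intro order_trans[OF b1[of k]] add_right_mono mult_left_mono order_trans[OF B(2)] add_mono sum) auto
      qed
      have \<eta>_bound: "L2_normsq ?N ?G \<le> 2 * (ennreal C * (2 * X + (2 + 2) * a m) + ennreal B * (ennreal \<eta> * ennreal h))"
        if "\<eta> > 0" for \<eta>
      proof (rule LIMSEQ_le_const)
        have "(\<lambda>k. 2 * (ennreal C * (2 * X + e * a k + (2 + 2) * a m)
          + ennreal B * (ennreal \<eta> * ennreal h + ennreal (1 / \<eta>) * ?b k)) + 2 * a k) \<longlonglongrightarrow>
           2 * (ennreal C * (2 * X + e * 0 + (2 + 2) * a m) + ennreal B * (ennreal \<eta> * ennreal h + ennreal (1 / \<eta>) * 0)) + 2 * 0"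
          by (intro tendsto_add ennreal_tendsto_cmult tendsto_const a0 dT e) auto
        then show "(\<lambda>k. 2 * (ennreal C * (2 * X + e * a k + (2 + 2) * a m)
          + ennreal B * (ennreal \<eta> * ennreal h + ennreal (1 / \<eta>) * ?b k)) + 2 * a k) \<longlonglongrightarrow>
           2 * (ennreal C * (2 * X + (2 + 2) * a m) + ennreal B * (ennreal \<eta> * ennreal h))"
          by simp
      qed (use k_bound[OF that] in blast)
      show ?thesis
      proof (rule LIMSEQ_le_const)
        have "(\<lambda>k. ennreal (inverse (real (Suc k)))) \<longlonglongrightarrow> ennreal 0"
          by (intro tendsto_ennrealI LIMSEQ_inverse_real_of_nat)
        then have "(\<lambda>k. ennreal h * ennreal (inverse (real (Suc k)))) \<longlonglongrightarrow> ennreal h * 0"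
          by (intro ennreal_tendsto_cmult) auto
        then have "(\<lambda>k. ennreal (inverse (real (Suc k))) * ennreal h) \<longlonglongrightarrow> 0"
          by (simp add: mult.commute)
        then have "(\<lambda>k. 2 * (ennreal C * (2 * X + (2 + 2) * a m) + ennreal B * (ennreal (inverse (real (Suc k))) * ennreal h)))
            \<longlonglongrightarrow> 2 * (ennreal C * (2 * X + (2 + 2) * a m) + ennreal B * 0)"
          by (intro tendsto_add ennreal_tendsto_cmult tendsto_const) auto
        then show "(\<lambda>k. 2 * (ennreal C * (2 * X + (2 + 2) * a m) + ennreal B * (ennreal (inverse (real (Suc k))) * ennreal h)))
            \<longlonglongrightarrow> 2 * (ennreal C * (2 * X + (2 + 2) * a m))"
          by simp
      qed (use \<eta>_bound[of "inverse (real (Suc _))"] in auto)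
    qed
    have "L2_normsq ?N ?G \<le> 2 * (ennreal C * (2 * X + (2 + 2) * 0))"
    proof (rule LIMSEQ_le_const)
      show "(\<lambda>m. 2 * (ennreal C * (2 * X + (2 + 2) * a m))) \<longlonglongrightarrow> 2 * (ennreal C * (2 * X + (2 + 2) * 0))"
        by (intro tendsto_add ennreal_tendsto_cmult tendsto_const a0) auto
    qed (use lim in blast)
    also have "\<dots> = ennreal (4 * C) * X"
    proof -
      have "ennreal (4 * C) = 2 * 2 * ennreal C" using C(1) by (simp add: ennreal_mult)
      then show ?thesis by (simp add: mult_ac)
    qed
    finally show "L2_normsq ?N ?G \<le> ennreal (4 * C) * (L2_normsq ?N (curl_field \<Omega> \<omega>) + L2_normsq ?N (div_field \<Omega> \<omega>) + L2_normsq ?N \<omega>)"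
      by (simp add: X_def curl div)
  qed
qed

end
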